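(* Let $m\ge3$, $n,r\ge1$, $1\le p\le m-2$ and $p\le k\le n-m+p$ be integers with $\min\left(\binom{k}{p},\binom{n-k-1}{m-p-1}\right)\ge r$. Let $\mathcal F_m=\omega_1\mu_1^{\otimes m}+\cdots+\omega_r\mu_r^{\otimes m}$ with $\omega_i\in\mathbb C$ and $\mu_i=((\mu_i)_0,(\mu_i)_1,\dots,(\mu_i)_n)\in\mathbb C^{n+1}$. Assume: (i) the scalars $\omega_i$ and the leading entry $(\mu_i)_0$ of each $\mu_i$ are nonzero; (ii) the vectors $\{[(\mu_i)_{1:n}]_{\mathscr B_0}\}_{i=1}^r$ are linearly independent; (iii) the vectors $\{[(\mu_i)_{1:n}]_{\mathcal O_\alpha}\}_{i=1}^r$ are linearly independent for all $\alpha\in\mathscr B_1$; (iv) the eigenvalues of the matrix $N(\xi)$ are distinct from each other. Let $q_i=(\omega_i)^{1/m}\mu_i$, and let $\hat q_i$ and $q_i^*$ be, respectively, the intermediate and the output vectors of the incomplete tensor approximation algorithm (described in the context) applied to $(\widehat{\mathcal F}_m)_{\Omega_m}$. If the distance $\epsilon:=\|(\widehat{\mathcal F}_m-\mathcal F_m)_{\Omega_m}\|$ is small enough, then there exist scalars $\hat\eta_i,\eta_i^*$ such that $$(\hat\eta_i)^m=(\eta_i^* )^m=1,\qquad \|\hat\eta_i\hat q_i-q_i\|=O(\epsilon),\qquad \|\eta_i^*q_i^*-q_i\|=O(\epsilon)$$ for $i=1,\dots,r$, up to a permutation of $(q_1,\dots,q_r)$, where the constants inside $O(\cdot)$ only depend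 on $\mathcal F_m$ and the choice of $\xi$ in the algorithm.
   Context: Tensor indices run over $0,1,\dots,n$. With $x=(x_1,\dots,x_n)$ and $x_0:=1$, the entries of a symmetric tensor $\mathcal F$ of order $m$ over $\mathbb C^{n+1}$ are also labelled by $\alpha\in\mathbb N^n$ with $|\alpha|\le m$ (or by the monomial $x^\alpha$): $\mathcal F_\alpha=\mathcal F_{i_1\dots i_m}$ whenever $x_0^{m-|\alpha|}x^\alpha=x_{i_1}\cdots x_{i_m}$. Monomials are identified with their exponents. $\Omega_m$ is the set of index tuples $(i_1,\dots,i_m)$ with pairwise distinct entries, and $(\cdot)_{\Omega_m}$ denotes restriction to these entries. $\|\cdot\|$ is the Euclidean/Frobenius/Hilbert–Schmidt norm; $c^{1/m}$ is the principal $m$th root; $v_{1:n}=(v_1,\dots,v_n)$. $\widehat{\mathcal F}_m$ is a symmetric tensor of order $m$ over $\mathbb C^{n+1}$ approximating $\mathcal F_m$. $\mathscr B_0$: the first $r$ monomials, in graded lexicographic order, of $\{x_{i_1}\cdots x_{i_p}:1\le i_1<\dots<i_p\le k\}$. $\mathscr B_1=\{x_{j_1}\cdots x_{j_{p+1}}:1\le j_1<\dots<j_p\le k<j_{p+1}\le n\}$. For $\alpha=e_{j_1}+\dots+e_{j_{p+1}}\in\mathscr B_1$ (with $j_{p+1}>k$), $\mathcal O_\alpha$ is the set of tuples $(s_1,\dots,s_{m-p-1})$ with $k+1\le s_1<\dots<s_{m-p-1}\le n$ and all $s_t\ne j_{p+1}$, identified with monomials $x_{s_1}\cdots x_{s_{m-p-1}}$.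 For a finite set $\mathscr B$ of monomials and a vector $v$, $[v]_{\mathscr B}=(f(v))_{f\in\mathscr B}$. For a tensor $\mathcal F$: $A[\alpha,\mathcal F]_{\gamma,\beta}=\mathcal F_{\beta+\gamma}$, $b[\alpha,\mathcal F]_\gamma=\mathcal F_{\alpha+\gamma}$ for $\gamma\in\mathcal O_\alpha$, $\beta\in\mathscr B_0$. For $G\in\mathbb C^{\mathscr B_0\times\mathscr B_1}$ and $l=k+1,\dots,n$, $N_l(G)\in\mathbb C^{r\times r}$ is given by $N_l(G)_{\nu,\beta}=G(\beta,\nu+e_l)$, $\nu,\beta\in\mathscr B_0$. In (iv), $N(\xi)=\sum_{l=k+1}^n\xi_lN_l(G)$, where $G$ is the matrix determined by $A[\alpha,\mathcal F_m]G(:,\alpha)=b[\alpha,\mathcal F_m]$ for all $\alpha\in\mathscr B_1$ (uniquely solvable under (i)–(iii)), and $\xi=(\xi_{k+1},\dots,\xi_n)$ is the vector chosen in the algorithm. Index sets: $J_1=\{x_{i_1}\cdots x_{i_p}:1\le i_1<\dots<i_p\le k\}$; $J_1^{-j}$ is the set of monomials in $J_1$ not involving $x_j$; $J_2=\{x_{i_1}\cdots x_{i_{m-p-1}}:k+1\le i_1<\dots<i_{m-p-1}\le n\}$; $J_3=\{x_{i_1-k}\cdots x_{i_{m-p-1}-k}: x_{i_1}\cdots x_{i_{m-p-1}}\in J_2\}$. Products of such sets are sets of products of monomials, arranged as matrices/tensors. Algorithm (input $r$, $d=n+1$, $p$, $(\widehat{\mathcal F}_m)_{\Omega_m}$): Step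 1. For each $\alpha\in\mathscr B_1$ let $\widehat G(:,\alpha)$ be the minimizer over $g\in\mathbb C^{\mathscr B_0}$ of $\|A[\alpha,\widehat{\mathcal F}_m]g-b[\alpha,\widehat{\mathcal F}_m]\|^2$. Step 2. For a generic vector $\xi=(\xi_{k+1},\dots,\xi_n)$ let $\widehat N(\xi)=\sum_l\xi_lN_l(\widehat G)$, let $\hat z_1,\dots,\hat z_r$ be unit-length eigenvectors of $\widehat N(\xi)$, and $\hat w_i=(\hat z_i^HN_{k+1}(\widehat G)\hat z_i,\dots,\hat z_i^HN_n(\widehat G)\hat z_i)$. Step 3. Let $(\hat\gamma_1,\dots,\hat\gamma_r)$, $\hat\gamma_i\in\mathbb C^{J_1}$, be the minimizer of $\|(\widehat{\mathcal F}_m)_{J_1\cdot J_2}-\sum_i\gamma_i\otimes[\hat w_i]_{J_3}\|^2$. For each $j\in\{1,\dots,k\}$ let $((\hat v_1)_j,\dots,(\hat v_r)_j)$ be the minimizer of $\|(\widehat{\mathcal F}_m)_{x_j\cdot J_1^{-j}\cdot J_2}-\sum_i(v_i)_j\hat\gamma_i\otimes[\hat w_i]_{J_3}\|^2$, with $\hat\gamma_i$ restricted to the labels in $J_1^{-j}$. With $\hat u_i=(\hat v_i,\hat w_i)$, let $(\hat\lambda_1,\dots,\hat\lambda_r)$ be the minimizer of $\|(\widehat{\mathcal F}_m)_{\Omega_m}-\sum_i\lambda_i((1,\hat u_i)^{\otimes m})_{\Omega_m}\|^2$. Step 4. Let $\hat q_i=(\hat\lambda_i)^{1/m}(1,\hat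 v_i,\hat w_i)$. Using $(\hat q_1,\dots,\hat q_r)$ as starting point, solve $\min_{(q_1,\dots,q_r)}\|(\widehat{\mathcal F}_m)_{\Omega_m}-\sum_i(q_i^{\otimes m})_{\Omega_m}\|^2$ and let $(q_1^*,\dots,q_r^* )$ be the minimizer. Output: $q_1^*,\dots,q_r^*$.
   Formalization: The claim on the intermediate vectors q̂_i is made only if for all i and all j in {1,…,k} some monomial in J_1^{-j} is nonzero at μ_i (otherwise the Step 3 problem for (v_i)_j is singular and the claim fails); the claim on q_i^* has no such condition. *)

theory Defs
  imports "HOL-Analysis.Analysis" "HOL-Library.Multiset" "HOL-Combinatorics.Permutations"
begin

text \<open>
  Order-m tensors over C^(n+1) are functions on index lists; only lists of length m with entries
  in {0..n} matter. Monomials in x_1, x_2, ... (and their exponents) are multisets of variable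
  indices, so that product of monomials is \<open>+\<close> and degree is \<open>size\<close>. Matrices and vectors whose
  rows or columns are labelled by a finite set are functions on the labels; values outside the
  label set are never used. Families indexed by i = 1, ..., r are functions on nat.
\<close>

type_synonym monomial = "nat multiset"
type_synonym tensor = "nat list \<Rightarrow> complex"

definition frob_norm :: "'a set \<Rightarrow> ('a \<Rightarrow> complex) \<Rightarrow> real" where
  "frob_norm A f = L2_set (\<lambda>a. norm (f a)) A"

definition lin_indep :: "nat \<Rightarrow> 'a set \<Rightarrow> (nat \<Rightarrow> 'a \<Rightarrow> complex) \<Rightarrow> bool" where
  "lin_indep r S a \<longleftrightarrow>
     (\<forall>c :: nat \<Rightarrow> complex. (\<forall>s\<in>S. (\<Sum>i=1..r. c i * a i s) = 0) \<longrightarrow> (\<forall>i\<in>{1..r}. c i = 0))"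

definition minimizer :: "('a \<Rightarrow> real) \<Rightarrow> 'a \<Rightarrow> bool" where
  "minimizer f x \<longleftrightarrow> is_arg_min f (\<lambda>_. True) x"

definition index_tuples :: "nat \<Rightarrow> nat \<Rightarrow> nat list set" where
  "index_tuples m n = {I. length I = m \<and> set I \<subseteq> {0..n}}"

definition Omega_set :: "nat \<Rightarrow> nat \<Rightarrow> nat list set" where
  "Omega_set m n = {I \<in> index_tuples m n. distinct I}"

definition symmetric_tensor :: "nat \<Rightarrow> nat \<Rightarrow> tensor \<Rightarrow> bool" where
  "symmetric_tensor m n F \<longleftrightarrow> (\<forall>I\<in>index_tuples m n. \<forall>J. mset J = mset I \<longrightarrow> F J = F I)"

definition tensor_power :: "(nat \<Rightarrow> complex) \<Rightarrow> tensor" where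
  "tensor_power v I = (\<Prod>i\<leftarrow>I. v i)"

text \<open>The entry of an order-m tensor labelled by a monomial f of degree at most m: the index 0
  fills up the remaining positions. For symmetric tensors the order of the indices is immaterial.\<close>

definition entry :: "nat \<Rightarrow> tensor \<Rightarrow> monomial \<Rightarrow> complex" where
  "entry m F f = F (replicate (m - size f) 0 @ sorted_list_of_multiset f)"

definition mono_eval :: "monomial \<Rightarrow> (nat \<Rightarrow> complex) \<Rightarrow> complex" where
  "mono_eval f v = (\<Prod>j\<in>#f. v j)"

definition sqfree_monomials :: "nat set \<Rightarrow> nat \<Rightarrow> monomial set" where
  "sqfree_monomials A d = {mset_set S |S. S \<subseteq> A \<and> card S = d}"

text \<open>Graded lexicographic order, listing the monomials as 1, x_1, x_2, ..., x_1^2, x_1 x_2, ...\<close>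

definition grlex_precedes :: "monomial \<Rightarrow> monomial \<Rightarrow> bool" where
  "grlex_precedes f g \<longleftrightarrow> size f < size g \<or>
     (size f = size g \<and> (\<exists>i. count f i > count g i \<and> (\<forall>j<i. count f j = count g j)))"

definition J1 :: "nat \<Rightarrow> nat \<Rightarrow> monomial set" where
  "J1 p k = sqfree_monomials {1..k} p"

definition J1_without :: "nat \<Rightarrow> nat \<Rightarrow> nat \<Rightarrow> monomial set" where
  "J1_without p k j = {f \<in> J1 p k. j \<notin># f}"

definition J2 :: "nat \<Rightarrow> nat \<Rightarrow> nat \<Rightarrow> nat \<Rightarrow> monomial set" where
  "J2 m n p k = sqfree_monomials {k+1..n} (m - p - 1)"

text \<open>The bijection from \<open>J2\<close> to J_3, which replaces x_i by x_(i-k).\<close>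

definition shift_mono :: "nat \<Rightarrow> monomial \<Rightarrow> monomial" where
  "shift_mono k g = image_mset (\<lambda>i. i - k) g"

definition B0 :: "nat \<Rightarrow> nat \<Rightarrow> nat \<Rightarrow> monomial set" where
  "B0 r p k = {f \<in> J1 p k. card {g \<in> J1 p k. grlex_precedes g f} < r}"

definition B1 :: "nat \<Rightarrow> nat \<Rightarrow> nat \<Rightarrow> monomial set" where
  "B1 n p k = {f + {#l#} |f l. f \<in> J1 p k \<and> l \<in> {k+1..n}}"

definition O_set :: "nat \<Rightarrow> nat \<Rightarrow> nat \<Rightarrow> nat \<Rightarrow> monomial \<Rightarrow> monomial set" where
  "O_set m n p k \<alpha> = sqfree_monomials ({k+1..n} - set_mset \<alpha>) (m - p - 1)"

definition A_mat :: "nat \<Rightarrow> tensor \<Rightarrow> monomial \<Rightarrow> monomial \<Rightarrow> complex" where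
  "A_mat m F \<gamma> \<beta> = entry m F (\<beta> + \<gamma>)"

definition b_vec :: "nat \<Rightarrow> tensor \<Rightarrow> monomial \<Rightarrow> monomial \<Rightarrow> complex" where
  "b_vec m F \<alpha> \<gamma> = entry m F (\<alpha> + \<gamma>)"

text \<open>The residual A[alpha,F] g - b[alpha,F], whose rows are labelled by \<open>O_set m n p k \<alpha>\<close>.\<close>

definition residual ::
  "nat \<Rightarrow> nat \<Rightarrow> nat \<Rightarrow> nat \<Rightarrow> tensor \<Rightarrow> monomial \<Rightarrow> (monomial \<Rightarrow> complex) \<Rightarrow> monomial \<Rightarrow> complex" where
  "residual m r p k F \<alpha> g \<gamma> = (\<Sum>\<beta>\<in>B0 r p k. A_mat m F \<gamma> \<beta> * g \<beta>) - b_vec m F \<alpha> \<gamma>"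

definition solves_linear_systems ::
  "nat \<Rightarrow> nat \<Rightarrow> nat \<Rightarrow> nat \<Rightarrow> nat \<Rightarrow> tensor \<Rightarrow> (monomial \<Rightarrow> monomial \<Rightarrow> complex) \<Rightarrow> bool" where
  "solves_linear_systems m n r p k F G \<longleftrightarrow>
     (\<forall>\<alpha>\<in>B1 n p k. \<forall>\<gamma>\<in>O_set m n p k \<alpha>. residual m r p k F \<alpha> (\<lambda>\<beta>. G \<beta> \<alpha>) \<gamma> = 0)"

definition N_l :: "(monomial \<Rightarrow> monomial \<Rightarrow> complex) \<Rightarrow> nat \<Rightarrow> monomial \<Rightarrow> monomial \<Rightarrow> complex" where
  "N_l G l \<nu> \<beta> = G \<beta> (\<nu> + {#l#})"

definition N_xi ::
  "nat \<Rightarrow> nat \<Rightarrow> (nat \<Rightarrow> complex) \<Rightarrow> (monomial \<Rightarrow> monomial \<Rightarrow> complex) \<Rightarrow> monomial \<Rightarrow> monomial \<Rightarrow> complex" where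
  "N_xi n k \<xi> G \<nu> \<beta> = (\<Sum>l=k+1..n. \<xi> l * N_l G l \<nu> \<beta>)"

definition eigenpair :: "'a set \<Rightarrow> ('a \<Rightarrow> 'a \<Rightarrow> complex) \<Rightarrow> complex \<Rightarrow> ('a \<Rightarrow> complex) \<Rightarrow> bool" where
  "eigenpair B M \<theta> z \<longleftrightarrow>
     (\<exists>\<nu>\<in>B. z \<nu> \<noteq> 0) \<and> (\<forall>\<nu>\<in>B. (\<Sum>\<beta>\<in>B. M \<nu> \<beta> * z \<beta>) = \<theta> * z \<nu>)"

text \<open>A square matrix has distinct eigenvalues if the number of different ones equals its size.\<close>

definition distinct_eigenvalues :: "'a set \<Rightarrow> ('a \<Rightarrow> 'a \<Rightarrow> complex) \<Rightarrow> bool" where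
  "distinct_eigenvalues B M \<longleftrightarrow> card {\<theta>. \<exists>z. eigenpair B M \<theta> z} = card B"

definition herm_form :: "'a set \<Rightarrow> ('a \<Rightarrow> 'a \<Rightarrow> complex) \<Rightarrow> ('a \<Rightarrow> complex) \<Rightarrow> complex" where
  "herm_form B M z = (\<Sum>\<nu>\<in>B. \<Sum>\<beta>\<in>B. cnj (z \<nu>) * M \<nu> \<beta> * z \<beta>)"

definition prepend_one :: "(nat \<Rightarrow> complex) \<Rightarrow> nat \<Rightarrow> complex" where
  "prepend_one u = u(0 := 1)"

text \<open>The algorithm is rendered as relations between its input and the vectors it produces, since
  least-squares minimizers and eigenvectors need not be unique for arbitrary input. The vectors
  z_1, ..., z_r are a full (linearly independent) system of eigenvectors. The entries of w_i are
  numbered 1, ..., n-k, as in the definition of J_3.\<close>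

definition step1 ::
  "nat \<Rightarrow> nat \<Rightarrow> nat \<Rightarrow> nat \<Rightarrow> nat \<Rightarrow> tensor \<Rightarrow> (monomial \<Rightarrow> monomial \<Rightarrow> complex) \<Rightarrow> bool" where
  "step1 m n r p k F G \<longleftrightarrow> (\<forall>\<alpha>\<in>B1 n p k.
     minimizer (\<lambda>g. (frob_norm (O_set m n p k \<alpha>) (residual m r p k F \<alpha> g))\<^sup>2) (\<lambda>\<beta>. G \<beta> \<alpha>))"

definition step2 ::
  "nat \<Rightarrow> nat \<Rightarrow> nat \<Rightarrow> nat \<Rightarrow> (nat \<Rightarrow> complex) \<Rightarrow> (monomial \<Rightarrow> monomial \<Rightarrow> complex)
   \<Rightarrow> (nat \<Rightarrow> nat \<Rightarrow> complex) \<Rightarrow> bool" where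
  "step2 n r p k \<xi> G w \<longleftrightarrow> (\<exists>z :: nat \<Rightarrow> monomial \<Rightarrow> complex.
     (\<forall>i\<in>{1..r}. frob_norm (B0 r p k) (z i) = 1 \<and>
        (\<exists>\<theta>. eigenpair (B0 r p k) (N_xi n k \<xi> G) \<theta> (z i))) \<and>
     lin_indep r (B0 r p k) z \<and>
     (\<forall>i\<in>{1..r}. \<forall>t\<in>{1..n-k}. w i t = herm_form (B0 r p k) (N_l G (k + t)) (z i)))"

definition step3_gamma ::
  "nat \<Rightarrow> nat \<Rightarrow> nat \<Rightarrow> nat \<Rightarrow> nat \<Rightarrow> tensor \<Rightarrow> (nat \<Rightarrow> nat \<Rightarrow> complex)
   \<Rightarrow> (nat \<Rightarrow> monomial \<Rightarrow> complex) \<Rightarrow> bool" where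
  "step3_gamma m n r p k F w \<gamma> \<longleftrightarrow>
     minimizer (\<lambda>\<gamma>. (frob_norm (J1 p k \<times> J2 m n p k)
       (\<lambda>(f, g). entry m F (f + g) - (\<Sum>i=1..r. \<gamma> i f * mono_eval (shift_mono k g) (w i))))\<^sup>2) \<gamma>"

definition step3_v ::
  "nat \<Rightarrow> nat \<Rightarrow> nat \<Rightarrow> nat \<Rightarrow> nat \<Rightarrow> tensor \<Rightarrow> (nat \<Rightarrow> nat \<Rightarrow> complex)
   \<Rightarrow> (nat \<Rightarrow> monomial \<Rightarrow> complex) \<Rightarrow> (nat \<Rightarrow> nat \<Rightarrow> complex) \<Rightarrow> bool" where
  "step3_v m n r p k F w \<gamma> v \<longleftrightarrow> (\<forall>j\<in>{1..k}.
     minimizer (\<lambda>c. (frob_norm (J1_without p k j \<times> J2 m n p k)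
       (\<lambda>(f, g). entry m F ({#j#} + f + g)
          - (\<Sum>i=1..r. c i * \<gamma> i f * mono_eval (shift_mono k g) (w i))))\<^sup>2) (\<lambda>i. v i j))"

definition step3_lambda ::
  "nat \<Rightarrow> nat \<Rightarrow> nat \<Rightarrow> tensor \<Rightarrow> (nat \<Rightarrow> nat \<Rightarrow> complex) \<Rightarrow> (nat \<Rightarrow> complex) \<Rightarrow> bool" where
  "step3_lambda m n r F u c \<longleftrightarrow>
     minimizer (\<lambda>c. (frob_norm (Omega_set m n)
       (\<lambda>I. F I - (\<Sum>i=1..r. c i * tensor_power (prepend_one (u i)) I)))\<^sup>2) c"

definition intermediate_vectors ::
  "nat \<Rightarrow> nat \<Rightarrow> nat \<Rightarrow> nat \<Rightarrow> nat \<Rightarrow> (nat \<Rightarrow> complex) \<Rightarrow> tensor \<Rightarrow> (nat \<Rightarrow> nat \<Rightarrow> complex) \<Rightarrow> bool" where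
  "intermediate_vectors m n r p k \<xi> F q \<longleftrightarrow> (\<exists>G w \<gamma> v u c.
     step1 m n r p k F G \<and> step2 n r p k \<xi> G w \<and>
     step3_gamma m n r p k F w \<gamma> \<and> step3_v m n r p k F w \<gamma> v \<and>
     (\<forall>i\<in>{1..r}. \<forall>j\<in>{1..n}. u i j = (if j \<le> k then v i j else w i (j - k))) \<and>
     step3_lambda m n r F u c \<and>
     (\<forall>i\<in>{1..r}. \<forall>j\<in>{0..n}. q i j = c i powr (1 / of_nat m) * prepend_one (u i) j))"

text \<open>The starting point of the final optimization does not occur in the characterization of its
  result as a (global) minimizer.\<close>

definition output_vectors :: "nat \<Rightarrow> nat \<Rightarrow> nat \<Rightarrow> tensor \<Rightarrow> (nat \<Rightarrow> nat \<Rightarrow> complex) \<Rightarrow> bool" where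
  "output_vectors m n r F q \<longleftrightarrow>
     minimizer (\<lambda>q. (frob_norm (Omega_set m n) (\<lambda>I. F I - (\<Sum>i=1..r. tensor_power (q i) I)))\<^sup>2) q"

text \<open>Closeness of two families of vectors in C^(n+1), up to relabelling the second
  family and multiplying the members of the first one by m-th roots of unity.\<close>

definition close_up_to ::
  "nat \<Rightarrow> nat \<Rightarrow> nat \<Rightarrow> real \<Rightarrow> (nat \<Rightarrow> nat \<Rightarrow> complex) \<Rightarrow> (nat \<Rightarrow> nat \<Rightarrow> complex) \<Rightarrow> bool" where
  "close_up_to m n r d q' q \<longleftrightarrow> (\<exists>\<sigma> \<eta>. \<sigma> permutes {1..r} \<and>
     (\<forall>i\<in>{1..r}. \<eta> i ^ m = (1::complex) \<and>
        frob_norm {0..n} (\<lambda>j. \<eta> i * q' i j - q (\<sigma> i) j) \<le> d))"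

text \<open>For every i and every j in {1..k} the part of the monomial vector of mu_i used to recover
  its j-th coordinate in Step 3 is nonzero. Without this the least-squares problem for the j-th
  coordinates is singular at the exact tensor, and its solutions for perturbed tensors
  need not converge.\<close>

definition step3_nondegenerate :: "nat \<Rightarrow> nat \<Rightarrow> nat \<Rightarrow> (nat \<Rightarrow> nat \<Rightarrow> complex) \<Rightarrow> bool" where
  "step3_nondegenerate r p k \<mu> \<longleftrightarrow>
     (\<forall>i\<in>{1..r}. \<forall>j\<in>{1..k}. \<exists>f\<in>J1_without p k j. mono_eval f (\<mu> i) \<noteq> 0)"

end

theory Submission
  imports Defs
begin

text \<open>
  Dividing each \<open>\<mu> i\<close> by its leading entry gives \<open>F = (\<Sum>i. c i * (u i)^m)\<close> with \<open>c i = \<omega> i * (\<mu> i 0)^m\<close> and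
  \<open>u i 0 = 1\<close>. Consider first the input \<open>F\<close> itself. The systems of Step 1 have full column rank, and their
  solution \<open>G\<close> interpolates, that is, the vector of the values of the monomials in \<open>B0\<close> at \<open>u i\<close> is an
  eigenvector of each \<open>N_l\<close> with eigenvalue \<open>u i l\<close>; as the eigenvalues of \<open>N_xi\<close> are distinct, these
  vectors are, up to scaling, its only eigenvectors. The systems of Step 3 have trivial kernel,
  the second one because of \<open>step3_nondegenerate\<close>. So the results are unique up to order and, for the
  roots in Step 4, roots of unity, and the theorem says that they depend on the input in a
  Lipschitz way. There are three mechanisms for this.

  A linear system with trivial kernel has a left inverse, so a vector that solves a nearby system up to
  \<open>O(\<epsilon>)\<close> is \<open>O(\<epsilon>)\<close>-close to the exact solution (\<open>near_solution\<close>). A least-squares minimizer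
  is such a vector, because its residual is at most that of the exact solution
  (\<open>small_minimizer_residual\<close>). In the basis of the exact eigenvectors, a perturbation of \<open>N_xi\<close> is
  diagonal up to \<open>O(\<epsilon>)\<close>; each of its eigenvectors has one dominant coordinate, and two
  eigenvectors with the same dominant coordinate are proportional, so that \<open>r\<close> independent
  eigenvectors define a permutation (\<open>dominant_coordinate\<close>,
  \<open>dominant_coordinate_determines_direction\<close>). Finally, the exact decomposition may be relabelled
  by this permutation, and an \<open>m\<close>-th root is determined, in a Lipschitz way, up to a root of unity
  (\<open>near_up_to_root_of_unity\<close>).

  For the output vectors \<open>q i\<close>, the tensor \<open>(\<Sum>i. (q i)^m)\<close> is itself \<open>O(\<epsilon>)\<close>-close to \<open>F\<close> on the
  observed entries. Since its Step 1 matrices are near matrices of full column rank \<open>r\<close>, no leading entry \<open>q i 0\<close>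
  vanishes and the vectors of the values at \<open>q i\<close> of the monomials in \<open>B0\<close> are independent
  (\<open>eventually_powers_nondegenerate\<close>). Hence Steps 1 and 2 applied to that tensor
  may return the values \<open>q i l / q i 0\<close> for \<open>l > k\<close>, and the bounds for these steps apply to them. The entries with
  index at most \<open>k\<close> are quotients of coefficients of monomials of degrees \<open>p\<close> and \<open>p - 1\<close>
  (\<open>powers_near\<close>). Some monomial of degree \<open>p\<close> in \<open>B0\<close> is nonzero at \<open>u i\<close>, so even a monomial of
  degree \<open>p - 1\<close> that avoids a given variable can be chosen for the denominator.

  The constants must not depend on the decomposition of \<open>F\<close>. Any two decompositions yield the
  same vectors up to order and roots of unity, because each of them is an output of the algorithm for the
  tensor \<open>F\<close> itself, at distance \<open>\<epsilon> = 0\<close>; so the constants of one decomposition serve for all.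
\<close>

section \<open>Finite systems of linear equations\<close>

text \<open>Adjoin the columns one at a time. A left inverse \<open>L\<close> for the columns in \<open>T\<close> gives the
  projection \<open>I - A L\<close>, which annihilates these columns but not the new column; one of its rows, scaled,
  is the new row of the left inverse and corrects the old rows.\<close>

lemma left_inverse_of_injective:
  fixes A :: "'s \<Rightarrow> 't \<Rightarrow> complex"
  assumes "finite T" and "finite S"
    and "\<And>h. (\<forall>s\<in>S. (\<Sum>t\<in>T. A s t * h t) = 0) \<Longrightarrow> \<forall>t\<in>T. h t = 0"
  shows "\<exists>L. \<forall>t\<in>T. \<forall>t'\<in>T. (\<Sum>s\<in>S. L t s * A s t') = (if t = t' then 1 else 0)"
  using assms(1,3)
proof (induction T rule: finite_induct)
  case empty
  then show ?case by simp
next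
  case (insert a T)
  have inj: "\<forall>t\<in>T. h t = 0" if "\<forall>s\<in>S. (\<Sum>t\<in>T. A s t * h t) = 0" for h
  proof -
    have "(\<Sum>t\<in>insert a T. A s t * (if t = a then 0 else h t)) = (\<Sum>t\<in>T. A s t * h t)" for s
      using insert.hyps by (auto intro!: sum.cong)
    then have "\<forall>t\<in>insert a T. (if t = a then 0 else h t) = 0"
      using insert.prems[of "\<lambda>t. if t = a then 0 else h t"] that by simp
    then show ?thesis using insert.hyps by (metis insertI2)
  qed
  obtain L where L: "\<And>t t'. t \<in> T \<Longrightarrow> t' \<in> T \<Longrightarrow>
      (\<Sum>s\<in>S. L t s * A s t') = (if t = t' then 1 else 0)"
    using insert.IH[OF inj] by blast
  define y where "y t = (\<Sum>s\<in>S. L t s * A s a)" for t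
  define R where "R s = A s a - (\<Sum>t\<in>T. A s t * y t)" for s
  have columns: "(\<Sum>t\<in>insert a T. A s t * (if t = a then 1 else - y t)) = R s" for s
  proof -
    have "(\<Sum>t\<in>T. A s t * (if t = a then 1 else - y t)) = (\<Sum>t\<in>T. - (A s t * y t))"
      using insert.hyps by (intro sum.cong) auto
    then show ?thesis using insert.hyps by (simp add: R_def sum_negf)
  qed
  have "\<exists>s\<in>S. R s \<noteq> 0"
  proof (rule ccontr)
    assume "\<not> ?thesis"
    then have "\<forall>s\<in>S. (\<Sum>t\<in>insert a T. A s t * (if t = a then 1 else - y t)) = 0"
      using columns by (simp add: R_def)
    then show False using insert.prems[of "\<lambda>t. if t = a then 1 else - y t"] by auto
  qed
  then obtain s0 where s0: "s0 \<in> S" "R s0 \<noteq> 0" by blast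
  define P where "P s = ((if s = s0 then 1 else 0) - (\<Sum>t\<in>T. A s0 t * L t s)) / R s0" for s
  have P_eq: "(\<Sum>s\<in>S. P s * A s b) = (A s0 b - (\<Sum>t\<in>T. A s0 t * (\<Sum>s\<in>S. L t s * A s b))) / R s0" for b
  proof -
    have "(\<Sum>s\<in>S. P s * A s b)
        = (\<Sum>s\<in>S. (if s = s0 then A s b else 0) - (\<Sum>t\<in>T. A s0 t * L t s) * A s b) / R s0"
      unfolding P_def sum_divide_distrib by (rule sum.cong) (auto simp: algebra_simps)
    also have "\<dots> = (A s0 b - (\<Sum>s\<in>S. \<Sum>t\<in>T. A s0 t * L t s * A s b)) / R s0"
      using s0 assms(2) by (simp add: sum_subtractf sum_distrib_right)
    also have "(\<Sum>s\<in>S. \<Sum>t\<in>T. A s0 t * L t s * A s b) = (\<Sum>t\<in>T. A s0 t * (\<Sum>s\<in>S. L t s * A s b))"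
      by (subst sum.swap) (simp add: sum_distrib_left mult.assoc)
    finally show ?thesis .
  qed
  have Pa: "(\<Sum>s\<in>S. P s * A s a) = 1"
    unfolding P_eq using s0 by (simp add: R_def y_def)
  have PT: "(\<Sum>s\<in>S. P s * A s b) = 0" if "b \<in> T" for b
  proof -
    have "(\<Sum>t\<in>T. A s0 t * (\<Sum>s\<in>S. L t s * A s b)) = (\<Sum>t\<in>T. if t = b then A s0 b else 0)"
      using that L by (intro sum.cong) auto
    then show ?thesis unfolding P_eq using that insert.hyps by simp
  qed
  define L' where "L' t s = (if t = a then P s else L t s - y t * P s)" for t s
  have "(\<Sum>s\<in>S. L' t s * A s t') = (if t = t' then 1 else 0)"
    if "t \<in> insert a T" "t' \<in> insert a T" for t t'
  proof (cases "t = a")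
    case True
    then show ?thesis using that Pa PT insert.hyps by (auto simp: L'_def)
  next
    case False
    have "(\<Sum>s\<in>S. L' t s * A s t') = (\<Sum>s\<in>S. L t s * A s t') - y t * (\<Sum>s\<in>S. P s * A s t')"
      using False by (simp add: L'_def left_diff_distrib sum_subtractf sum_distrib_left mult.assoc)
    then show ?thesis using that False Pa PT L insert.hyps by (auto simp: y_def)
  qed
  then show ?case by blast
qed

lemma underdetermined_system:
  fixes A :: "'s \<Rightarrow> 't \<Rightarrow> complex"
  assumes "finite S" and "finite T" and "card S < card T"
  shows "\<exists>h. (\<exists>t\<in>T. h t \<noteq> 0) \<and> (\<forall>s\<in>S. (\<Sum>t\<in>T. A s t * h t) = 0)"
  using assms
proof (induction S arbitrary: A T rule: finite_induct)
  case empty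
  then have "T \<noteq> {}" by auto
  then show ?case by (intro exI[of _ "\<lambda>_. 1"]) auto
next
  case (insert a S)
  show ?case
  proof (cases "\<forall>t\<in>T. A a t = 0")
    case True
    have "card S < card T" using insert by simp
    from insert.IH[OF insert.prems(1) this, of A] True show ?thesis by auto
  next
    case False
    then obtain t0 where t0: "t0 \<in> T" "A a t0 \<noteq> 0" by blast
    define T' where "T' = T - {t0}"
    have T': "finite T'" "card S < card T'" "T = insert t0 T'" "t0 \<notin> T'"
      using insert.prems insert.hyps t0 by (auto simp: T'_def)
    obtain h where h: "\<exists>t\<in>T'. h t \<noteq> 0"
      "\<forall>s\<in>S. (\<Sum>t\<in>T'. (A s t - A s t0 * A a t / A a t0) * h t) = 0"
      using insert.IH[OF T'(1,2), of "\<lambda>s t. A s t - A s t0 * A a t / A a t0"] by blast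
    define h' where "h' t = (if t = t0 then - (\<Sum>t\<in>T'. A a t * h t) / A a t0 else h t)" for t
    have sum: "(\<Sum>t\<in>T. A s t * h' t) = A s t0 * h' t0 + (\<Sum>t\<in>T'. A s t * h t)" for s
    proof -
      have "(\<Sum>t\<in>T'. A s t * h' t) = (\<Sum>t\<in>T'. A s t * h t)"
        using T'(4) by (intro sum.cong) (auto simp: h'_def)
      then show ?thesis using T' by simp
    qed
    have "(\<Sum>t\<in>T. A s t * h' t) = 0" if "s \<in> insert a S" for s
    proof (cases "s = a")
      case True
      show ?thesis unfolding True sum using t0 by (simp add: h'_def)
    next
      case False
      then have "(\<Sum>t\<in>T'. (A s t - A s t0 * A a t / A a t0) * h t) = 0" using h that by auto
      moreover have "(\<Sum>t\<in>T'. (A s t - A s t0 * A a t / A a t0) * h t)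
         = (\<Sum>t\<in>T'. A s t * h t) - A s t0 / A a t0 * (\<Sum>t\<in>T'. A a t * h t)"
        by (simp add: left_diff_distrib sum_subtractf sum_distrib_left mult.assoc)
      ultimately show ?thesis unfolding sum by (simp add: h'_def)
    qed
    moreover have "\<exists>t\<in>T. h' t \<noteq> 0" using h(1) T' by (auto simp: h'_def)
    ultimately show ?thesis by blast
  qed
qed

text \<open>With at least as many columns as rows, adjoining the unit vector of \<open>s'\<close> to the columns makes
  the system underdetermined, so this unit vector is in the span of the columns.\<close>

lemma right_inverse_of_square:
  fixes A :: "'s \<Rightarrow> 't \<Rightarrow> complex"
  assumes "finite S" and "finite T" and "card S \<le> card T"
    and L: "\<And>t t'. t \<in> T \<Longrightarrow> t' \<in> T \<Longrightarrow> (\<Sum>s\<in>S. L t s * A s t') = (if t = t' then 1 else 0)"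
    and "s \<in> S" and "s' \<in> S"
  shows "(\<Sum>t\<in>T. A s t * L t s') = (if s = s' then 1 else 0)"
proof -
  define B where "B s = case_option (if s = s' then 1 else 0) (A s)" for s
  have "card S < card (insert None (Some ` T))"
    using assms(2,3) by (simp add: card_image)
  then obtain h where h: "\<exists>t\<in>insert None (Some ` T). h t \<noteq> 0"
    "\<forall>s\<in>S. (\<Sum>t\<in>insert None (Some ` T). B s t * h t) = 0"
    using underdetermined_system[of S "insert None (Some ` T)" B] assms(1,2) by auto
  have eq: "(if s = s' then 1 else 0) * h None = - (\<Sum>t\<in>T. A s t * h (Some t))" if "s \<in> S" for s
  proof -
    have "0 = B s None * h None + (\<Sum>t\<in>T. B s (Some t) * h (Some t))"
      using h(2) that assms(2) by (simp add: sum.reindex)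
    then show ?thesis by (auto simp: B_def eq_neg_iff_add_eq_0)
  qed
  have hL: "h (Some t) = - L t s' * h None" if "t \<in> T" for t
  proof -
    have "(\<Sum>s\<in>S. L t s * ((if s = s' then 1 else 0) * h None)) = L t s' * h None"
    proof -
      have "(\<Sum>s\<in>S. L t s * ((if s = s' then 1 else 0) * h None)) = (\<Sum>s\<in>S. if s = s' then L t s' * h None else 0)"
        by (intro sum.cong) auto
      then show ?thesis using assms by simp
    qed
    also have "(\<Sum>s\<in>S. L t s * ((if s = s' then 1 else 0) * h None))
       = - (\<Sum>s\<in>S. \<Sum>t'\<in>T. L t s * A s t' * h (Some t'))"
      using eq by (simp add: sum_distrib_left sum_negf mult.assoc)
    also have "(\<Sum>s\<in>S. \<Sum>t'\<in>T. L t s * A s t' * h (Some t'))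
       = (\<Sum>t'\<in>T. (\<Sum>s\<in>S. L t s * A s t') * h (Some t'))"
      by (subst sum.swap) (simp add: sum_distrib_right)
    also have "\<dots> = (\<Sum>t'\<in>T. if t = t' then h (Some t') else 0)"
      using L that by (intro sum.cong) auto
    also have "\<dots> = h (Some t)" using that assms by simp
    finally have "h (Some t) = - (L t s' * h None)" by (metis minus_minus)
    then show ?thesis by simp
  qed
  then have hn: "h None \<noteq> 0" using h(1) by auto
  have "(if s = s' then 1 else 0) * h None = (\<Sum>t\<in>T. A s t * L t s') * h None"
    using eq[OF \<open>s \<in> S\<close>] hL by (simp add: sum_negf[symmetric] sum_distrib_right mult.assoc)
  then show ?thesis using hn by simp
qed

lemma lin_indep_imp_nonzero:
  assumes "lin_indep r S a" and "i \<in> {1..r}" shows "\<exists>s\<in>S. a i s \<noteq> 0"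
proof (rule ccontr)
  assume "\<not> ?thesis"
  then have "\<forall>s\<in>S. (\<Sum>j=1..r. (if j = i then 1 else 0) * a j s) = 0"
    by (intro ballI sum.neutral) auto
  then have "(if i = i then 1 else 0 :: complex) = 0"
    using assms(1)[unfolded lin_indep_def, rule_format, of "\<lambda>j. if j = i then 1 else 0" i] assms(2) by blast
  then show False by simp
qed

lemma sum_cnj_mult_self:
  assumes "frob_norm B z = 1" shows "(\<Sum>\<nu>\<in>B. cnj (z \<nu>) * z \<nu>) = 1"
proof -
  have "(\<Sum>\<nu>\<in>B. (norm (z \<nu>))\<^sup>2) = 1" using assms unfolding frob_norm_def L2_set_def by simp
  then have "complex_of_real (\<Sum>\<nu>\<in>B. (norm (z \<nu>))\<^sup>2) = 1" by simp
  then show ?thesis by (simp only: of_real_sum complex_norm_square mult.commute)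
qed

section \<open>Approximation up to a multiple of a vanishing quantity\<close>

text \<open>In Landau notation, \<open>small\<close> is \<open>f \<in> O(e)\<close>. The target of \<open>near\<close> is a constant: a target that
  depends on a labelling becomes constant on the part of the filter where the labelling is fixed.\<close>

definition small :: "'x filter \<Rightarrow> ('x \<Rightarrow> real) \<Rightarrow> ('x \<Rightarrow> complex) \<Rightarrow> bool" where
  "small \<Phi> e f \<longleftrightarrow> (\<exists>C. \<forall>\<^sub>F x in \<Phi>. norm (f x) \<le> C * e x)"

definition near :: "'x filter \<Rightarrow> ('x \<Rightarrow> real) \<Rightarrow> ('x \<Rightarrow> complex) \<Rightarrow> complex \<Rightarrow> bool" where
  "near \<Phi> e f c \<longleftrightarrow> small \<Phi> e (\<lambda>x. f x - c)"

definition bdd :: "'x filter \<Rightarrow> ('x \<Rightarrow> complex) \<Rightarrow> bool" where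
  "bdd \<Phi> f \<longleftrightarrow> (\<exists>C. \<forall>\<^sub>F x in \<Phi>. norm (f x) \<le> C)"

lemma small_cong: "\<forall>\<^sub>F x in \<Phi>. f x = g x \<Longrightarrow> small \<Phi> e f \<Longrightarrow> small \<Phi> e g"
  unfolding small_def
proof (elim exE)
  fix C assume "\<forall>\<^sub>F x in \<Phi>. f x = g x" "\<forall>\<^sub>F x in \<Phi>. norm (f x) \<le> C * e x"
  then have "\<forall>\<^sub>F x in \<Phi>. norm (g x) \<le> C * e x" by eventually_elim simp
  then show "\<exists>C. \<forall>\<^sub>F x in \<Phi>. norm (g x) \<le> C * e x" by blast
qed

lemma near_cong: "\<forall>\<^sub>F x in \<Phi>. f x = g x \<Longrightarrow> near \<Phi> e f c \<Longrightarrow> near \<Phi> e g c"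
  unfolding near_def by (erule small_cong[rotated]) (auto elim: eventually_mono)

lemma small_filter_mono: "\<Psi> \<le> \<Phi> \<Longrightarrow> small \<Phi> e f \<Longrightarrow> small \<Psi> e f"
  unfolding small_def using filter_leD by blast

lemma near_filter_mono: "\<Psi> \<le> \<Phi> \<Longrightarrow> near \<Phi> e f c \<Longrightarrow> near \<Psi> e f c"
  unfolding near_def by (rule small_filter_mono)

lemma bdd_const: "bdd \<Phi> (\<lambda>_. c)"
  unfolding bdd_def by (intro exI[of _ "norm c"]) simp

lemma bdd_add: "bdd \<Phi> f \<Longrightarrow> bdd \<Phi> g \<Longrightarrow> bdd \<Phi> (\<lambda>x. f x + g x)"
  unfolding bdd_def
proof (elim exE)
  fix C D assume "\<forall>\<^sub>F x in \<Phi>. norm (f x) \<le> C" "\<forall>\<^sub>F x in \<Phi>. norm (g x) \<le> D"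
  then have "\<forall>\<^sub>F x in \<Phi>. norm (f x + g x) \<le> C + D"
    by eventually_elim (metis add_mono norm_triangle_le)
  then show "\<exists>C. \<forall>\<^sub>F x in \<Phi>. norm (f x + g x) \<le> C" by blast
qed

lemma bdd_mult: "bdd \<Phi> f \<Longrightarrow> bdd \<Phi> g \<Longrightarrow> bdd \<Phi> (\<lambda>x. f x * g x)"
  unfolding bdd_def
proof (elim exE)
  fix C D assume "\<forall>\<^sub>F x in \<Phi>. norm (f x) \<le> C" "\<forall>\<^sub>F x in \<Phi>. norm (g x) \<le> D"
  then have "\<forall>\<^sub>F x in \<Phi>. norm (f x * g x) \<le> C * D"
  proof eventually_elim
    case (elim x)
    have "0 \<le> C" using elim(1) norm_ge_zero[of "f x"] by linarith
    then show ?case unfolding norm_mult by (intro mult_mono) (use elim in auto)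
  qed
  then show "\<exists>C. \<forall>\<^sub>F x in \<Phi>. norm (f x * g x) \<le> C" by blast
qed

lemma bdd_sum: "(\<And>t. t \<in> T \<Longrightarrow> bdd \<Phi> (f t)) \<Longrightarrow> bdd \<Phi> (\<lambda>x. \<Sum>t\<in>T. f t x)"
  by (induction T rule: infinite_finite_induct) (auto simp: bdd_const intro!: bdd_add)

lemma small_zero: "small \<Phi> e (\<lambda>_. 0)"
  unfolding small_def by (intro exI[of _ 0]) simp

lemma small_add: "small \<Phi> e f \<Longrightarrow> small \<Phi> e g \<Longrightarrow> small \<Phi> e (\<lambda>x. f x + g x)"
  unfolding small_def
proof (elim exE)
  fix C D assume "\<forall>\<^sub>F x in \<Phi>. norm (f x) \<le> C * e x" "\<forall>\<^sub>F x in \<Phi>. norm (g x) \<le> D * e x"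
  then have "\<forall>\<^sub>F x in \<Phi>. norm (f x + g x) \<le> (C + D) * e x"
    by eventually_elim (metis add_mono distrib_right norm_triangle_le)
  then show "\<exists>C. \<forall>\<^sub>F x in \<Phi>. norm (f x + g x) \<le> C * e x" by blast
qed

lemma small_minus: "small \<Phi> e f \<Longrightarrow> small \<Phi> e (\<lambda>x. - f x)"
  unfolding small_def by simp

lemma small_diff: "small \<Phi> e f \<Longrightarrow> small \<Phi> e g \<Longrightarrow> small \<Phi> e (\<lambda>x. f x - g x)"
  using small_add[OF _ small_minus, of \<Phi> e f g] by simp

lemma small_sum: "(\<And>t. t \<in> T \<Longrightarrow> small \<Phi> e (f t)) \<Longrightarrow> small \<Phi> e (\<lambda>x. \<Sum>t\<in>T. f t x)"
  by (induction T rule: infinite_finite_induct) (auto simp: small_zero intro!: small_add)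

lemma near_const: "near \<Phi> e (\<lambda>_. c) c"
  unfolding near_def by (simp add: small_zero)

lemma near_add: "near \<Phi> e f c \<Longrightarrow> near \<Phi> e g d \<Longrightarrow> near \<Phi> e (\<lambda>x. f x + g x) (c + d)"
  unfolding near_def using small_add[of \<Phi> e "\<lambda>x. f x - c" "\<lambda>x. g x - d"]
  by (simp add: algebra_simps)

lemma near_sum:
  "(\<And>t. t \<in> T \<Longrightarrow> near \<Phi> e (f t) (c t)) \<Longrightarrow> near \<Phi> e (\<lambda>x. \<Sum>t\<in>T. f t x) (\<Sum>t\<in>T. c t)"
  by (induction T rule: infinite_finite_induct) (auto simp: near_const intro!: near_add)

lemma near_add_small: "near \<Phi> e f c \<Longrightarrow> small \<Phi> e g \<Longrightarrow> near \<Phi> e (\<lambda>x. f x + g x) c"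
  using near_add[of \<Phi> e f c g 0] by (simp add: near_def)

locale vanishing =
  fixes \<Phi> :: "'x filter" and e :: "'x \<Rightarrow> real"
  assumes e_nonneg: "\<And>x. 0 \<le> e x" and e_tendsto: "(e \<longlongrightarrow> 0) \<Phi>"
begin

lemma eventually_mult_e_less: "0 < d \<Longrightarrow> \<forall>\<^sub>F x in \<Phi>. C * e x < d"
  using order_tendstoD(2)[OF tendsto_mult[OF tendsto_const e_tendsto], of C d] by simp

lemma small_uniform:
  assumes "finite S" and "\<And>s. s \<in> S \<Longrightarrow> small \<Phi> e (f s)"
  shows "\<exists>C\<ge>0. \<forall>\<^sub>F x in \<Phi>. \<forall>s\<in>S. norm (f s x) \<le> C * e x"
proof -
  obtain C where C: "\<And>s. s \<in> S \<Longrightarrow> \<forall>\<^sub>F x in \<Phi>. norm (f s x) \<le> C s * e x"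
    using assms(2) unfolding small_def by metis
  have "\<forall>\<^sub>F x in \<Phi>. \<forall>s\<in>S. norm (f s x) \<le> C s * e x"
    using C by (simp add: eventually_ball_finite assms(1))
  then have "\<forall>\<^sub>F x in \<Phi>. \<forall>s\<in>S. norm (f s x) \<le> (\<Sum>s\<in>S. \<bar>C s\<bar>) * e x"
  proof eventually_elim
    case (elim x)
    show ?case
    proof
      fix s assume s: "s \<in> S"
      have "C s \<le> (\<Sum>s\<in>S. \<bar>C s\<bar>)"
        using member_le_sum[of s S "\<lambda>s. \<bar>C s\<bar>"] s assms(1) by auto
      then have "C s * e x \<le> (\<Sum>s\<in>S. \<bar>C s\<bar>) * e x" by (intro mult_right_mono e_nonneg)
      then show "norm (f s x) \<le> (\<Sum>s\<in>S. \<bar>C s\<bar>) * e x" using elim s by fastforce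
    qed
  qed
  then show ?thesis by (intro exI[of _ "\<Sum>s\<in>S. \<bar>C s\<bar>"]) (auto simp: sum_nonneg)
qed

lemma small_imp_bdd: assumes "small \<Phi> e f" shows "bdd \<Phi> f"
proof -
  obtain C where C: "\<forall>\<^sub>F x in \<Phi>. norm (f x) \<le> C * e x" using assms by (auto simp: small_def)
  have "\<forall>\<^sub>F x in \<Phi>. norm (f x) \<le> 1"
    using C eventually_mult_e_less[OF zero_less_one, of C] by eventually_elim linarith
  then show ?thesis unfolding bdd_def by blast
qed

lemma small_mult_bdd: assumes "small \<Phi> e f" "bdd \<Phi> g" shows "small \<Phi> e (\<lambda>x. f x * g x)"
proof -
  obtain C D where "\<forall>\<^sub>F x in \<Phi>. norm (f x) \<le> C * e x" "\<forall>\<^sub>F x in \<Phi>. norm (g x) \<le> D"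
    using assms by (auto simp: small_def bdd_def)
  then have "\<forall>\<^sub>F x in \<Phi>. norm (f x * g x) \<le> (C * D) * e x"
  proof eventually_elim
    case (elim x)
    have "0 \<le> C * e x" using elim(1) norm_ge_zero[of "f x"] by linarith
    then have "norm (f x * g x) \<le> (C * e x) * D"
      unfolding norm_mult by (intro mult_mono) (use elim in auto)
    then show ?case by (simp add: algebra_simps)
  qed
  then show ?thesis unfolding small_def by blast
qed

lemma near_imp_bdd: "near \<Phi> e f c \<Longrightarrow> bdd \<Phi> f"
  using bdd_add[OF small_imp_bdd bdd_const, of "\<lambda>x. f x - c" c] by (simp add: near_def)

lemma near_mult: assumes "near \<Phi> e f c" "near \<Phi> e g d" shows "near \<Phi> e (\<lambda>x. f x * g x) (c * d)"
proof -
  have "small \<Phi> e (\<lambda>x. (f x - c) * g x + (g x - d) * c)"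
    using assms by (intro small_add small_mult_bdd near_imp_bdd[OF assms(2)] bdd_const)
      (auto simp: near_def)
  then show ?thesis unfolding near_def by (simp add: algebra_simps)
qed

lemma near_tendsto: assumes "near \<Phi> e f c" shows "(f \<longlongrightarrow> c) \<Phi>"
proof -
  obtain C where C: "\<forall>\<^sub>F x in \<Phi>. norm (f x - c) \<le> C * e x"
    using assms by (auto simp: near_def small_def)
  have "((\<lambda>x. C * e x) \<longlongrightarrow> 0) \<Phi>" using tendsto_mult[OF tendsto_const e_tendsto, of C] by simp
  then show ?thesis by (metis C Lim_null_comparison LIM_zero_cancel)
qed

lemma near_eventually_nonzero: "near \<Phi> e f c \<Longrightarrow> c \<noteq> 0 \<Longrightarrow> \<forall>\<^sub>F x in \<Phi>. f x \<noteq> 0"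
  using near_tendsto tendsto_imp_eventually_ne by blast

text \<open>A function that is differentiable at the limit point is Lipschitz there, so it preserves
  the rate of approximation.\<close>

lemma near_differentiable:
  assumes "near \<Phi> e f c" and "(g has_field_derivative D) (at c)"
  shows "near \<Phi> e (\<lambda>x. g (f x)) (g c)"
proof -
  obtain C where C: "\<forall>\<^sub>F x in \<Phi>. norm (f x - c) \<le> C * e x"
    using assms by (auto simp: near_def small_def)
  have "(\<forall>\<^sub>F y in nhds c. norm (g y - g c) \<le> (norm D + 1) * norm (y - c))"
  proof -
    have "\<forall>\<^sub>F y in at c. norm ((g y - g c) / (y - c)) < norm D + 1"
      using order_tendstoD(2)[OF tendsto_norm[OF assms(2)[unfolded has_field_derivative_iff]], of "norm D + 1"]
      by simp
    then have "\<forall>\<^sub>F y in at c. norm (g y - g c) \<le> (norm D + 1) * norm (y - c)"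
      by (auto simp: norm_divide divide_simps eventually_at_filter less_imp_le elim!: eventually_mono)
    then show ?thesis by (simp add: eventually_at_filter) (auto elim!: eventually_mono)
  qed
  then have "\<forall>\<^sub>F x in \<Phi>. norm (g (f x) - g c) \<le> (norm D + 1) * norm (f x - c)"
    by (rule eventually_compose_filterlim[OF _ near_tendsto[OF assms(1)]])
  with C have "\<forall>\<^sub>F x in \<Phi>. norm (g (f x) - g c) \<le> ((norm D + 1) * C) * e x"
  proof eventually_elim
    case (elim x)
    have "(norm D + 1) * norm (f x - c) \<le> (norm D + 1) * (C * e x)"
      using elim by (intro mult_left_mono) auto
    then show ?case using elim by (simp add: mult.assoc)
  qed
  then show ?thesis unfolding near_def small_def by blast
qed

lemma near_divide:
  assumes "near \<Phi> e f c" "near \<Phi> e g d" "d \<noteq> 0" shows "near \<Phi> e (\<lambda>x. f x / g x) (c / d)"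
proof -
  have "near \<Phi> e (\<lambda>x. inverse (g x)) (inverse d)"
    by (rule near_differentiable[OF assms(2) DERIV_inverse[OF assms(3)]])
  from near_mult[OF assms(1) this] show ?thesis by (simp add: divide_inverse)
qed

lemma near_prod_mset:
  "(\<And>j. j \<in># f \<Longrightarrow> near \<Phi> e (\<lambda>x. a x j) (b j)) \<Longrightarrow> near \<Phi> e (\<lambda>x. \<Prod>j\<in>#f. a x j) (\<Prod>j\<in>#f. b j)"
  by (induction f) (auto simp: near_const intro!: near_mult)

lemma near_prod_list:
  "(\<And>j. j \<in> set I \<Longrightarrow> near \<Phi> e (\<lambda>x. a x j) (b j)) \<Longrightarrow> near \<Phi> e (\<lambda>x. \<Prod>j\<leftarrow>I. a x j) (\<Prod>j\<leftarrow>I. b j)"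
  by (induction I) (auto simp: near_const intro!: near_mult)

text \<open>A left inverse of the limit system bounds a vector by its image under the limit system, and the
  difference of the two systems contributes at most half of the norm of the vector.\<close>

lemma injective_system_bound:
  fixes Ah :: "'x \<Rightarrow> 's \<Rightarrow> 't \<Rightarrow> complex"
  assumes fin: "finite S" "finite T"
    and near: "\<And>s t. s \<in> S \<Longrightarrow> t \<in> T \<Longrightarrow> near \<Phi> e (\<lambda>x. Ah x s t) (A s t)"
    and inj: "\<And>h. (\<forall>s\<in>S. (\<Sum>t\<in>T. A s t * h t) = 0) \<Longrightarrow> \<forall>t\<in>T. h t = 0"
  shows "\<exists>K\<ge>0. \<forall>\<^sub>F x in \<Phi>. \<forall>h. (\<Sum>t\<in>T. norm (h t)) \<le> K * (\<Sum>s\<in>S. norm (\<Sum>t\<in>T. Ah x s t * h t))"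
proof -
  obtain L where L: "\<And>t t'. t \<in> T \<Longrightarrow> t' \<in> T \<Longrightarrow>
      (\<Sum>s\<in>S. L t s * A s t') = (if t = t' then 1 else 0)"
    using left_inverse_of_injective[OF fin(2,1) inj] by blast
  obtain C where C: "C \<ge> 0" "\<forall>\<^sub>F x in \<Phi>. \<forall>st\<in>S\<times>T. norm (Ah x (fst st) (snd st) - A (fst st) (snd st)) \<le> C * e x"
    using small_uniform[of "S \<times> T" "\<lambda>st x. Ah x (fst st) (snd st) - A (fst st) (snd st)"] fin near
    unfolding near_def by auto
  define K where "K = (\<Sum>t\<in>T. \<Sum>s\<in>S. norm (L t s))"
  have K: "K \<ge> 0" by (auto simp: K_def intro!: sum_nonneg)
  have "\<forall>\<^sub>F x in \<Phi>. (K * C) * e x < 1/2" by (rule eventually_mult_e_less) simp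
  with C(2) have "\<forall>\<^sub>F x in \<Phi>. \<forall>h. (\<Sum>t\<in>T. norm (h t)) \<le> (2 * K) * (\<Sum>s\<in>S. norm (\<Sum>t\<in>T. Ah x s t * h t))"
  proof eventually_elim
    case (elim x)
    show ?case
    proof
      fix h :: "'t \<Rightarrow> complex"
      define H where "H = (\<Sum>t\<in>T. norm (h t))"
      define R where "R s = (\<Sum>t\<in>T. Ah x s t * h t)" for s
      define Rs where "Rs = (\<Sum>s\<in>S. norm (R s))"
      have H: "H \<ge> 0" by (auto simp: H_def intro!: sum_nonneg)
      have "norm (h t) \<le> (\<Sum>s\<in>S. norm (L t s)) * (Rs + C * e x * H)" if t: "t \<in> T" for t
      proof -
        have "h t = (\<Sum>t'\<in>T. (if t = t' then 1 else 0) * h t')"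
        proof -
          have "(\<Sum>t'\<in>T. (if t = t' then 1 else 0) * h t') = (\<Sum>t'\<in>T. if t = t' then h t' else 0)"
            by (intro sum.cong) auto
          then show ?thesis using t fin by simp
        qed
        also have "\<dots> = (\<Sum>t'\<in>T. (\<Sum>s\<in>S. L t s * A s t') * h t')"
          using L t by (intro sum.cong) auto
        also have "\<dots> = (\<Sum>s\<in>S. L t s * (\<Sum>t'\<in>T. A s t' * h t'))"
          by (subst sum_distrib_right, subst sum.swap) (simp add: sum_distrib_left mult.assoc)
        also have "norm \<dots> \<le> (\<Sum>s\<in>S. norm (L t s) * (Rs + C * e x * H))"
        proof (rule order_trans[OF norm_sum], rule sum_mono)
          fix s assume s: "s \<in> S"
          have "(\<Sum>t'\<in>T. A s t' * h t') = R s - (\<Sum>t'\<in>T. (Ah x s t' - A s t') * h t')"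
            by (simp add: R_def left_diff_distrib sum_subtractf)
          also have "norm \<dots> \<le> norm (R s) + (\<Sum>t'\<in>T. C * e x * norm (h t'))"
          proof (rule order_trans[OF norm_triangle_ineq4], rule add_left_mono, rule order_trans[OF norm_sum], rule sum_mono)
            fix t' assume "t' \<in> T"
            then show "norm ((Ah x s t' - A s t') * h t') \<le> C * e x * norm (h t')"
              using elim(1) s unfolding norm_mult by (intro mult_right_mono) auto
          qed
          also have "norm (R s) \<le> Rs" unfolding Rs_def using s fin by (intro member_le_sum) auto
          finally have "norm (\<Sum>t'\<in>T. A s t' * h t') \<le> Rs + C * e x * H"
            by (simp add: H_def sum_distrib_left)
          then show "norm (L t s * (\<Sum>t'\<in>T. A s t' * h t')) \<le> norm (L t s) * (Rs + C * e x * H)"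
            unfolding norm_mult by (intro mult_left_mono) auto
        qed
        finally show ?thesis by (simp add: sum_distrib_right)
      qed
      then have "H \<le> K * (Rs + C * e x * H)"
        unfolding H_def K_def sum_distrib_right[of _ T] by (intro sum_mono) auto
      also have "K * (Rs + C * e x * H) = K * Rs + (K * C * e x) * H" by (simp add: algebra_simps)
      also have "(K * C * e x) * H \<le> 1/2 * H" using elim(2) H by (intro mult_right_mono) auto
      finally show "H \<le> 2 * K * (\<Sum>s\<in>S. norm (R s))" by (simp add: Rs_def)
    qed
  qed
  then show ?thesis using K by (intro exI[of _ "2 * K"]) auto
qed

lemma eventually_injective:
  assumes "finite S" "finite T"
    and "\<And>s t. s \<in> S \<Longrightarrow> t \<in> T \<Longrightarrow> near \<Phi> e (\<lambda>x. Ah x s t) (A s t)"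
    and "\<And>h. (\<forall>s\<in>S. (\<Sum>t\<in>T. A s t * h t) = 0) \<Longrightarrow> \<forall>t\<in>T. h t = 0"
  shows "\<forall>\<^sub>F x in \<Phi>. \<forall>h. (\<forall>s\<in>S. (\<Sum>t\<in>T. Ah x s t * h t) = 0) \<longrightarrow> (\<forall>t\<in>T. h t = 0)"
proof -
  obtain K where "\<forall>\<^sub>F x in \<Phi>. \<forall>h. (\<Sum>t\<in>T. norm (h t)) \<le> K * (\<Sum>s\<in>S. norm (\<Sum>t\<in>T. Ah x s t * h t))"
    using injective_system_bound[of S T Ah A, OF assms] by blast
  then show ?thesis
  proof eventually_elim
    case (elim x)
    show ?case
    proof (intro allI impI)
      fix h assume "\<forall>s\<in>S. (\<Sum>t\<in>T. Ah x s t * h t) = 0"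
      then have "(\<Sum>t\<in>T. norm (h t)) \<le> 0" using elim[rule_format, of h] by simp
      then have "(\<Sum>t\<in>T. norm (h t)) = 0" by (intro antisym sum_nonneg) auto
      then show "\<forall>t\<in>T. h t = 0" using assms(2) by (simp add: sum_nonneg_eq_0_iff)
    qed
  qed
qed

lemma near_solution:
  assumes fin: "finite S" "finite T"
    and near: "\<And>s t. s \<in> S \<Longrightarrow> t \<in> T \<Longrightarrow> near \<Phi> e (\<lambda>x. Ah x s t) (A s t)"
    and inj: "\<And>h. (\<forall>s\<in>S. (\<Sum>t\<in>T. A s t * h t) = 0) \<Longrightarrow> \<forall>t\<in>T. h t = 0"
    and rhs: "\<And>s. s \<in> S \<Longrightarrow> near \<Phi> e (\<lambda>x. \<Sum>t\<in>T. Ah x s t * h x t) (\<Sum>t\<in>T. A s t * h0 t)"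
    and t: "t \<in> T"
  shows "near \<Phi> e (\<lambda>x. h x t) (h0 t)"
proof -
  obtain K where K: "K \<ge> 0" "\<forall>\<^sub>F x in \<Phi>. \<forall>h. (\<Sum>t\<in>T. norm (h t)) \<le> K * (\<Sum>s\<in>S. norm (\<Sum>t\<in>T. Ah x s t * h t))"
    using injective_system_bound[of S T Ah A, OF fin near inj] by blast
  have "small \<Phi> e (\<lambda>x. \<Sum>t\<in>T. Ah x s t * (h x t - h0 t))" if "s \<in> S" for s
  proof -
    have "near \<Phi> e (\<lambda>x. \<Sum>t\<in>T. Ah x s t * h0 t) (\<Sum>t\<in>T. A s t * h0 t)"
      using that near by (intro near_sum near_mult near_const) auto
    from small_diff[OF rhs[OF that, unfolded near_def] this[unfolded near_def]]
    show ?thesis by (simp add: right_diff_distrib sum_subtractf)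
  qed
  then obtain C where "\<forall>\<^sub>F x in \<Phi>. \<forall>s\<in>S. norm (\<Sum>t\<in>T. Ah x s t * (h x t - h0 t)) \<le> C * e x"
    using small_uniform[OF fin(1), of "\<lambda>s x. \<Sum>t\<in>T. Ah x s t * (h x t - h0 t)"] by blast
  with K(2) have "\<forall>\<^sub>F x in \<Phi>. norm (h x t - h0 t) \<le> (K * (card S * C)) * e x"
  proof eventually_elim
    case (elim x)
    have "norm (h x t - h0 t) \<le> (\<Sum>t\<in>T. norm (h x t - h0 t))"
      using t fin by (intro member_le_sum) auto
    also have "\<dots> \<le> K * (\<Sum>s\<in>S. norm (\<Sum>t\<in>T. Ah x s t * (h x t - h0 t)))"
      using elim(1)[rule_format, of "\<lambda>t. h x t - h0 t"] .
    also have "\<dots> \<le> K * (card S * (C * e x))"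
      using elim(2) by (intro mult_left_mono K sum_bounded_above) auto
    finally show ?case by (simp add: mult.assoc)
  qed
  then show ?thesis unfolding near_def small_def by blast
qed

text \<open>The competitor \<open>g0\<close> has residual \<open>O(e)\<close>, so the minimizer has too, whether it is unique or not.\<close>

lemma small_minimizer_residual:
  assumes "finite S"
    and "\<forall>\<^sub>F x in \<Phi>. minimizer (\<lambda>g. (frob_norm S (R x g))\<^sup>2) (gh x)"
    and "\<And>s. s \<in> S \<Longrightarrow> small \<Phi> e (\<lambda>x. R x g0 s)"
    and "s \<in> S"
  shows "small \<Phi> e (\<lambda>x. R x (gh x) s)"
proof -
  obtain C where "\<forall>\<^sub>F x in \<Phi>. \<forall>s\<in>S. norm (R x g0 s) \<le> C * e x"
    using small_uniform[OF assms(1), of "\<lambda>s x. R x g0 s"] assms(3) by blast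
  with assms(2) have "\<forall>\<^sub>F x in \<Phi>. norm (R x (gh x) s) \<le> (card S * C) * e x"
  proof eventually_elim
    case (elim x)
    have "norm (R x (gh x) s) \<le> frob_norm S (R x (gh x))"
      unfolding frob_norm_def using assms by (intro member_le_L2_set)
    also have "(frob_norm S (R x (gh x)))\<^sup>2 \<le> (frob_norm S (R x g0))\<^sup>2"
      using elim(1) unfolding minimizer_def is_arg_min_def by (simp add: not_less)
    then have "frob_norm S (R x (gh x)) \<le> frob_norm S (R x g0)"
      by (rule power2_le_imp_le) (simp add: frob_norm_def)
    also have "\<dots> \<le> (\<Sum>s\<in>S. norm (R x g0 s))"
      unfolding frob_norm_def by (rule L2_set_le_sum) simp
    also have "\<dots> \<le> card S * (C * e x)" using elim(2) by (intro sum_bounded_above) auto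
    finally show ?case by (simp add: mult.assoc)
  qed
  then show ?thesis unfolding small_def by blast
qed

end

section \<open>Perturbed eigenvectors\<close>

lemma finite_has_largest:
  fixes f :: "'j \<Rightarrow> real"
  assumes "finite J" "J \<noteq> {}"
  obtains s where "s \<in> J" "\<And>j. j \<in> J \<Longrightarrow> f j \<le> f s"
proof -
  have "Max (f ` J) \<in> f ` J" using assms by (intro Max_in) auto
  then obtain s where s: "s \<in> J" "f s = Max (f ` J)" by force
  have "f j \<le> f s" if "j \<in> J" for j unfolding s(2) using that assms by (intro Max_ge) auto
  then show ?thesis using s that by blast
qed

lemma exists_gap:
  fixes \<theta> :: "nat \<Rightarrow> complex"
  assumes "finite J" "inj_on \<theta> J"
  shows "\<exists>g>0. \<forall>i\<in>J. \<forall>j\<in>J. i \<noteq> j \<longrightarrow> g \<le> norm (\<theta> i - \<theta> j)"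
proof -
  \<comment> \<open>The element 1 keeps \<open>D\<close> nonempty when \<open>J\<close> has at most one element.\<close>
  define D where "D = insert 1 ((\<lambda>(i, j). norm (\<theta> i - \<theta> j)) ` {(i, j) \<in> J \<times> J. i \<noteq> j})"
  have fin: "finite D"
  proof -
    have "finite {(i, j) \<in> J \<times> J. i \<noteq> j}"
      by (rule finite_subset[of _ "J \<times> J"]) (use assms in auto)
    then show ?thesis by (simp add: D_def)
  qed
  have "\<forall>d\<in>D. d > 0" using assms(2) by (auto simp: D_def inj_on_def)
  then have "Min D > 0" using fin by (simp add: D_def)
  moreover have "Min D \<le> norm (\<theta> i - \<theta> j)" if "i \<in> J" "j \<in> J" "i \<noteq> j" for i j
    by (rule Min_le[OF fin]) (use that in \<open>auto simp: D_def\<close>)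
  ultimately show ?thesis by blast
qed

text \<open>At a coordinate \<open>s\<close> of maximal modulus, row \<open>s\<close> shows that \<open>t\<close> is close to \<open>\<theta> s\<close>. Then \<open>t\<close> is at
  distance at least \<open>g / 2\<close> from the other diagonal entries, which makes the other coordinates small.\<close>

lemma dominant_coordinate:
  fixes \<theta> x :: "'j \<Rightarrow> complex" and E :: "'j \<Rightarrow> 'j \<Rightarrow> complex" and d g :: real
  assumes J: "finite J" and nz: "\<exists>j\<in>J. x j \<noteq> 0"
    and eig: "\<And>i. i \<in> J \<Longrightarrow> \<theta> i * x i + (\<Sum>j\<in>J. E i j * x j) = t * x i"
    and E: "\<And>i j. i \<in> J \<Longrightarrow> j \<in> J \<Longrightarrow> norm (E i j) \<le> d"
    and gap: "\<And>i j. i \<in> J \<Longrightarrow> j \<in> J \<Longrightarrow> i \<noteq> j \<Longrightarrow> g \<le> norm (\<theta> i - \<theta> j)"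
    and g: "g > 0" and d: "4 * card J * d < g"
  shows "\<exists>s\<in>J. x s \<noteq> 0 \<and> norm (\<theta> s - t) \<le> card J * d \<and>
           (\<forall>j\<in>J. j \<noteq> s \<longrightarrow> norm (x j) \<le> 2 * card J * d / g * norm (x s))"
proof -
  have "J \<noteq> {}" using nz by auto
  then obtain s where s: "s \<in> J" "\<And>j. j \<in> J \<Longrightarrow> norm (x j) \<le> norm (x s)"
    using finite_has_largest[OF J, of "\<lambda>j. norm (x j)"] by blast
  obtain j0 where "j0 \<in> J" "norm (x j0) > 0" using nz by auto
  then have xs: "norm (x s) > 0" using s(2)[of j0] by linarith
  have defect: "norm ((\<theta> i - t) * x i) \<le> card J * d * norm (x s)" if "i \<in> J" for i
  proof -
    have "(\<theta> i - t) * x i = - (\<Sum>j\<in>J. E i j * x j)"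
      using eig[OF that] by (simp add: algebra_simps eq_neg_iff_add_eq_0)
    also have "norm \<dots> \<le> (\<Sum>j\<in>J. d * norm (x s))"
      unfolding norm_minus_cancel
    proof (rule order_trans[OF norm_sum], rule sum_mono)
      fix j assume j: "j \<in> J"
      have "0 \<le> d" using E[OF that j] norm_ge_zero order_trans by blast
      then show "norm (E i j * x j) \<le> d * norm (x s)"
        unfolding norm_mult by (intro mult_mono E that j s) auto
    qed
    finally show ?thesis by (simp add: mult.assoc)
  qed
  have ts: "norm (\<theta> s - t) \<le> card J * d"
    using defect[OF s(1)] xs by (simp add: norm_mult)
  moreover have "norm (x j) \<le> 2 * card J * d / g * norm (x s)" if "j \<in> J" "j \<noteq> s" for j
  proof -
    have "g \<le> norm (\<theta> s - t) + norm (\<theta> j - t)"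
      using gap[of s j] that s norm_triangle_ineq4[of "\<theta> s - t" "\<theta> j - t"] by fastforce
    then have "g / 2 \<le> norm (\<theta> j - t)" using ts d g by simp
    then have "g / 2 * norm (x j) \<le> norm ((\<theta> j - t) * x j)"
      unfolding norm_mult by (intro mult_right_mono) auto
    also have "\<dots> \<le> card J * d * norm (x s)" by (rule defect[OF that(1)])
    finally show ?thesis using g by (simp add: field_simps)
  qed
  ultimately show ?thesis using s xs by auto
qed

text \<open>Near a simple diagonal entry there is only one eigenvector: normalize both vectors at \<open>s\<close>; the
  largest coordinate of their difference is then bounded by a proper fraction of itself.\<close>

lemma dominant_coordinate_determines_direction:
  fixes \<theta> x x' :: "'j \<Rightarrow> complex" and E :: "'j \<Rightarrow> 'j \<Rightarrow> complex" and d g :: real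
  assumes J: "finite J"
    and eig: "\<And>i. i \<in> J \<Longrightarrow> \<theta> i * x i + (\<Sum>j\<in>J. E i j * x j) = t * x i"
    and eig': "\<And>i. i \<in> J \<Longrightarrow> \<theta> i * x' i + (\<Sum>j\<in>J. E i j * x' j) = t' * x' i"
    and E: "\<And>i j. i \<in> J \<Longrightarrow> j \<in> J \<Longrightarrow> norm (E i j) \<le> d"
    and gap: "\<And>i j. i \<in> J \<Longrightarrow> j \<in> J \<Longrightarrow> i \<noteq> j \<Longrightarrow> g \<le> norm (\<theta> i - \<theta> j)"
    and g: "g > 0" and d: "4 * card J * d < g"
    and s: "s \<in> J" "x s \<noteq> 0" "x' s \<noteq> 0"
    and dom: "norm (\<theta> s - t) \<le> card J * d"
      "\<And>j. j \<in> J \<Longrightarrow> j \<noteq> s \<Longrightarrow> norm (x' j) \<le> 2 * card J * d / g * norm (x' s)"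
    and i: "i \<in> J"
  shows "x i * x' s = x' i * x s"
proof -
  have d0: "0 \<le> d" using E[OF s(1) s(1)] norm_ge_zero order_trans by blast
  define y where "y i = x i / x s" for i
  define y' where "y' i = x' i / x' s" for i
  define D where "D i = y i - y' i" for i
  have eq: "\<theta> i * y i + (\<Sum>j\<in>J. E i j * y j) = t * y i" if "i \<in> J" for i
    using arg_cong[OF eig[OF that], of "\<lambda>z. z / x s"] by (simp add: y_def add_divide_distrib sum_divide_distrib)
  have eq': "\<theta> i * y' i + (\<Sum>j\<in>J. E i j * y' j) = t' * y' i" if "i \<in> J" for i
    using arg_cong[OF eig'[OF that], of "\<lambda>z. z / x' s"] by (simp add: y'_def add_divide_distrib sum_divide_distrib)
  have ys: "y s = 1" "y' s = 1" using s by (auto simp: y_def y'_def)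
  have y'1: "norm (y' j) \<le> 1" if "j \<in> J" "j \<noteq> s" for j
  proof -
    have "norm (y' j) \<le> 2 * card J * d / g"
      using dom(2)[OF that] s(3) by (simp add: y'_def norm_divide pos_divide_le_eq)
    also have "\<dots> \<le> 1" using d d0 g by (simp add: divide_simps)
    finally show ?thesis .
  qed
  obtain a where a: "a \<in> J" "\<And>j. j \<in> J \<Longrightarrow> norm (D j) \<le> norm (D a)"
    using finite_has_largest[OF J, of "\<lambda>j. norm (D j)"] s(1) by blast
  have ED: "norm (\<Sum>j\<in>J. E i j * D j) \<le> card J * d * norm (D a)" if "i \<in> J" for i
  proof -
    have "norm (\<Sum>j\<in>J. E i j * D j) \<le> (\<Sum>j\<in>J. d * norm (D a))"
    proof (rule order_trans[OF norm_sum], rule sum_mono)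
      fix j assume j: "j \<in> J"
      show "norm (E i j * D j) \<le> d * norm (D a)"
        unfolding norm_mult by (intro mult_mono E that j a d0) auto
    qed
    then show ?thesis by (simp add: mult.assoc)
  qed
  have "D a = 0"
  proof (rule ccontr)
    assume na: "D a \<noteq> 0"
    then have as: "a \<noteq> s" using ys by (auto simp: D_def)
    \<comment> \<open>Row \<open>s\<close>, where both vectors are 1, bounds the difference of the eigenvalues.\<close>
    have "t - t' = (\<Sum>j\<in>J. E s j * D j)"
      using eq[OF s(1), symmetric] eq'[OF s(1), symmetric] ys
      by (simp add: D_def right_diff_distrib sum_subtractf)
    then have tt: "norm (t - t') \<le> card J * d * norm (D a)" using ED[OF s(1)] by simp
    have "(t - \<theta> a) * D a = (\<Sum>j\<in>J. E a j * D j) - (t - t') * y' a"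
      using eq[OF a(1)] eq'[OF a(1)]
      by (simp add: D_def right_diff_distrib left_diff_distrib sum_subtractf algebra_simps)
    then have "norm (t - \<theta> a) * norm (D a) \<le> norm (\<Sum>j\<in>J. E a j * D j) + norm (t - t') * norm (y' a)"
      by (metis norm_mult norm_triangle_ineq4)
    also have "\<dots> \<le> card J * d * norm (D a) + (card J * d * norm (D a)) * 1"
      using d0 by (intro add_mono mult_mono ED a tt y'1 as) auto
    finally have "norm (t - \<theta> a) \<le> 2 * card J * d" using na by (simp add: field_simps)
    moreover have "g \<le> norm (\<theta> s - t) + norm (t - \<theta> a)"
      using gap[OF s(1) a(1)] as norm_triangle_ineq[of "\<theta> s - t" "t - \<theta> a"] by fastforce
    ultimately have "g \<le> 3 * (card J * d)" using dom(1) by (simp add: algebra_simps)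
    moreover have "0 \<le> card J * d" using d0 by simp
    ultimately show False using d by simp
  qed
  then have "D i = 0" using a(2)[OF i] by simp
  then show ?thesis using s by (simp add: D_def y_def y'_def field_simps)
qed

section \<open>Alignment by roots of unity\<close>

context vanishing begin

text \<open>Dividing by the principal root of the quotient of the two powers, which is close to 1, turns
  \<open>a\<close> into an \<open>m\<close>-th root of \<open>b ^ m\<close>, hence into \<open>b\<close> times a root of unity.\<close>

lemma near_up_to_root_of_unity:
  assumes a: "near \<Phi> e (\<lambda>x. a x ^ m) (b ^ m)" and b: "b \<noteq> 0" and m: "m > 0"
  shows "\<exists>\<eta>. (\<forall>\<^sub>F x in \<Phi>. \<eta> x ^ m = 1) \<and> near \<Phi> e (\<lambda>x. \<eta> x * a x) b"
proof -
  define s where "s x = a x ^ m / b ^ m" for x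
  define \<eta> where "\<eta> x = b * s x powr (1 / of_nat m) / a x" for x
  have s: "near \<Phi> e s 1"
    unfolding s_def using near_divide[OF a near_const, of "b ^ m"] b by simp
  have "((\<lambda>z::complex. z powr (1 / of_nat m)) has_field_derivative (1 / of_nat m) * 1 powr (1 / of_nat m - 1)) (at 1)"
    by (rule has_field_derivative_powr) auto
  from near_differentiable[OF s this] have sm: "near \<Phi> e (\<lambda>x. s x powr (1 / of_nat m)) 1" by simp
  have a0: "\<forall>\<^sub>F x in \<Phi>. a x \<noteq> 0"
    using near_eventually_nonzero[OF a] b m by (auto elim!: eventually_mono)
  have "\<forall>\<^sub>F x in \<Phi>. \<eta> x ^ m = 1" using a0
  proof eventually_elim
    case (elim x)
    then have "s x \<noteq> 0" using b by (simp add: s_def)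
    then have "(s x powr (1 / of_nat m)) ^ m = s x"
      using m by (simp add: powr_def exp_of_nat_mult[symmetric])
    then show ?case using elim b by (simp add: \<eta>_def power_mult_distrib power_divide s_def)
  qed
  moreover have "near \<Phi> e (\<lambda>x. \<eta> x * a x) b"
  proof (rule near_cong)
    show "near \<Phi> e (\<lambda>x. b * s x powr (1 / of_nat m)) b" using near_mult[OF near_const sm, of b] by simp
    show "\<forall>\<^sub>F x in \<Phi>. b * s x powr (1 / of_nat m) = \<eta> x * a x"
      using a0 by eventually_elim (simp add: \<eta>_def)
  qed
  ultimately show ?thesis by blast
qed

text \<open>The vectors are products of a leading entry, known only through its \<open>m\<close>-th power, and a vector of
  quotients that is approximated directly.\<close>

lemma aligned_vectors_close:
  fixes q' u' :: "'x \<Rightarrow> nat \<Rightarrow> nat \<Rightarrow> complex"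
  assumes m: "m > 0"
    and lead: "\<And>i. i \<in> {1..r} \<Longrightarrow> near \<Phi> e (\<lambda>x. q' x i 0 ^ m) (q i 0 ^ m)"
    and nz: "\<And>i. i \<in> {1..r} \<Longrightarrow> q i 0 \<noteq> 0"
    and q': "\<forall>\<^sub>F x in \<Phi>. \<forall>i\<in>{1..r}. \<forall>j\<in>{0..n}. q' x i j = q' x i 0 * u' x i j"
    and q: "\<And>i j. i \<in> {1..r} \<Longrightarrow> j \<in> {0..n} \<Longrightarrow> q i j = q i 0 * u i j"
    and u: "\<And>i j. i \<in> {1..r} \<Longrightarrow> j \<in> {0..n} \<Longrightarrow> near \<Phi> e (\<lambda>x. u' x i j) (u i j)"
  shows "\<exists>C. \<forall>\<^sub>F x in \<Phi>. \<exists>\<eta>. \<forall>i\<in>{1..r::nat}. \<eta> i ^ m = (1::complex) \<and>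
           frob_norm {0..n} (\<lambda>j. \<eta> i * q' x i j - q i j) \<le> C * e x"
proof -
  have "\<forall>i\<in>{1..r}. \<exists>\<eta>. (\<forall>\<^sub>F x in \<Phi>. \<eta> x ^ m = 1) \<and> near \<Phi> e (\<lambda>x. \<eta> x * q' x i 0) (q i 0)"
    using near_up_to_root_of_unity[OF lead nz m] by blast
  from bchoice[OF this] obtain \<eta> where \<eta>:
    "\<And>i. i \<in> {1..r} \<Longrightarrow> \<forall>\<^sub>F x in \<Phi>. \<eta> i x ^ m = 1"
    "\<And>i. i \<in> {1..r} \<Longrightarrow> near \<Phi> e (\<lambda>x. \<eta> i x * q' x i 0) (q i 0)"
    by blast
  have "small \<Phi> e (\<lambda>x. \<eta> i x * q' x i j - q i j)" if ij: "i \<in> {1..r}" "j \<in> {0..n}" for i j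
  proof (rule small_cong)
    show "small \<Phi> e (\<lambda>x. \<eta> i x * q' x i 0 * u' x i j - q i 0 * u i j)"
      using near_mult[OF \<eta>(2)[OF ij(1)] u[OF ij]] unfolding near_def .
    show "\<forall>\<^sub>F x in \<Phi>. \<eta> i x * q' x i 0 * u' x i j - q i 0 * u i j = \<eta> i x * q' x i j - q i j"
      using q'
    proof eventually_elim
      case (elim x)
      have "q' x i j = q' x i 0 * u' x i j" using elim ij by blast
      then show ?case unfolding q[OF ij] by (simp only: mult.assoc)
    qed
  qed
  then have sm: "small \<Phi> e (\<lambda>x. \<eta> (fst ij) x * q' x (fst ij) (snd ij) - q (fst ij) (snd ij))"
    if "ij \<in> {1..r}\<times>{0..n}" for ij
    using that by (simp add: mem_Times_iff)
  have fin: "finite ({1..r::nat} \<times> {0..n::nat})" by simp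
  obtain C where C: "\<forall>\<^sub>F x in \<Phi>. \<forall>ij\<in>{1..r}\<times>{0..n}.
      norm (\<eta> (fst ij) x * q' x (fst ij) (snd ij) - q (fst ij) (snd ij)) \<le> C * e x"
    using small_uniform[of "{1..r} \<times> {0..n}"
        "\<lambda>ij x. \<eta> (fst ij) x * q' x (fst ij) (snd ij) - q (fst ij) (snd ij)", OF fin sm] by blast
  moreover have "\<forall>\<^sub>F x in \<Phi>. \<forall>i\<in>{1..r}. \<eta> i x ^ m = 1"
    using \<eta>(1) by (intro eventually_ball_finite) auto
  ultimately have "\<forall>\<^sub>F x in \<Phi>. \<forall>i\<in>{1..r}. \<eta> i x ^ m = 1 \<and>
      frob_norm {0..n} (\<lambda>j. \<eta> i x * q' x i j - q i j) \<le> (card {0..n} * C) * e x"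
  proof eventually_elim
    case (elim x)
    have "frob_norm {0..n} (\<lambda>j. \<eta> i x * q' x i j - q i j) \<le> (card {0..n} * C) * e x" if "i \<in> {1..r}" for i
    proof -
      have "frob_norm {0..n} (\<lambda>j. \<eta> i x * q' x i j - q i j) \<le> (\<Sum>j\<in>{0..n}. norm (\<eta> i x * q' x i j - q i j))"
        unfolding frob_norm_def by (rule L2_set_le_sum) simp
      also have "\<dots> \<le> card {0..n} * (C * e x)"
        by (intro sum_bounded_above) (use elim(1) that in \<open>force simp: mem_Times_iff\<close>)
      finally show ?thesis by (simp only: mult.assoc)
    qed
    then show ?case using elim(2) by blast
  qed
  then have "\<forall>\<^sub>F x in \<Phi>. \<exists>\<eta>. \<forall>i\<in>{1..r}. \<eta> i ^ m = 1 \<and>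
      frob_norm {0..n} (\<lambda>j. \<eta> i * q' x i j - q i j) \<le> (card {0..n} * C) * e x"
  proof eventually_elim
    case (elim x)
    show ?case using elim by (rule exI[of _ "\<lambda>i. \<eta> i x"])
  qed
  then show ?thesis by blast
qed

lemma restricted: "vanishing (inf \<Phi> \<Psi>) e"
  by unfold_locales (auto simp: e_nonneg intro: tendsto_mono[OF _ e_tendsto])

text \<open>Finitely many alternatives, each holding on its own part of the filter with its own constant,
  can be treated with the sum of the constants.\<close>

lemma bound_by_cases:
  assumes "finite S" and "\<forall>\<^sub>F x in \<Phi>. \<sigma> x \<in> S"
    and "\<And>s. s \<in> S \<Longrightarrow> \<exists>C. \<forall>\<^sub>F x in inf \<Phi> (principal {x. \<sigma> x = s}). P (C * e x) x"
    and mono: "\<And>d d' x. d \<le> d' \<Longrightarrow> P d x \<Longrightarrow> P d' x"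
  shows "\<exists>C. \<forall>\<^sub>F x in \<Phi>. P (C * e x) x"
proof -
  obtain C where C: "\<And>s. s \<in> S \<Longrightarrow> \<forall>\<^sub>F x in inf \<Phi> (principal {x. \<sigma> x = s}). P (C s * e x) x"
    using assms(3) by metis
  have "\<forall>\<^sub>F x in \<Phi>. \<forall>s\<in>S. \<sigma> x = s \<longrightarrow> P (C s * e x) x"
    using C assms(1) unfolding eventually_inf_principal mem_Collect_eq by (intro eventually_ball_finite) auto
  with assms(2) have "\<forall>\<^sub>F x in \<Phi>. P ((\<Sum>s\<in>S. \<bar>C s\<bar>) * e x) x"
  proof eventually_elim
    case (elim x)
    have "C (\<sigma> x) \<le> (\<Sum>s\<in>S. \<bar>C s\<bar>)"
      using member_le_sum[of "\<sigma> x" S "\<lambda>s. \<bar>C s\<bar>"] elim(1) assms(1) by auto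
    then have "C (\<sigma> x) * e x \<le> (\<Sum>s\<in>S. \<bar>C s\<bar>) * e x" by (intro mult_right_mono e_nonneg)
    then show ?case using elim mono by blast
  qed
  then show ?thesis by blast
qed

end

section \<open>From filters to explicit constants\<close>

lemma vanishing_on_set:
  assumes "\<And>x. 0 \<le> e x"
  shows "vanishing (inf (filtercomap e (nhds 0)) (principal X)) e"
proof
  show "(e \<longlongrightarrow> 0) (inf (filtercomap e (nhds 0)) (principal X))"
    by (rule tendsto_mono[OF inf_le1 filterlim_filtercomap])
qed (rule assms)

text \<open>The constants are uniform because a single filter comprises all inputs in \<open>X\<close> with a small error.\<close>

lemma bound_near_zero:
  assumes nonneg: "\<And>x. 0 \<le> e x"
    and "\<exists>C. \<forall>\<^sub>F x in inf (filtercomap e (nhds 0)) (principal X). P (C * e x) x"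
  shows "\<exists>C \<delta> :: real. \<delta> > 0 \<and> (\<forall>x\<in>X. e x < \<delta> \<longrightarrow> P (C * e x) x)"
proof -
  obtain C where "\<forall>\<^sub>F x in filtercomap e (nhds 0). x \<in> X \<longrightarrow> P (C * e x) x"
    using assms(2) by (auto simp: eventually_inf_principal)
  then obtain Q where Q: "\<forall>\<^sub>F y in nhds 0. Q y" "\<And>x. Q (e x) \<Longrightarrow> x \<in> X \<longrightarrow> P (C * e x) x"
    by (auto simp: eventually_filtercomap)
  obtain \<delta> where "\<delta> > 0" "\<And>y. dist y 0 < \<delta> \<Longrightarrow> Q y"
    using Q(1) by (auto simp: eventually_nhds_metric)
  then have "\<forall>x\<in>X. e x < \<delta> \<longrightarrow> P (C * e x) x" using Q(2) nonneg by (simp add: dist_norm)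
  then show ?thesis using \<open>\<delta> > 0\<close> by blast
qed

section \<open>Closeness up to relabelling\<close>

lemma close_up_to_mono: "d \<le> d' \<Longrightarrow> close_up_to m n r d q' q \<Longrightarrow> close_up_to m n r d' q' q"
  unfolding close_up_to_def by (meson order_trans)

lemma norm_root_of_unity: "\<eta> ^ m = (1::complex) \<Longrightarrow> m > 0 \<Longrightarrow> norm \<eta> = 1"
  using power_eq_1_iff by blast

text \<open>Distance 0 is equality up to relabelling and roots of unity, both of which can be composed with
  those relating \<open>q'\<close> to \<open>q1\<close>.\<close>

lemma close_up_to_change_target:
  assumes m: "m > 0" and c1: "close_up_to m n r d q' q1" and c0: "close_up_to m n r 0 q q1"
  shows "close_up_to m n r d q' q"
proof -
  obtain \<sigma>' \<eta>' where 1: "\<sigma>' permutes {1..r}" "\<And>i. i \<in> {1..r} \<Longrightarrow> \<eta>' i ^ m = 1"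
    "\<And>i. i \<in> {1..r} \<Longrightarrow> frob_norm {0..n} (\<lambda>j. \<eta>' i * q' i j - q1 (\<sigma>' i) j) \<le> d"
    using c1 unfolding close_up_to_def by blast
  obtain \<sigma> \<eta> where 2: "\<sigma> permutes {1..r}" "\<And>i. i \<in> {1..r} \<Longrightarrow> \<eta> i ^ m = 1"
    "\<And>i. i \<in> {1..r} \<Longrightarrow> frob_norm {0..n} (\<lambda>j. \<eta> i * q i j - q1 (\<sigma> i) j) \<le> 0"
    using c0 unfolding close_up_to_def by blast
  have eq: "q1 (\<sigma> i) j = \<eta> i * q i j" if "i \<in> {1..r}" "j \<in> {0..n}" for i j
  proof -
    have "L2_set (\<lambda>j. norm (\<eta> i * q i j - q1 (\<sigma> i) j)) {0..n} = 0"
      using 2(3)[OF that(1)] L2_set_nonneg unfolding frob_norm_def by (metis antisym)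
    then show ?thesis using that(2) by (simp add: L2_set_eq_0_iff)
  qed
  define \<tau> where "\<tau> = inv \<sigma> \<circ> \<sigma>'"
  have \<tau>: "\<tau> permutes {1..r}" unfolding \<tau>_def by (intro permutes_compose permutes_inv 1 2)
  have "(\<eta>' i / \<eta> (\<tau> i)) ^ m = 1 \<and> frob_norm {0..n} (\<lambda>j. \<eta>' i / \<eta> (\<tau> i) * q' i j - q (\<tau> i) j) \<le> d"
    if i: "i \<in> {1..r}" for i
  proof -
    have ti: "\<tau> i \<in> {1..r}" using permutes_in_image[OF \<tau>] i by blast
    have st: "\<sigma> (\<tau> i) = \<sigma>' i" using 2(1) by (simp add: \<tau>_def permutes_inverses)
    have n1: "norm (\<eta> (\<tau> i)) = 1" by (rule norm_root_of_unity[OF 2(2)[OF ti] m])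
    then have nz: "\<eta> (\<tau> i) \<noteq> 0" by auto
    have "norm (\<eta>' i / \<eta> (\<tau> i) * q' i j - q (\<tau> i) j) = norm (\<eta>' i * q' i j - q1 (\<sigma>' i) j)"
      if "j \<in> {0..n}" for j
    proof -
      have "\<eta>' i * q' i j - q1 (\<sigma>' i) j = \<eta> (\<tau> i) * (\<eta>' i / \<eta> (\<tau> i) * q' i j - q (\<tau> i) j)"
        using eq[OF ti that] nz by (simp add: st field_simps)
      then show ?thesis by (simp add: norm_mult n1)
    qed
    then have "frob_norm {0..n} (\<lambda>j. \<eta>' i / \<eta> (\<tau> i) * q' i j - q (\<tau> i) j)
        = frob_norm {0..n} (\<lambda>j. \<eta>' i * q' i j - q1 (\<sigma>' i) j)"
      unfolding frob_norm_def by (intro L2_set_cong) auto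
    then show ?thesis using 1 2(2)[OF ti] i by (simp add: power_divide)
  qed
  then show ?thesis unfolding close_up_to_def
    by (intro exI[of _ \<tau>] exI[of _ "\<lambda>i. \<eta>' i / \<eta> (\<tau> i)"]) (use \<tau> in blast)
qed

section \<open>Squarefree monomials\<close>

lemma sqfree_monomials_iff:
  assumes "finite A"
  shows "f \<in> sqfree_monomials A d \<longleftrightarrow> set_mset f \<subseteq> A \<and> size f = d \<and> (\<forall>j. count f j \<le> 1)"
proof
  assume "f \<in> sqfree_monomials A d"
  then obtain S where S: "S \<subseteq> A" "card S = d" "f = mset_set S" by (auto simp: sqfree_monomials_def)
  have "finite S" using S assms finite_subset by blast
  then show "set_mset f \<subseteq> A \<and> size f = d \<and> (\<forall>j. count f j \<le> 1)"
    using S by (auto simp: count_mset_set')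
next
  assume f: "set_mset f \<subseteq> A \<and> size f = d \<and> (\<forall>j. count f j \<le> 1)"
  have "f = mset_set (set_mset f)"
  proof (rule multiset_eqI)
    fix j
    have "count f j \<le> 1" using f by blast
    moreover have "count f j = 0 \<longleftrightarrow> j \<notin># f" by (simp add: count_eq_zero_iff)
    ultimately show "count f j = count (mset_set (set_mset f)) j"
      by (auto simp: count_mset_set' le_Suc_eq)
  qed
  moreover have "card (set_mset f) = d" using f calculation by (metis finite_set_mset size_mset_set)
  ultimately show "f \<in> sqfree_monomials A d" using f by (auto simp: sqfree_monomials_def)
qed

lemma finite_sqfree_monomials: "finite A \<Longrightarrow> finite (sqfree_monomials A d)"
proof -
  assume "finite A"
  moreover have "sqfree_monomials A d \<subseteq> mset_set ` Pow A" by (auto simp: sqfree_monomials_def)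
  ultimately show ?thesis by (meson finite_Pow_iff finite_imageI finite_subset)
qed

lemma finite_index_tuples: "finite (index_tuples m n)"
proof -
  have "index_tuples m n = {I. set I \<subseteq> {0..n} \<and> length I = m}" by (auto simp: index_tuples_def)
  then show ?thesis by (simp add: finite_lists_length_eq)
qed

lemma finite_Omega_set: "finite (Omega_set m n)"
  unfolding Omega_set_def using finite_index_tuples by simp

lemma mono_eval_add: "mono_eval (f + g) v = mono_eval f v * mono_eval g v"
  by (simp add: mono_eval_def)

lemma mono_eval_single: "mono_eval {#j#} v = v j"
  by (simp add: mono_eval_def)

lemma tensor_power_padded:
  "tensor_power v (replicate d 0 @ sorted_list_of_multiset f) = v 0 ^ d * mono_eval f v"
proof -
  have "prod_list (map v (sorted_list_of_multiset f)) = prod_mset (image_mset v f)"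
    by (metis mset_map mset_sorted_list_of_multiset prod_mset_prod_list)
  then show ?thesis by (simp add: tensor_power_def mono_eval_def)
qed

lemma padded_in_Omega_set:
  assumes "set_mset f \<subseteq> {1..n}" "size f \<le> m" "m \<le> Suc (size f)" "\<And>j. count f j \<le> 1"
  shows "replicate (m - size f) 0 @ sorted_list_of_multiset f \<in> Omega_set m n"
proof -
  have len: "length (sorted_list_of_multiset f) = size f"
    by (metis mset_sorted_list_of_multiset size_mset)
  have "distinct (sorted_list_of_multiset f)"
    unfolding distinct_count_atmost_1
  proof
    fix a
    have "count (mset (sorted_list_of_multiset f)) a = count f a" by simp
    moreover have "count f a \<le> 1" by (rule assms)
    moreover have "count f a = 0 \<longleftrightarrow> a \<notin># f" by (simp add: count_eq_zero_iff)
    ultimately show "count (mset (sorted_list_of_multiset f)) a = (if a \<in> set (sorted_list_of_multiset f) then 1 else 0)"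
      by auto
  qed
  moreover have "distinct (replicate (m - size f) (0::nat))" "0 \<notin># f"
    using assms by (auto simp: distinct_conv_nth)
  ultimately show ?thesis using assms(1,2) len
    by (auto simp: Omega_set_def index_tuples_def subset_iff split: if_splits)
qed

section \<open>The monomials \<open>B0\<close>\<close>

lemma grlex_precedes_irrefl: "\<not> grlex_precedes f f"
  by (simp add: grlex_precedes_def)

lemma grlex_precedes_trans:
  assumes "grlex_precedes f g" "grlex_precedes g h" shows "grlex_precedes f h"
proof (cases "size f = size g \<and> size g = size h")
  case True
  obtain i where i: "count f i > count g i" "\<And>j. j < i \<Longrightarrow> count f j = count g j"
    using assms(1) True by (auto simp: grlex_precedes_def)
  obtain i' where i': "count g i' > count h i'" "\<And>j. j < i' \<Longrightarrow> count g j = count h j"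
    using assms(2) True by (auto simp: grlex_precedes_def)
  have "count f (min i i') > count h (min i i')"
    using i i' by (cases i i' rule: linorder_cases) (auto simp: min_def)
  moreover have "\<forall>j<min i i'. count f j = count h j" using i i' by auto
  ultimately show ?thesis using True unfolding grlex_precedes_def by metis
next
  case False
  then show ?thesis using assms unfolding grlex_precedes_def by auto
qed

lemma grlex_precedes_total:
  assumes "f \<noteq> g" shows "grlex_precedes f g \<or> grlex_precedes g f"
proof -
  have "\<exists>i. count f i \<noteq> count g i" using assms by (meson multiset_eqI)
  define i where "i = (LEAST i. count f i \<noteq> count g i)"
  have i: "count f i \<noteq> count g i" unfolding i_def using \<open>\<exists>i. _\<close> by (rule LeastI_ex)
  have less: "\<forall>j<i. count f j = count g j" unfolding i_def using not_less_Least by blast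
  consider "size f < size g" | "size g < size f"
    | "size f = size g" "count f i > count g i" | "size g = size f" "count g i > count f i"
    using i by linarith
  then show ?thesis
  proof cases
    case 3
    then show ?thesis using less unfolding grlex_precedes_def by blast
  next
    case 4
    moreover have "\<forall>j<i. count g j = count f j" using less by simp
    ultimately show ?thesis unfolding grlex_precedes_def by blast
  qed (simp_all add: grlex_precedes_def)
qed

lemma finite_J1: "finite (J1 p k)" and finite_J2: "finite (J2 m n p k)"
  and finite_O_set: "finite (O_set m n p k \<alpha>)"
  unfolding J1_def J2_def O_set_def by (auto intro!: finite_sqfree_monomials)

lemma B0_subset_J1: "B0 r p k \<subseteq> J1 p k"
  by (auto simp: B0_def)

lemma finite_B0: "finite (B0 r p k)"
  by (rule finite_subset[OF B0_subset_J1 finite_J1])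

text \<open>The number of predecessors is injective on \<open>J1\<close>, because the order is strict and total.\<close>

lemma card_B0_le: "card (B0 r p k) \<le> r"
proof -
  define rank where "rank f = card {g \<in> J1 p k. grlex_precedes g f}" for f
  have "rank f < rank g" if "f \<in> J1 p k" "grlex_precedes f g" for f g
    unfolding rank_def
  proof (rule psubset_card_mono)
    show "finite {h \<in> J1 p k. grlex_precedes h g}" using finite_J1 by simp
    have "{h \<in> J1 p k. grlex_precedes h f} \<subseteq> {h \<in> J1 p k. grlex_precedes h g}"
      using grlex_precedes_trans[OF _ that(2)] by auto
    moreover have "f \<in> {h \<in> J1 p k. grlex_precedes h g}" "f \<notin> {h \<in> J1 p k. grlex_precedes h f}"
      using that grlex_precedes_irrefl by auto
    ultimately show "{h \<in> J1 p k. grlex_precedes h f} \<subset> {h \<in> J1 p k. grlex_precedes h g}" by blast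
  qed
  note less = this
  have "inj_on rank (B0 r p k)"
  proof (intro inj_onI)
    fix f g assume fg: "f \<in> B0 r p k" "g \<in> B0 r p k" "rank f = rank g"
    then have "f \<in> J1 p k" "g \<in> J1 p k" using B0_subset_J1 by auto
    then have "\<not> grlex_precedes f g" "\<not> grlex_precedes g f" using less fg(3) by force+
    then show "f = g" using grlex_precedes_total by blast
  qed
  moreover have "rank ` B0 r p k \<subseteq> {..<r}" by (auto simp: rank_def B0_def)
  ultimately show ?thesis using card_inj_on_le[of rank "B0 r p k" "{..<r}"] by simp
qed

section \<open>Monomials labelling entries on the index set Omega\<close>

text \<open>The size is \<open>m\<close> or \<open>m - 1\<close>: the index 0 may fill at most one position of a tuple with distinct
  entries.\<close>

definition Omega_monomial :: "nat \<Rightarrow> nat \<Rightarrow> monomial \<Rightarrow> bool" where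
  "Omega_monomial m n f \<longleftrightarrow>
     set_mset f \<subseteq> {1..n} \<and> size f \<le> m \<and> m \<le> Suc (size f) \<and> (\<forall>j. count f j \<le> 1)"

lemma J1_iff: "f \<in> J1 p k \<longleftrightarrow> set_mset f \<subseteq> {1..k} \<and> size f = p \<and> (\<forall>j. count f j \<le> 1)"
  unfolding J1_def by (rule sqfree_monomials_iff) simp

lemma J2_iff: "g \<in> J2 m n p k \<longleftrightarrow>
    set_mset g \<subseteq> {k+1..n} \<and> size g = m - p - 1 \<and> (\<forall>j. count g j \<le> 1)"
  unfolding J2_def by (rule sqfree_monomials_iff) simp

lemma O_set_iff:
  assumes "f \<in> J1 p k"
  shows "g \<in> O_set m n p k (f + {#l#}) \<longleftrightarrow> g \<in> J2 m n p k \<and> l \<notin># g"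
proof -
  have "g \<in> O_set m n p k (f + {#l#}) \<longleftrightarrow> set_mset g \<subseteq> {k+1..n} - set_mset (f + {#l#}) \<and>
      size g = m - p - 1 \<and> (\<forall>j. count g j \<le> 1)"
    unfolding O_set_def by (rule sqfree_monomials_iff) simp
  moreover have "set_mset f \<subseteq> {1..k}" using assms by (simp add: J1_iff)
  ultimately show ?thesis by (fastforce simp: J2_iff)
qed

lemma B1_iff: "\<alpha> \<in> B1 n p k \<longleftrightarrow> (\<exists>f\<in>J1 p k. \<exists>l\<in>{k+1..n}. \<alpha> = f + {#l#})"
  unfolding B1_def by blast

lemma count_add_le_1:
  assumes "\<And>j. count f j \<le> 1" "\<And>j. count g j \<le> 1" "set_mset f \<inter> set_mset g = {}"
  shows "count (f + g) j \<le> 1"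
proof -
  have "count f j = 0 \<or> count g j = 0" using assms(3) by (auto simp: count_eq_zero_iff)
  then show ?thesis using assms(1,2)[of j] by auto
qed

lemma Omega_monomial_add:
  assumes "\<And>j. count f j \<le> 1" "\<And>j. count g j \<le> 1" "set_mset f \<inter> set_mset g = {}"
    "set_mset f \<subseteq> {1..n}" "set_mset g \<subseteq> {1..n}" "size f + size g \<le> m" "m \<le> Suc (size f + size g)"
  shows "Omega_monomial m n (f + g)"
  unfolding Omega_monomial_def using assms count_add_le_1[OF assms(1-3)] by simp

lemma A_mat_action:
  assumes "\<And>\<beta>. \<beta> \<in> B \<Longrightarrow>
    A_mat m F \<gamma> \<beta> = (\<Sum>i=1..r. a i * mono_eval \<beta> (v i) * mono_eval \<gamma> (v i))"
  shows "(\<Sum>\<beta>\<in>B. A_mat m F \<gamma> \<beta> * h \<beta>)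
       = (\<Sum>i=1..r. a i * (\<Sum>\<beta>\<in>B. mono_eval \<beta> (v i) * h \<beta>) * mono_eval \<gamma> (v i))"
proof -
  have "(\<Sum>\<beta>\<in>B. A_mat m F \<gamma> \<beta> * h \<beta>)
    = (\<Sum>\<beta>\<in>B. \<Sum>i=1..r. a i * (mono_eval \<beta> (v i) * h \<beta>) * mono_eval \<gamma> (v i))"
    using assms by (intro sum.cong refl) (simp add: sum_distrib_right, simp add: ac_simps)
  also have "\<dots> = (\<Sum>i=1..r. a i * (\<Sum>\<beta>\<in>B. mono_eval \<beta> (v i) * h \<beta>) * mono_eval \<gamma> (v i))"
    by (subst sum.swap) (simp add: sum_distrib_left sum_distrib_right)
  finally show ?thesis .
qed

section \<open>The exact decomposition\<close>

text \<open>The normalization \<open>u i 0 = 1\<close> makes the entry labelled by a monomial \<open>f\<close> equal to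
  \<open>\<Sum>i. c i * mono_eval f (u i)\<close>, whether or not its index tuple contains 0.\<close>

locale exact_decomposition =
  fixes m n r p k :: nat and F :: tensor and c :: "nat \<Rightarrow> complex" and u :: "nat \<Rightarrow> nat \<Rightarrow> complex"
  assumes p_pos: "1 \<le> p" and p_m: "p + 2 \<le> m" and p_k: "p \<le> k" and k_n: "k + m \<le> n + p" and r_pos: "1 \<le> r"
    and F_eq: "\<And>I. I \<in> Omega_set m n \<Longrightarrow> F I = (\<Sum>i=1..r. c i * tensor_power (u i) I)"
    and c_nz: "\<And>i. i \<in> {1..r} \<Longrightarrow> c i \<noteq> 0"
    and u0: "\<And>i. i \<in> {1..r} \<Longrightarrow> u i 0 = 1"
    and indep_B0: "lin_indep r (B0 r p k) (\<lambda>i f. mono_eval f (u i))"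
    and indep_O: "\<And>\<alpha>. \<alpha> \<in> B1 n p k \<Longrightarrow> lin_indep r (O_set m n p k \<alpha>) (\<lambda>i f. mono_eval f (u i))"
begin

lemma k_less_n: "k < n"
  using p_m k_n by linarith

lemma Omega_J1_J2: "f \<in> J1 p k \<Longrightarrow> g \<in> J2 m n p k \<Longrightarrow> Omega_monomial m n (f + g)"
  using p_m k_less_n by (intro Omega_monomial_add) (fastforce simp: J1_iff J2_iff)+

lemma Omega_B1_O_set:
  assumes "f \<in> J1 p k" "l \<in> {k+1..n}" "g \<in> O_set m n p k (f + {#l#})"
  shows "Omega_monomial m n (f + {#l#} + g)"
proof -
  have g: "g \<in> J2 m n p k" "l \<notin># g" using assms O_set_iff by blast+
  have "Omega_monomial m n (f + (g + {#l#}))"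
  proof (rule Omega_monomial_add)
    show "count (g + {#l#}) j \<le> 1" for j
      using g by (intro count_add_le_1) (auto simp: J2_iff)
  qed (use assms g p_m k_less_n in \<open>(fastforce simp: J1_iff J2_iff)+\<close>)
  then show ?thesis by (simp add: ac_simps)
qed

lemma J1_nonempty: "\<exists>f. f \<in> J1 p k"
proof -
  obtain S where "S \<subseteq> {1..k}" "card S = p" using p_k obtain_subset_with_card_n[of p "{1..k}"] by auto
  then show ?thesis by (auto simp: J1_def sqfree_monomials_def)
qed

lemma indep_O_set:
  assumes "f \<in> J1 p k" "l \<in> {k+1..n}"
    and "\<And>g. g \<in> O_set m n p k (f + {#l#}) \<Longrightarrow> (\<Sum>i=1..r. d i * mono_eval g (u i)) = 0"
    and "i \<in> {1..r}"
  shows "d i = 0"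
proof -
  have "f + {#l#} \<in> B1 n p k" unfolding B1_iff using assms(1,2) by blast
  then show ?thesis using indep_O assms(3,4) unfolding lin_indep_def by blast
qed

lemma indep_J2:
  assumes "\<And>g. g \<in> J2 m n p k \<Longrightarrow> (\<Sum>i=1..r. d i * mono_eval g (u i)) = 0" and "i \<in> {1..r}"
  shows "d i = 0"
proof -
  obtain f where "f \<in> J1 p k" using J1_nonempty by blast
  moreover have "k + 1 \<in> {k+1..n}" using k_less_n by simp
  ultimately show ?thesis using indep_O_set[of f "k+1" d i] assms O_set_iff by blast
qed

lemma indep_B0D: "(\<And>f. f \<in> B0 r p k \<Longrightarrow> (\<Sum>i=1..r. d i * mono_eval f (u i)) = 0) \<Longrightarrow> i \<in> {1..r} \<Longrightarrow> d i = 0"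
  using indep_B0 unfolding lin_indep_def by blast

lemma exists_nonzero_B0: "i \<in> {1..r} \<Longrightarrow> \<exists>f\<in>B0 r p k. mono_eval f (u i) \<noteq> 0"
  by (rule lin_indep_imp_nonzero[OF indep_B0])

lemma card_B0: "card (B0 r p k) = r"
proof (rule antisym[OF card_B0_le], rule ccontr)
  assume "\<not> r \<le> card (B0 r p k)"
  then have "card (B0 r p k) < card {1..r}" by simp
  then obtain h where h: "\<exists>i\<in>{1..r}. h i \<noteq> 0"
    "\<forall>f\<in>B0 r p k. (\<Sum>i=1..r. mono_eval f (u i) * h i) = 0"
    using underdetermined_system[of "B0 r p k" "{1..r}" "\<lambda>f i. mono_eval f (u i)"] finite_B0 by auto
  then have "(\<Sum>i=1..r. h i * mono_eval f (u i)) = 0" if "f \<in> B0 r p k" for f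
    using that by (simp add: mult.commute)
  then show False using indep_B0D[of h] h(1) by blast
qed

definition B0_inverse :: "(nat \<Rightarrow> monomial \<Rightarrow> complex) \<Rightarrow> bool" where
  "B0_inverse L \<longleftrightarrow>
     (\<forall>i\<in>{1..r}. \<forall>j\<in>{1..r}. (\<Sum>\<nu>\<in>B0 r p k. L i \<nu> * mono_eval \<nu> (u j)) = (if i = j then 1 else 0)) \<and>
     (\<forall>\<nu>\<in>B0 r p k. \<forall>\<nu>'\<in>B0 r p k. (\<Sum>i=1..r. mono_eval \<nu> (u i) * L i \<nu>') = (if \<nu> = \<nu>' then 1 else 0))"

lemma B0_inverse_exists: "\<exists>L. B0_inverse L"
proof -
  have "\<exists>L. \<forall>i\<in>{1..r}. \<forall>j\<in>{1..r}. (\<Sum>\<nu>\<in>B0 r p k. L i \<nu> * mono_eval \<nu> (u j)) = (if i = j then 1 else 0)"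
  proof (rule left_inverse_of_injective)
    fix h assume "\<forall>f\<in>B0 r p k. (\<Sum>i=1..r. mono_eval f (u i) * h i) = 0"
    then have "(\<Sum>i=1..r. h i * mono_eval f (u i)) = 0" if "f \<in> B0 r p k" for f
      using that by (simp add: mult.commute)
    then show "\<forall>i\<in>{1..r}. h i = 0" using indep_B0D by blast
  qed (auto simp: finite_B0)
  then obtain L where L: "\<And>i j. i \<in> {1..r} \<Longrightarrow> j \<in> {1..r} \<Longrightarrow>
       (\<Sum>\<nu>\<in>B0 r p k. L i \<nu> * mono_eval \<nu> (u j)) = (if i = j then 1 else 0)" by blast
  have "(\<Sum>i=1..r. mono_eval \<nu> (u i) * L i \<nu>') = (if \<nu> = \<nu>' then 1 else 0)"
    if "\<nu> \<in> B0 r p k" "\<nu>' \<in> B0 r p k" for \<nu> \<nu>'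
    by (rule right_inverse_of_square[OF finite_B0 finite_atLeastAtMost _ L that]) (simp_all add: card_B0)
  with L show ?thesis unfolding B0_inverse_def by blast
qed

lemma entry_eq:
  assumes "Omega_monomial m n f" shows "entry m F f = (\<Sum>i=1..r. c i * mono_eval f (u i))"
proof -
  have "replicate (m - size f) 0 @ sorted_list_of_multiset f \<in> Omega_set m n"
    using assms unfolding Omega_monomial_def by (intro padded_in_Omega_set) auto
  then show ?thesis unfolding entry_def
    by (subst F_eq) (auto simp: tensor_power_padded u0 intro!: sum.cong)
qed

lemma A_mat_exact_action:
  assumes "\<gamma> \<in> J2 m n p k"
  shows "(\<Sum>\<beta>\<in>B0 r p k. A_mat m F \<gamma> \<beta> * h \<beta>)
       = (\<Sum>i=1..r. c i * (\<Sum>\<beta>\<in>B0 r p k. mono_eval \<beta> (u i) * h \<beta>) * mono_eval \<gamma> (u i))"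
proof (rule A_mat_action)
  fix \<beta> assume "\<beta> \<in> B0 r p k"
  then have "Omega_monomial m n (\<beta> + \<gamma>)" using B0_subset_J1 Omega_J1_J2 assms by blast
  then show "A_mat m F \<gamma> \<beta> = (\<Sum>i=1..r. c i * mono_eval \<beta> (u i) * mono_eval \<gamma> (u i))"
    unfolding A_mat_def by (simp only: entry_eq mono_eval_add mult.assoc)
qed

text \<open>The coefficient matrix is the product of the matrix of the values on \<open>O_set\<close>, a nonsingular
  diagonal matrix and the transpose of the square matrix of the values on \<open>B0\<close>.\<close>

lemma A_mat_injective:
  assumes "f \<in> J1 p k" "l \<in> {k+1..n}"
    and 0: "\<forall>\<gamma>\<in>O_set m n p k (f + {#l#}). (\<Sum>\<beta>\<in>B0 r p k. A_mat m F \<gamma> \<beta> * h \<beta>) = 0"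
  shows "\<forall>\<beta>\<in>B0 r p k. h \<beta> = 0"
proof
  define s where "s i = (\<Sum>\<beta>\<in>B0 r p k. mono_eval \<beta> (u i) * h \<beta>)" for i
  have "(\<Sum>i=1..r. (c i * s i) * mono_eval g (u i)) = 0" if "g \<in> O_set m n p k (f + {#l#})" for g
  proof -
    have g: "g \<in> J2 m n p k" using O_set_iff assms(1) that by blast
    have "(\<Sum>i=1..r. (c i * s i) * mono_eval g (u i)) = (\<Sum>\<beta>\<in>B0 r p k. A_mat m F g \<beta> * h \<beta>)"
      unfolding s_def by (rule A_mat_exact_action[OF g, symmetric])
    then show ?thesis using 0 that by simp
  qed
  then have cs: "c i * s i = 0" if "i \<in> {1..r}" for i
    using indep_O_set[OF assms(1,2), of "\<lambda>i. c i * s i"] that by blast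
  have s0: "s i = 0" if "i \<in> {1..r}" for i
    using cs[OF that] c_nz[OF that] by simp
  obtain L where L: "B0_inverse L" using B0_inverse_exists by blast
  fix \<beta> assume \<beta>: "\<beta> \<in> B0 r p k"
  have "(\<Sum>i=1..r. s i * L i \<beta>) = (\<Sum>\<nu>\<in>B0 r p k. h \<nu> * (\<Sum>i=1..r. mono_eval \<nu> (u i) * L i \<beta>))"
    unfolding s_def sum_distrib_right sum_distrib_left by (subst sum.swap) (simp add: ac_simps)
  also have "\<dots> = (\<Sum>\<nu>\<in>B0 r p k. if \<nu> = \<beta> then h \<nu> else 0)"
    using L \<beta> unfolding B0_inverse_def by (intro sum.cong) auto
  also have "\<dots> = h \<beta>" using \<beta> finite_B0 by simp
  finally show "h \<beta> = 0" using s0 by simp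
qed

text \<open>The residual is the combination of the independent vectors of values on \<open>O_set\<close> whose coefficients
  are \<open>c i\<close> times the interpolation defects.\<close>

lemma solution_interpolates:
  assumes G: "solves_linear_systems m n r p k F G" and \<alpha>: "\<alpha> \<in> B1 n p k" and i: "i \<in> {1..r}"
  shows "(\<Sum>\<beta>\<in>B0 r p k. mono_eval \<beta> (u i) * G \<beta> \<alpha>) = mono_eval \<alpha> (u i)"
proof -
  obtain f l where fl: "f \<in> J1 p k" "l \<in> {k+1..n}" "\<alpha> = f + {#l#}" using \<alpha> B1_iff by blast
  define d where "d i = c i * ((\<Sum>\<beta>\<in>B0 r p k. mono_eval \<beta> (u i) * G \<beta> \<alpha>) - mono_eval \<alpha> (u i))" for i
  have "(\<Sum>i=1..r. d i * mono_eval g (u i)) = 0" if g: "g \<in> O_set m n p k (f + {#l#})" for g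
  proof -
    have gJ: "g \<in> J2 m n p k" using O_set_iff fl(1) g by blast
    have "0 = residual m r p k F \<alpha> (\<lambda>\<beta>. G \<beta> \<alpha>) g"
      using G \<alpha> g fl by (simp add: solves_linear_systems_def)
    also have "\<dots> = (\<Sum>i=1..r. c i * (\<Sum>\<beta>\<in>B0 r p k. mono_eval \<beta> (u i) * G \<beta> \<alpha>) * mono_eval g (u i))
        - (\<Sum>i=1..r. c i * mono_eval \<alpha> (u i) * mono_eval g (u i))"
    proof -
      have "Omega_monomial m n (\<alpha> + g)" using Omega_B1_O_set fl g by blast
      then have "b_vec m F \<alpha> g = (\<Sum>i=1..r. c i * mono_eval \<alpha> (u i) * mono_eval g (u i))"
        unfolding b_vec_def by (simp only: entry_eq mono_eval_add mult.assoc)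
      then show ?thesis unfolding residual_def by (simp only: A_mat_exact_action[OF gJ])
    qed
    also have "\<dots> = (\<Sum>i=1..r. d i * mono_eval g (u i))"
      by (simp only: d_def right_diff_distrib left_diff_distrib sum_subtractf)
    finally show ?thesis by simp
  qed
  then have "d i = 0" using indep_O_set[OF fl(1,2), of d i] i by blast
  then show ?thesis using c_nz[OF i] by (simp add: d_def)
qed

lemma N_l_action:
  assumes G: "solves_linear_systems m n r p k F G" and "l \<in> {k+1..n}" "i \<in> {1..r}" "\<nu> \<in> B0 r p k"
  shows "(\<Sum>\<beta>\<in>B0 r p k. N_l G l \<nu> \<beta> * mono_eval \<beta> (u i)) = u i l * mono_eval \<nu> (u i)"
proof -
  have "\<nu> + {#l#} \<in> B1 n p k" unfolding B1_iff using assms B0_subset_J1 by blast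
  from solution_interpolates[OF G this assms(3)]
  show ?thesis by (simp add: N_l_def mono_eval_def mult.commute)
qed

lemma N_xi_action:
  assumes G: "solves_linear_systems m n r p k F G" and i: "i \<in> {1..r}" "\<nu> \<in> B0 r p k"
  shows "(\<Sum>\<beta>\<in>B0 r p k. N_xi n k \<xi> G \<nu> \<beta> * mono_eval \<beta> (u i)) = (\<Sum>l=k+1..n. \<xi> l * u i l) * mono_eval \<nu> (u i)"
proof -
  have "(\<Sum>\<beta>\<in>B0 r p k. N_xi n k \<xi> G \<nu> \<beta> * mono_eval \<beta> (u i))
      = (\<Sum>l=k+1..n. \<xi> l * (\<Sum>\<beta>\<in>B0 r p k. N_l G l \<nu> \<beta> * mono_eval \<beta> (u i)))"
    unfolding N_xi_def sum_distrib_right sum_distrib_left by (subst sum.swap) (simp add: ac_simps)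
  also have "\<dots> = (\<Sum>l=k+1..n. \<xi> l * (u i l * mono_eval \<nu> (u i)))"
    using N_l_action[OF G _ i] by (intro sum.cong) auto
  finally show ?thesis by (simp add: sum_distrib_right mult.assoc)
qed

lemma expand_in_B0:
  assumes L: "B0_inverse L"
    and \<nu>: "\<nu> \<in> B0 r p k"
  shows "(\<Sum>i=1..r. mono_eval \<nu> (u i) * (\<Sum>\<nu>'\<in>B0 r p k. L i \<nu>' * z \<nu>')) = z \<nu>"
proof -
  have "(\<Sum>i=1..r. mono_eval \<nu> (u i) * (\<Sum>\<nu>'\<in>B0 r p k. L i \<nu>' * z \<nu>'))
     = (\<Sum>\<nu>'\<in>B0 r p k. (\<Sum>i=1..r. mono_eval \<nu> (u i) * L i \<nu>') * z \<nu>')"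
    unfolding sum_distrib_left sum_distrib_right by (subst sum.swap) (simp add: ac_simps)
  also have "\<dots> = (\<Sum>\<nu>'\<in>B0 r p k. if \<nu> = \<nu>' then z \<nu>' else 0)"
    using L \<nu> unfolding B0_inverse_def by (intro sum.cong) auto
  finally show ?thesis using \<nu> finite_B0 by simp
qed

text \<open>In the basis of the vectors \<open>mono_eval \<nu> (u i)\<close> of the space of functions on \<open>B0\<close>, a matrix near \<open>N_xi\<close>
  is a perturbation of a diagonal matrix.\<close>

lemma eigenvector_coordinates:
  fixes \<xi> :: "nat \<Rightarrow> complex"
  assumes G: "solves_linear_systems m n r p k F G"
    and L: "B0_inverse L"
    and z: "\<And>\<nu>. \<nu> \<in> B0 r p k \<Longrightarrow> (\<Sum>\<beta>\<in>B0 r p k. M \<nu> \<beta> * z \<beta>) = t * z \<nu>"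
    and i: "i \<in> {1..r}"
  defines "X \<equiv> \<lambda>i. \<Sum>\<nu>\<in>B0 r p k. L i \<nu> * z \<nu>"
    and "E \<equiv> \<lambda>i j. \<Sum>\<nu>\<in>B0 r p k. \<Sum>\<beta>\<in>B0 r p k. (M \<nu> \<beta> - N_xi n k \<xi> G \<nu> \<beta>) * (L i \<nu> * mono_eval \<beta> (u j))"
  shows "(\<Sum>l=k+1..n. \<xi> l * u i l) * X i + (\<Sum>j=1..r. E i j * X j) = t * X i"
proof -
  define \<theta> where "\<theta> i = (\<Sum>l=k+1..n. \<xi> l * u i l)" for i
  have zX: "z \<beta> = (\<Sum>j=1..r. mono_eval \<beta> (u j) * X j)" if "\<beta> \<in> B0 r p k" for \<beta>
    using expand_in_B0[OF L that, where z = z] by (simp add: X_def)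
  have N: "(\<Sum>\<beta>\<in>B0 r p k. N_xi n k \<xi> G \<nu> \<beta> * z \<beta>) = (\<Sum>j=1..r. \<theta> j * mono_eval \<nu> (u j) * X j)"
    if "\<nu> \<in> B0 r p k" for \<nu>
  proof -
    have "(\<Sum>\<beta>\<in>B0 r p k. N_xi n k \<xi> G \<nu> \<beta> * z \<beta>)
      = (\<Sum>\<beta>\<in>B0 r p k. \<Sum>j=1..r. N_xi n k \<xi> G \<nu> \<beta> * mono_eval \<beta> (u j) * X j)"
      using zX by (intro sum.cong) (simp_all add: sum_distrib_left ac_simps)
    also have "\<dots> = (\<Sum>j=1..r. (\<Sum>\<beta>\<in>B0 r p k. N_xi n k \<xi> G \<nu> \<beta> * mono_eval \<beta> (u j)) * X j)"
      by (subst sum.swap) (simp add: sum_distrib_right)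
    also have "\<dots> = (\<Sum>j=1..r. \<theta> j * mono_eval \<nu> (u j) * X j)"
      using N_xi_action[OF G _ that] by (intro sum.cong) (auto simp: \<theta>_def)
    finally show ?thesis .
  qed
  have diag: "(\<Sum>\<nu>\<in>B0 r p k. L i \<nu> * (\<Sum>\<beta>\<in>B0 r p k. N_xi n k \<xi> G \<nu> \<beta> * z \<beta>)) = \<theta> i * X i"
  proof -
    have "(\<Sum>\<nu>\<in>B0 r p k. L i \<nu> * (\<Sum>\<beta>\<in>B0 r p k. N_xi n k \<xi> G \<nu> \<beta> * z \<beta>))
      = (\<Sum>\<nu>\<in>B0 r p k. \<Sum>j=1..r. L i \<nu> * mono_eval \<nu> (u j) * (\<theta> j * X j))"
      using N by (intro sum.cong) (simp_all add: sum_distrib_left ac_simps)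
    also have "\<dots> = (\<Sum>j=1..r. (\<Sum>\<nu>\<in>B0 r p k. L i \<nu> * mono_eval \<nu> (u j)) * (\<theta> j * X j))"
      by (subst sum.swap) (simp add: sum_distrib_right)
    also have "\<dots> = (\<Sum>j=1..r. if i = j then \<theta> j * X j else 0)"
      using L i unfolding B0_inverse_def by (intro sum.cong) auto
    finally show ?thesis using i by simp
  qed
  have pert: "(\<Sum>\<nu>\<in>B0 r p k. L i \<nu> * (\<Sum>\<beta>\<in>B0 r p k. (M \<nu> \<beta> - N_xi n k \<xi> G \<nu> \<beta>) * z \<beta>)) = (\<Sum>j=1..r. E i j * X j)"
  proof -
    have "(\<Sum>\<nu>\<in>B0 r p k. L i \<nu> * (\<Sum>\<beta>\<in>B0 r p k. (M \<nu> \<beta> - N_xi n k \<xi> G \<nu> \<beta>) * z \<beta>))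
      = (\<Sum>\<nu>\<in>B0 r p k. \<Sum>\<beta>\<in>B0 r p k. \<Sum>j=1..r. (M \<nu> \<beta> - N_xi n k \<xi> G \<nu> \<beta>) * (L i \<nu> * mono_eval \<beta> (u j)) * X j)"
      using zX by (intro sum.cong refl) (simp add: sum_distrib_left ac_simps)
    also have "\<dots> = (\<Sum>\<nu>\<in>B0 r p k. \<Sum>j=1..r. \<Sum>\<beta>\<in>B0 r p k. (M \<nu> \<beta> - N_xi n k \<xi> G \<nu> \<beta>) * (L i \<nu> * mono_eval \<beta> (u j)) * X j)"
      by (intro sum.cong refl sum.swap)
    also have "\<dots> = (\<Sum>j=1..r. E i j * X j)"
      unfolding E_def sum_distrib_right by (rule sum.swap)
    finally show ?thesis .
  qed
  have "t * X i = (\<Sum>\<nu>\<in>B0 r p k. L i \<nu> * (t * z \<nu>))"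
    by (simp add: X_def sum_distrib_left ac_simps)
  also have "\<dots> = (\<Sum>\<nu>\<in>B0 r p k. L i \<nu> * (\<Sum>\<beta>\<in>B0 r p k. M \<nu> \<beta> * z \<beta>))"
    using z by (intro sum.cong) auto
  also have "\<dots> = (\<Sum>\<nu>\<in>B0 r p k. L i \<nu> * (\<Sum>\<beta>\<in>B0 r p k. (M \<nu> \<beta> - N_xi n k \<xi> G \<nu> \<beta>) * z \<beta>))
     + (\<Sum>\<nu>\<in>B0 r p k. L i \<nu> * (\<Sum>\<beta>\<in>B0 r p k. N_xi n k \<xi> G \<nu> \<beta> * z \<beta>))"
    by (simp add: left_diff_distrib sum_subtractf right_diff_distrib)
  finally show ?thesis using diag pert by (simp add: \<theta>_def)
qed

text \<open>The space has dimension \<open>r\<close> and every eigenvalue is one of the \<open>r\<close> numbers attached to the \<open>u i\<close>, so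
  \<open>r\<close> distinct eigenvalues leave no room for a coincidence.\<close>

lemma distinct_eigenvalues_imp_inj:
  assumes G: "solves_linear_systems m n r p k F G"
    and dist: "distinct_eigenvalues (B0 r p k) (N_xi n k \<xi> G)"
  shows "inj_on (\<lambda>i. \<Sum>l=k+1..n. \<xi> l * u i l) {1..r}"
proof -
  define \<theta> where "\<theta> i = (\<Sum>l=k+1..n. \<xi> l * u i l)" for i
  obtain L where L: "B0_inverse L" using B0_inverse_exists by blast
  have "{t. \<exists>z. eigenpair (B0 r p k) (N_xi n k \<xi> G) t z} \<subseteq> \<theta> ` {1..r}"
  proof (intro subsetI, elim CollectE exE)
    fix t z assume ep: "eigenpair (B0 r p k) (N_xi n k \<xi> G) t z"
    then obtain \<nu> where \<nu>: "\<nu> \<in> B0 r p k" "z \<nu> \<noteq> 0" unfolding eigenpair_def by blast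
    define X where "X i = (\<Sum>\<nu>\<in>B0 r p k. L i \<nu> * z \<nu>)" for i
    have "\<theta> i * X i = t * X i" if "i \<in> {1..r}" for i
      using eigenvector_coordinates[OF G L, of "N_xi n k \<xi> G" z t i \<xi>] ep that
      by (simp add: eigenpair_def \<theta>_def X_def)
    moreover have "\<exists>i\<in>{1..r}. X i \<noteq> 0"
    proof (rule ccontr)
      assume "\<not> ?thesis"
      then have "(\<Sum>i=1..r. mono_eval \<nu> (u i) * X i) = 0" by simp
      then show False using expand_in_B0[OF L \<nu>(1), where z = z] \<nu>(2) by (simp add: X_def)
    qed
    ultimately show "t \<in> \<theta> ` {1..r}" by (metis image_eqI mult_cancel_right)
  qed
  then have "card (B0 r p k) \<le> card (\<theta> ` {1..r})"
    using dist unfolding distinct_eigenvalues_def by (metis card_mono finite_atLeastAtMost finite_imageI)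
  then have "card (\<theta> ` {1..r}) = card {1..r}"
    using card_B0 card_image_le[of "{1..r}" \<theta>] by simp
  then show ?thesis unfolding \<theta>_def[symmetric] by (simp add: eq_card_imp_inj_on)
qed

lemma permuted:
  assumes \<sigma>: "\<sigma> permutes {1..r}"
  shows "exact_decomposition m n r p k F (c \<circ> \<sigma>) (u \<circ> \<sigma>)"
proof -
  have perm: "lin_indep r S (\<lambda>i f. mono_eval f ((u \<circ> \<sigma>) i))" if li: "lin_indep r S (\<lambda>i f. mono_eval f (u i))" for S
    unfolding lin_indep_def
  proof (intro allI impI ballI)
    fix d i assume d: "\<forall>s\<in>S. (\<Sum>i=1..r. d i * mono_eval s ((u \<circ> \<sigma>) i)) = 0" and i: "i \<in> {1..r}"
    have "(\<Sum>i=1..r. d (inv \<sigma> i) * mono_eval s (u i)) = 0" if "s \<in> S" for s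
    proof -
      have "(\<Sum>i=1..r. d (inv \<sigma> i) * mono_eval s (u i)) = (\<Sum>i=1..r. d (inv \<sigma> (\<sigma> i)) * mono_eval s (u (\<sigma> i)))"
        by (rule sum.permute[OF \<sigma>, unfolded o_def])
      then show ?thesis using d that \<sigma> by (simp add: permutes_inverses)
    qed
    moreover have "\<sigma> i \<in> {1..r}" using permutes_in_image[OF \<sigma>] i by blast
    ultimately have "d (inv \<sigma> (\<sigma> i)) = 0"
      using li[unfolded lin_indep_def, rule_format, of "\<lambda>i. d (inv \<sigma> i)" "\<sigma> i"] by blast
    then show "d i = 0" using \<sigma> by (simp add: permutes_inverses)
  qed
  have im: "\<sigma> i \<in> {1..r}" if "i \<in> {1..r}" for i using permutes_in_image[OF \<sigma>] that by blast
  show ?thesis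
  proof
    fix I assume "I \<in> Omega_set m n"
    then have "F I = (\<Sum>i=1..r. c i * tensor_power (u i) I)" by (rule F_eq)
    also have "\<dots> = (\<Sum>i=1..r. c (\<sigma> i) * tensor_power (u (\<sigma> i)) I)"
      by (rule sum.permute[OF \<sigma>, unfolded o_def])
    finally show "F I = (\<Sum>i=1..r. (c \<circ> \<sigma>) i * tensor_power ((u \<circ> \<sigma>) i) I)" by simp
  next
    show "(c \<circ> \<sigma>) i \<noteq> 0" "(u \<circ> \<sigma>) i 0 = 1" if "i \<in> {1..r}" for i
      using c_nz[OF im[OF that]] u0[OF im[OF that]] by simp_all
    show "lin_indep r (O_set m n p k \<alpha>) (\<lambda>i f. mono_eval f ((u \<circ> \<sigma>) i))" if "\<alpha> \<in> B1 n p k" for \<alpha>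
      by (rule perm[OF indep_O[OF that]])
  qed (fact p_pos p_m p_k k_n r_pos perm[OF indep_B0])+
qed

end

section \<open>The perturbed linear systems and eigenvectors\<close>

text \<open>Here \<open>x\<close> ranges over the possible inputs and results of the algorithm, and the entries of
  \<open>Fh x\<close> deviate from those of \<open>F\<close> by at most a constant multiple of \<open>e x\<close>.\<close>

locale perturbed_decomposition =
  exact_decomposition m n r p k F c u + vanishing \<Phi> e
  for m n r p k :: nat and F :: tensor and c :: "nat \<Rightarrow> complex" and u :: "nat \<Rightarrow> nat \<Rightarrow> complex"
    and \<Phi> :: "'x filter" and e :: "'x \<Rightarrow> real" +
  fixes Fh :: "'x \<Rightarrow> tensor"
  assumes Fh_near: "\<And>I. I \<in> Omega_set m n \<Longrightarrow> near \<Phi> e (\<lambda>x. Fh x I) (F I)"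
begin

lemma entry_near: assumes "Omega_monomial m n f" shows "near \<Phi> e (\<lambda>x. entry m (Fh x) f) (entry m F f)"
  unfolding entry_def
  by (rule Fh_near, rule padded_in_Omega_set) (use assms in \<open>auto simp: Omega_monomial_def\<close>)

lemma A_mat_near:
  assumes "f \<in> J1 p k" "\<gamma> \<in> O_set m n p k (f + {#l#})" "\<beta> \<in> B0 r p k"
  shows "near \<Phi> e (\<lambda>x. A_mat m (Fh x) \<gamma> \<beta>) (A_mat m F \<gamma> \<beta>)"
  unfolding A_mat_def
  by (intro entry_near Omega_J1_J2) (use assms B0_subset_J1 O_set_iff in blast)+

lemma residual_near:
  assumes "f \<in> J1 p k" "l \<in> {k+1..n}" "\<gamma> \<in> O_set m n p k (f + {#l#})"
  shows "near \<Phi> e (\<lambda>x. residual m r p k (Fh x) (f + {#l#}) g \<gamma>) (residual m r p k F (f + {#l#}) g \<gamma>)"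
proof -
  have "near \<Phi> e (\<lambda>x. (\<Sum>\<beta>\<in>B0 r p k. A_mat m (Fh x) \<gamma> \<beta> * g \<beta>) + (-1) * entry m (Fh x) (f + {#l#} + \<gamma>))
    ((\<Sum>\<beta>\<in>B0 r p k. A_mat m F \<gamma> \<beta> * g \<beta>) + (-1) * entry m F (f + {#l#} + \<gamma>))"
    by (intro near_add near_sum near_mult near_const entry_near A_mat_near[OF assms(1,3)]
        Omega_B1_O_set[OF assms])
  then show ?thesis by (simp add: residual_def b_vec_def)
qed

lemma step1_near:
  assumes step1: "\<forall>\<^sub>F x in \<Phi>. step1 m n r p k (Fh x) (G x)"
    and G0: "solves_linear_systems m n r p k F G0"
    and \<beta>: "\<beta> \<in> B0 r p k" and \<alpha>: "\<alpha> \<in> B1 n p k"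
  shows "near \<Phi> e (\<lambda>x. G x \<beta> \<alpha>) (G0 \<beta> \<alpha>)"
proof -
  obtain f l where fl: "f \<in> J1 p k" "l \<in> {k+1..n}" "\<alpha> = f + {#l#}" using \<alpha> B1_iff by blast
  have min: "\<forall>\<^sub>F x in \<Phi>. minimizer (\<lambda>g. (frob_norm (O_set m n p k \<alpha>) (residual m r p k (Fh x) \<alpha> g))\<^sup>2) (\<lambda>\<beta>. G x \<beta> \<alpha>)"
    using step1 by eventually_elim (use \<alpha> in \<open>simp add: step1_def\<close>)
  have res0: "residual m r p k F \<alpha> (\<lambda>\<beta>. G0 \<beta> \<alpha>) \<gamma> = 0" if "\<gamma> \<in> O_set m n p k \<alpha>" for \<gamma>
    using G0 \<alpha> that by (simp add: solves_linear_systems_def)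
  have sm: "small \<Phi> e (\<lambda>x. residual m r p k (Fh x) \<alpha> (\<lambda>\<beta>. G x \<beta> \<alpha>) \<gamma>)" if "\<gamma> \<in> O_set m n p k \<alpha>" for \<gamma>
  proof (rule small_minimizer_residual[OF finite_O_set min _ that, where ?g0.0 = "\<lambda>\<beta>. G0 \<beta> \<alpha>"])
    fix \<gamma> assume \<gamma>: "\<gamma> \<in> O_set m n p k \<alpha>"
    show "small \<Phi> e (\<lambda>x. residual m r p k (Fh x) \<alpha> (\<lambda>\<beta>. G0 \<beta> \<alpha>) \<gamma>)"
      using residual_near[OF fl(1,2), of \<gamma> "\<lambda>\<beta>. G0 \<beta> \<alpha>"] \<gamma> res0[OF \<gamma>] by (simp add: near_def fl(3))
  qed
  show ?thesis
  proof (rule near_solution[OF finite_O_set finite_B0, where h = "\<lambda>x \<beta>. G x \<beta> \<alpha>" and ?h0.0 = "\<lambda>\<beta>. G0 \<beta> \<alpha>"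
        and Ah = "\<lambda>x. A_mat m (Fh x)" and A = "A_mat m F"])
    fix \<gamma> \<beta> assume "\<gamma> \<in> O_set m n p k \<alpha>" "\<beta> \<in> B0 r p k"
    then show "near \<Phi> e (\<lambda>x. A_mat m (Fh x) \<gamma> \<beta>) (A_mat m F \<gamma> \<beta>)"
      using A_mat_near fl by blast
  next
    fix h assume "\<forall>\<gamma>\<in>O_set m n p k \<alpha>. (\<Sum>\<beta>\<in>B0 r p k. A_mat m F \<gamma> \<beta> * h \<beta>) = 0"
    then show "\<forall>\<beta>\<in>B0 r p k. h \<beta> = 0" using A_mat_injective[OF fl(1,2), of h] fl(3) by blast
  next
    fix \<gamma> assume \<gamma>: "\<gamma> \<in> O_set m n p k \<alpha>"
    have "near \<Phi> e (\<lambda>x. entry m (Fh x) (\<alpha> + \<gamma>) + residual m r p k (Fh x) \<alpha> (\<lambda>\<beta>. G x \<beta> \<alpha>) \<gamma>) (entry m F (\<alpha> + \<gamma>))"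
      using Omega_B1_O_set[OF fl(1,2)] \<gamma> fl(3) by (intro near_add_small entry_near sm) auto
    then show "near \<Phi> e (\<lambda>x. \<Sum>\<beta>\<in>B0 r p k. A_mat m (Fh x) \<gamma> \<beta> * G x \<beta> \<alpha>) (\<Sum>\<beta>\<in>B0 r p k. A_mat m F \<gamma> \<beta> * G0 \<beta> \<alpha>)"
      using res0[OF \<gamma>] by (simp add: residual_def b_vec_def)
  qed (rule \<beta>)
qed

text \<open>Assign to the \<open>i\<close>-th computed eigenvector its dominant coordinate \<open>\<sigma> x i\<close> in the basis of the exact
  eigenvectors. The assignment depends on \<open>x\<close>, so \<open>w x i\<close> is near a constant vector only on the parts of the
  filter where \<open>\<sigma> x\<close> is constant. There the computed eigenvector is a multiple of an exact one up to \<open>O(e)\<close>,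
  and the Hermitian form of a unit eigenvector is its eigenvalue.\<close>

lemma step2_near:
  assumes G: "\<And>\<beta> \<alpha>. \<beta> \<in> B0 r p k \<Longrightarrow> \<alpha> \<in> B1 n p k \<Longrightarrow> near \<Phi> e (\<lambda>x. G x \<beta> \<alpha>) (G0 \<beta> \<alpha>)"
    and G0: "solves_linear_systems m n r p k F G0"
    and dist: "distinct_eigenvalues (B0 r p k) (N_xi n k \<xi> G0)"
    and step2: "\<forall>\<^sub>F x in \<Phi>. step2 n r p k \<xi> (G x) (w x)"
  obtains \<sigma> :: "'x \<Rightarrow> nat \<Rightarrow> nat" where
    "\<forall>\<^sub>F x in \<Phi>. \<sigma> x permutes {1..r}"
    "\<And>s i t. i \<in> {1..r} \<Longrightarrow> t \<in> {1..n-k} \<Longrightarrow>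
       near (inf \<Phi> (principal {x. \<sigma> x = s})) e (\<lambda>x. w x i t) (u (s i) (k + t))"
proof -
  define B where "B = B0 r p k"
  define \<theta> where "\<theta> i = (\<Sum>l=k+1..n. \<xi> l * u i l)" for i
  have finB: "finite B" by (simp add: B_def finite_B0)
  obtain L where L: "B0_inverse L" using B0_inverse_exists by blast
  define eigdata where "eigdata x z T \<longleftrightarrow>
     (\<forall>i\<in>{1..r}. frob_norm B (z i) = 1 \<and> eigenpair B (N_xi n k \<xi> (G x)) (T i) (z i)) \<and>
     lin_indep r B z \<and>
     (\<forall>i\<in>{1..r}. \<forall>t\<in>{1..n-k}. w x i t = herm_form B (N_l (G x) (k + t)) (z i))" for x z T
  have "\<forall>x. \<exists>z T. step2 n r p k \<xi> (G x) (w x) \<longrightarrow> eigdata x z T"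
  proof (intro allI)
    fix x
    show "\<exists>z T. step2 n r p k \<xi> (G x) (w x) \<longrightarrow> eigdata x z T"
    proof (cases "step2 n r p k \<xi> (G x) (w x)")
      case True
      then obtain z where z: "\<forall>i\<in>{1..r}. frob_norm B (z i) = 1 \<and> (\<exists>\<theta>. eigenpair B (N_xi n k \<xi> (G x)) \<theta> (z i))"
        "lin_indep r B z" "\<forall>i\<in>{1..r}. \<forall>t\<in>{1..n-k}. w x i t = herm_form B (N_l (G x) (k + t)) (z i)"
        unfolding step2_def B_def by blast
      have "\<forall>i\<in>{1..r}. \<exists>t. eigenpair B (N_xi n k \<xi> (G x)) t (z i)" using z(1) by blast
      from bchoice[OF this] z show ?thesis unfolding eigdata_def by blast
    qed blast
  qed
  from choice[OF this] obtain z where "\<forall>x. \<exists>T. step2 n r p k \<xi> (G x) (w x) \<longrightarrow> eigdata x (z x) T" by blast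
  from choice[OF this] obtain T where "\<And>x. step2 n r p k \<xi> (G x) (w x) \<Longrightarrow> eigdata x (z x) (T x)" by blast
  note zT = this[unfolded eigdata_def]
  define X where "X x i j = (\<Sum>\<nu>\<in>B. L j \<nu> * z x i \<nu>)" for x i j
  \<comment> \<open>The deviation from the diagonal matrix in the basis of the exact eigenvectors.\<close>
  define E where "E x i j = (\<Sum>\<nu>\<in>B. \<Sum>\<beta>\<in>B. (N_xi n k \<xi> (G x) \<nu> \<beta> - N_xi n k \<xi> G0 \<nu> \<beta>) * (L i \<nu> * mono_eval \<beta> (u j)))"
    for x i j
  have N_near: "near \<Phi> e (\<lambda>x. N_l (G x) l \<nu> \<beta>) (N_l G0 l \<nu> \<beta>)"
    if "l \<in> {k+1..n}" "\<nu> \<in> B" "\<beta> \<in> B" for l \<nu> \<beta>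
  proof -
    have "\<nu> + {#l#} \<in> B1 n p k" unfolding B1_iff using that B0_subset_J1 B_def by blast
    then show ?thesis unfolding N_l_def using that(3) unfolding B_def by (intro G)
  qed
  have Nxi_near: "near \<Phi> e (\<lambda>x. N_xi n k \<xi> (G x) \<nu> \<beta>) (N_xi n k \<xi> G0 \<nu> \<beta>)"
    if "\<nu> \<in> B" "\<beta> \<in> B" for \<nu> \<beta>
    unfolding N_xi_def by (intro near_sum near_mult near_const N_near that)
  have E_small: "small \<Phi> e (\<lambda>x. E x i j)" for i j
    unfolding E_def
    by (intro small_sum small_mult_bdd bdd_const) (use Nxi_near in \<open>simp add: near_def\<close>)
  define Es where "Es ij x = E x (fst ij) (snd ij)" for ij x
  have "\<exists>C\<ge>0. \<forall>\<^sub>F x in \<Phi>. \<forall>ij\<in>{1..r}\<times>{1..r}. norm (Es ij x) \<le> C * e x"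
    by (rule small_uniform) (simp_all add: Es_def E_small)
  then obtain C where C: "C \<ge> 0" "\<forall>\<^sub>F x in \<Phi>. \<forall>ij\<in>{1..r}\<times>{1..r}. norm (Es ij x) \<le> C * e x" by blast
  have "inj_on \<theta> {1..r}" unfolding \<theta>_def by (rule distinct_eigenvalues_imp_inj[OF G0 dist])
  then obtain g where g: "g > 0" "\<And>i j. i \<in> {1..r} \<Longrightarrow> j \<in> {1..r} \<Longrightarrow> i \<noteq> j \<Longrightarrow> g \<le> norm (\<theta> i - \<theta> j)"
    using exists_gap[of "{1..r}" \<theta>] by auto
  define good where "good x \<longleftrightarrow> step2 n r p k \<xi> (G x) (w x) \<and>
      (\<forall>i\<in>{1..r}. \<forall>j\<in>{1..r}. norm (E x i j) \<le> C * e x) \<and> 4 * card {1..r} * (C * e x) < g" for x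
  have good: "\<forall>\<^sub>F x in \<Phi>. good x"
    using step2 C(2) eventually_mult_e_less[OF g(1), of "4 * card {1..r} * C"]
    by eventually_elim (auto simp: good_def Es_def mult.assoc)
  have eig: "\<theta> j * X x i j + (\<Sum>l=1..r. E x j l * X x i l) = T x i * X x i j"
    if "good x" "i \<in> {1..r}" "j \<in> {1..r}" for x i j
  proof -
    have "eigenpair B (N_xi n k \<xi> (G x)) (T x i) (z x i)" using zT that by (simp add: good_def)
    then have "\<And>\<nu>. \<nu> \<in> B0 r p k \<Longrightarrow>
        (\<Sum>\<beta>\<in>B0 r p k. N_xi n k \<xi> (G x) \<nu> \<beta> * z x i \<beta>) = T x i * z x i \<nu>"
      by (simp add: eigenpair_def B_def)
    from eigenvector_coordinates[OF G0 L this that(3), where \<xi> = \<xi>]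
    show ?thesis by (simp add: \<theta>_def X_def E_def B_def)
  qed
  have zX: "z x i \<nu> = (\<Sum>j=1..r. mono_eval \<nu> (u j) * X x i j)" if "\<nu> \<in> B" for x i \<nu>
    using expand_in_B0[OF L, of \<nu> "z x i"] that by (simp add: X_def B_def)
  have X_nz: "\<exists>j\<in>{1..r}. X x i j \<noteq> 0" if "good x" "i \<in> {1..r}" for x i
  proof (rule ccontr)
    assume "\<not> ?thesis"
    then have "z x i \<nu> = 0" if "\<nu> \<in> B" for \<nu> unfolding zX[OF that] by simp
    moreover have "eigenpair B (N_xi n k \<xi> (G x)) (T x i) (z x i)" using zT that by (simp add: good_def)
    ultimately show False unfolding eigenpair_def by blast
  qed
  define dominates where "dominates x i s \<longleftrightarrow> s \<in> {1..r} \<and> X x i s \<noteq> 0 \<and> norm (\<theta> s - T x i) \<le> card {1..r} * (C * e x) \<and>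
     (\<forall>j\<in>{1..r}. j \<noteq> s \<longrightarrow> norm (X x i j) \<le> 2 * card {1..r} * (C * e x) / g * norm (X x i s))" for x i s
  define \<sigma> where "\<sigma> x i = (if i \<in> {1..r} then SOME s. dominates x i s else i)" for x i
  have dom: "dominates x i (\<sigma> x i)" if "good x" "i \<in> {1..r}" for x i
  proof -
    have "\<exists>s\<in>{1..r}. X x i s \<noteq> 0 \<and> norm (\<theta> s - T x i) \<le> card {1..r} * (C * e x) \<and>
     (\<forall>j\<in>{1..r}. j \<noteq> s \<longrightarrow> norm (X x i j) \<le> 2 * card {1..r} * (C * e x) / g * norm (X x i s))"
      by (rule dominant_coordinate[OF _ X_nz[OF that], where E = "E x"])
        (use that eig g in \<open>auto simp: good_def\<close>)
    then have "\<exists>s. dominates x i s" unfolding dominates_def by blast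
    then show ?thesis using that(2) by (simp add: \<sigma>_def someI_ex)
  qed
  have \<sigma>_inj: "inj_on (\<sigma> x) {1..r}" if gx: "good x" for x
  proof (rule inj_onI, rule ccontr)
    fix i i' assume i: "i \<in> {1..r}" "i' \<in> {1..r}" "\<sigma> x i = \<sigma> x i'" "i \<noteq> i'"
    define s where "s = \<sigma> x i"
    have ds: "dominates x i s" "dominates x i' s" using dom[OF gx i(1)] dom[OF gx i(2)] i(3) by (simp_all add: s_def)
    have proportional: "X x i j * X x i' s = X x i' j * X x i s" if "j \<in> {1..r}" for j
      by (rule dominant_coordinate_determines_direction[where \<theta> = \<theta> and E = "E x" and t = "T x i" and t' = "T x i'"
            and J = "{1..r}" and d = "C * e x" and g = g])
        (use gx i ds that eig g in \<open>auto simp: good_def dominates_def\<close>)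
    \<comment> \<open>The combination that cancels the coordinate \<open>s\<close>.\<close>
    define a where "a j = (if j = i then X x i' s else if j = i' then - X x i s else 0)" for j
    have "(\<Sum>j=1..r. a j * z x j \<nu>) = 0" if "\<nu> \<in> B" for \<nu>
    proof -
      have "(\<Sum>j=1..r. a j * z x j \<nu>) = (\<Sum>j\<in>{i, i'}. a j * z x j \<nu>)"
        using i by (intro sum.mono_neutral_right) (auto simp: a_def)
      also have "\<dots> = X x i' s * z x i \<nu> - X x i s * z x i' \<nu>" using i by (simp add: a_def)
      also have "\<dots> = (\<Sum>j=1..r. mono_eval \<nu> (u j) * (X x i j * X x i' s - X x i' j * X x i s))"
        unfolding zX[OF that] by (simp add: sum_distrib_left sum_subtractf algebra_simps)
      also have "\<dots> = 0" using proportional by simp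
      finally show ?thesis .
    qed
    moreover have "lin_indep r B (z x)" using zT gx by (simp add: good_def)
    ultimately have "a i = 0" using i(1) unfolding lin_indep_def by blast
    then show False using ds(2) by (simp add: a_def dominates_def)
  qed
  have perm: "\<sigma> x permutes {1..r}" if gx: "good x" for x
  proof (rule bij_imp_permutes)
    have "\<sigma> x ` {1..r} \<subseteq> {1..r}" using dom[OF gx] unfolding dominates_def by blast
    then show "bij_betw (\<sigma> x) {1..r} {1..r}"
      using \<sigma>_inj[OF gx] endo_inj_surj[of "{1..r}" "\<sigma> x"] by (simp add: bij_betw_def)
  next
    fix i assume "i \<notin> {1..r}"
    then show "\<sigma> x i = i" unfolding \<sigma>_def by (rule if_not_P)
  qed
  have w_near: "near (inf \<Phi> (principal {x. \<sigma> x = s})) e (\<lambda>x. w x i t) (u (s i) (k + t))"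
    if i: "i \<in> {1..r}" and t: "t \<in> {1..n-k}" for s i t
  proof -
    define \<Psi> where "\<Psi> = inf \<Phi> (principal {x. \<sigma> x = s})"
    interpret sub: vanishing \<Psi> e unfolding \<Psi>_def by (rule restricted)
    have le: "\<Psi> \<le> \<Phi>" by (simp add: \<Psi>_def)
    have gs: "\<forall>\<^sub>F x in \<Psi>. good x \<and> \<sigma> x = s"
      using good unfolding \<Psi>_def eventually_inf_principal by (auto elim: eventually_mono)
    define l where "l = k + t"
    have l: "l \<in> {k+1..n}" using t by (auto simp: l_def)
    have z1: "norm (z x i \<nu>) \<le> 1" if "good x" "\<nu> \<in> B" for x \<nu>
    proof -
      have "norm (z x i \<nu>) \<le> frob_norm B (z x i)"
        unfolding frob_norm_def by (rule member_le_L2_set[OF finB that(2)])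
      then show ?thesis using zT that i by (simp add: good_def)
    qed
    have z_bdd: "bdd \<Psi> (\<lambda>x. z x i \<nu>)" if "\<nu> \<in> B" for \<nu>
      unfolding bdd_def by (rule exI[of _ 1], rule eventually_mono[OF gs]) (use z1 that in blast)
    have cz_bdd: "bdd \<Psi> (\<lambda>x. cnj (z x i \<nu>))" if "\<nu> \<in> B" for \<nu>
      using z_bdd[OF that] by (simp add: bdd_def)
    have X_bdd: "bdd \<Psi> (\<lambda>x. X x i j)" for j
      unfolding X_def by (intro bdd_sum bdd_mult bdd_const z_bdd)
    have X_small: "small \<Psi> e (\<lambda>x. X x i j)" if j: "j \<in> {1..r}" "j \<noteq> s i" for j
    proof -
      obtain D where D: "\<forall>\<^sub>F x in \<Psi>. norm (X x i (s i)) \<le> D" using X_bdd unfolding bdd_def by blast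
      have "\<forall>\<^sub>F x in \<Psi>. norm (X x i j) \<le> (2 * card {1..r} * C / g * D) * e x"
        using gs D
      proof eventually_elim
        case (elim x)
        have "dominates x i (s i)" using dom[OF _ i, of x] elim(1) by auto
        then have "norm (X x i j) \<le> 2 * card {1..r} * (C * e x) / g * norm (X x i (s i))"
          using j unfolding dominates_def by blast
        also have "\<dots> \<le> 2 * card {1..r} * (C * e x) / g * D"
          by (rule mult_left_mono[OF elim(2)]) (use C(1) g(1) e_nonneg[of x] in simp)
        finally show ?case by (simp add: ac_simps)
      qed
      then show ?thesis unfolding small_def by blast
    qed
    \<comment> \<open>The defect of the computed eigenvector as an eigenvector of \<open>N_l (G x) l\<close> for \<open>u (s i) l\<close>; the
      summand \<open>j = s i\<close> vanishes.\<close>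
    define R where "R x \<nu> = (\<Sum>\<beta>\<in>B. (N_l (G x) l \<nu> \<beta> - N_l G0 l \<nu> \<beta>) * z x i \<beta>)
        + (\<Sum>j=1..r. X x i j * ((u j l - u (s i) l) * mono_eval \<nu> (u j)))" for x \<nu>
    have R_small: "small \<Psi> e (\<lambda>x. R x \<nu>)" if \<nu>: "\<nu> \<in> B" for \<nu>
    proof -
      have "small \<Psi> e (\<lambda>x. (N_l (G x) l \<nu> \<beta> - N_l G0 l \<nu> \<beta>) * z x i \<beta>)" if "\<beta> \<in> B" for \<beta>
        using small_filter_mono[OF le] N_near[OF l \<nu> that, unfolded near_def]
        by (intro sub.small_mult_bdd z_bdd that) blast
      moreover have "small \<Psi> e (\<lambda>x. X x i j * ((u j l - u (s i) l) * mono_eval \<nu> (u j)))" if "j \<in> {1..r}" for j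
      proof (cases "j = s i")
        case True
        then show ?thesis by (simp add: small_zero)
      next
        case False
        then show ?thesis using X_small that by (intro sub.small_mult_bdd bdd_const)
      qed
      ultimately show ?thesis unfolding R_def by (intro small_add small_sum)
    qed
    have wR: "w x i t - u (s i) (k + t) = (\<Sum>\<nu>\<in>B. R x \<nu> * cnj (z x i \<nu>))" if gx: "good x" for x
    proof -
      have Nz: "(\<Sum>\<beta>\<in>B. N_l (G x) l \<nu> \<beta> * z x i \<beta>) = R x \<nu> + u (s i) l * z x i \<nu>" if "\<nu> \<in> B" for \<nu>
      proof -
        have "(\<Sum>\<beta>\<in>B. N_l G0 l \<nu> \<beta> * z x i \<beta>) = (\<Sum>\<beta>\<in>B. \<Sum>j=1..r. N_l G0 l \<nu> \<beta> * mono_eval \<beta> (u j) * X x i j)"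
          using zX by (intro sum.cong refl) (simp add: sum_distrib_left mult.assoc)
        also have "\<dots> = (\<Sum>j=1..r. (\<Sum>\<beta>\<in>B. N_l G0 l \<nu> \<beta> * mono_eval \<beta> (u j)) * X x i j)"
          by (subst sum.swap) (simp add: sum_distrib_right)
        also have "\<dots> = (\<Sum>j=1..r. u j l * mono_eval \<nu> (u j) * X x i j)"
          using N_l_action[OF G0 l] that unfolding B_def by (intro sum.cong refl) simp
        also have "\<dots> = (\<Sum>j=1..r. X x i j * ((u j l - u (s i) l) * mono_eval \<nu> (u j))) + u (s i) l * z x i \<nu>"
          unfolding zX[OF that] sum_distrib_left sum.distrib[symmetric]
          by (intro sum.cong refl) (simp add: algebra_simps)
        finally show ?thesis by (simp add: R_def left_diff_distrib sum_subtractf)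
      qed
      have n1: "(\<Sum>\<nu>\<in>B. cnj (z x i \<nu>) * z x i \<nu>) = 1"
        by (rule sum_cnj_mult_self) (use zT gx i in \<open>simp add: good_def\<close>)
      have "w x i t = herm_form B (N_l (G x) l) (z x i)"
        using zT gx i t by (simp add: good_def l_def)
      also have "\<dots> = (\<Sum>\<nu>\<in>B. cnj (z x i \<nu>) * (\<Sum>\<beta>\<in>B. N_l (G x) l \<nu> \<beta> * z x i \<beta>))"
        by (simp add: herm_form_def sum_distrib_left mult.assoc)
      also have "\<dots> = (\<Sum>\<nu>\<in>B. R x \<nu> * cnj (z x i \<nu>) + u (s i) l * (cnj (z x i \<nu>) * z x i \<nu>))"
        using Nz by (intro sum.cong refl) (simp add: algebra_simps)
      also have "\<dots> = (\<Sum>\<nu>\<in>B. R x \<nu> * cnj (z x i \<nu>)) + u (s i) l"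
        unfolding sum.distrib sum_distrib_left[symmetric] n1 by simp
      finally show ?thesis by (simp add: l_def)
    qed
    have "small \<Psi> e (\<lambda>x. \<Sum>\<nu>\<in>B. R x \<nu> * cnj (z x i \<nu>))"
      by (intro small_sum sub.small_mult_bdd R_small cz_bdd)
    then have "small \<Psi> e (\<lambda>x. w x i t - u (s i) (k + t))"
      by (rule small_cong[rotated]) (rule eventually_mono[OF gs], simp add: wR)
    then show ?thesis by (simp add: near_def \<Psi>_def)
  qed
  show ?thesis
  proof (rule that)
    show "\<forall>\<^sub>F x in \<Phi>. \<sigma> x permutes {1..r}" by (rule eventually_mono[OF good perm])
  qed (rule w_near)
qed

section \<open>Recovering the vectors and the coefficients\<close>

lemma mono_eval_near:
  "(\<And>j. j \<in># f \<Longrightarrow> near \<Phi> e (\<lambda>x. v x j) (b j)) \<Longrightarrow> near \<Phi> e (\<lambda>x. mono_eval f (v x)) (mono_eval f b)"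
  unfolding mono_eval_def by (rule near_prod_mset)

lemma tensor_power_near:
  "(\<And>j. j \<in> set I \<Longrightarrow> near \<Phi> e (\<lambda>x. v x j) (b j)) \<Longrightarrow> near \<Phi> e (\<lambda>x. tensor_power (v x) I) (tensor_power b I)"
  unfolding tensor_power_def by (rule near_prod_list)

lemma shifted_near:
  assumes w: "\<And>t. t \<in> {1..n-k} \<Longrightarrow> near \<Phi> e (\<lambda>x. w x t) (b (k + t))" and g: "g \<in> J2 m n p k"
  shows "near \<Phi> e (\<lambda>x. mono_eval (shift_mono k g) (w x)) (mono_eval g b)"
proof -
  have "near \<Phi> e (\<lambda>x. \<Prod>j\<in>#g. w x (j - k)) (\<Prod>j\<in>#g. b j)"
  proof (rule near_prod_mset)
    fix j assume "j \<in># g"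
    then have j: "k + 1 \<le> j" "j \<le> n" using g by (auto simp: J2_iff)
    then have "near \<Phi> e (\<lambda>x. w x (j - k)) (b (k + (j - k)))" by (intro w) auto
    then show "near \<Phi> e (\<lambda>x. w x (j - k)) (b j)" using j by simp
  qed
  then show ?thesis by (simp add: mono_eval_def shift_mono_def multiset.map_comp o_def)
qed

text \<open>The limit system is injective because \<open>J2\<close> contains the sets \<open>O_set\<close>.\<close>

lemma J2_system_near:
  assumes M: "\<And>i g. i \<in> {1..r} \<Longrightarrow> g \<in> J2 m n p k \<Longrightarrow> near \<Phi> e (\<lambda>x. M x g i) (mono_eval g (u i))"
    and rhs: "\<And>g. g \<in> J2 m n p k \<Longrightarrow>
       near \<Phi> e (\<lambda>x. \<Sum>i=1..r. M x g i * h x i) (\<Sum>i=1..r. mono_eval g (u i) * h0 i)"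
    and i: "i \<in> {1..r}"
  shows "near \<Phi> e (\<lambda>x. h x i) (h0 i)"
proof (rule near_solution[where Ah = M and A = "\<lambda>g i. mono_eval g (u i)" and T = "{1..r}" and S = "J2 m n p k"])
  fix d :: "nat \<Rightarrow> complex" assume 0: "\<forall>g\<in>J2 m n p k. (\<Sum>i=1..r. mono_eval g (u i) * d i) = 0"
  show "\<forall>i\<in>{1..r}. d i = 0"
  proof
    fix i assume i: "i \<in> {1..r}"
    have "(\<Sum>i=1..r. d i * mono_eval g (u i)) = 0" if "g \<in> J2 m n p k" for g
      using 0 that by (simp add: mult.commute)
    from indep_J2[OF this i] show "d i = 0" by simp
  qed
qed (use assms finite_J2 in auto)

lemma step3_gamma_near:
  assumes w: "\<And>i t. i \<in> {1..r} \<Longrightarrow> t \<in> {1..n-k} \<Longrightarrow> near \<Phi> e (\<lambda>x. w x i t) (u i (k + t))"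
    and step: "\<forall>\<^sub>F x in \<Phi>. step3_gamma m n r p k (Fh x) (w x) (\<gamma> x)"
    and i: "i \<in> {1..r}" and f: "f \<in> J1 p k"
  shows "near \<Phi> e (\<lambda>x. \<gamma> x i f) (c i * mono_eval f (u i))"
proof -
  define M where "M x g i = mono_eval (shift_mono k g) (w x i)" for x g i
  define R where "R x \<gamma> fg = (case fg of (f, g) \<Rightarrow> entry m (Fh x) (f + g)
     - (\<Sum>i=1..r. \<gamma> i f * mono_eval (shift_mono k g) (w x i)))" for x and \<gamma> :: "nat \<Rightarrow> monomial \<Rightarrow> complex" and fg
  have M: "near \<Phi> e (\<lambda>x. M x g i) (mono_eval g (u i))" if "i \<in> {1..r}" "g \<in> J2 m n p k" for i g
    unfolding M_def by (rule shifted_near[where w = "\<lambda>x. w x i" and b = "u i", OF w[OF that(1)] that(2)])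
  have ent: "near \<Phi> e (\<lambda>x. entry m (Fh x) (f + g)) (\<Sum>i=1..r. (c i * mono_eval f (u i)) * mono_eval g (u i))"
    if "f \<in> J1 p k" "g \<in> J2 m n p k" for f g
    using entry_near[OF Omega_J1_J2[OF that]] entry_eq[OF Omega_J1_J2[OF that]]
    by (simp add: mono_eval_add mult.assoc)
  have min: "\<forall>\<^sub>F x in \<Phi>. minimizer (\<lambda>\<gamma>. (frob_norm (J1 p k \<times> J2 m n p k) (R x \<gamma>))\<^sup>2) (\<gamma> x)"
    using step by eventually_elim (simp add: step3_gamma_def R_def[abs_def])
  have sm: "small \<Phi> e (\<lambda>x. R x (\<gamma> x) fg)" if "fg \<in> J1 p k \<times> J2 m n p k" for fg
  proof (rule small_minimizer_residual[OF _ min _ that, where ?g0.0 = "\<lambda>i f. c i * mono_eval f (u i)"])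
    fix fg assume fg: "fg \<in> J1 p k \<times> J2 m n p k"
    obtain f g where fg': "fg = (f, g)" "f \<in> J1 p k" "g \<in> J2 m n p k" using fg by auto
    have "near \<Phi> e (\<lambda>x. \<Sum>i=1..r. (c i * mono_eval f (u i)) * M x g i)
       (\<Sum>i=1..r. (c i * mono_eval f (u i)) * mono_eval g (u i))"
      by (intro near_sum near_mult near_const M fg')
    from small_diff[OF ent[OF fg'(2,3), unfolded near_def] this[unfolded near_def]]
    show "small \<Phi> e (\<lambda>x. R x (\<lambda>i f. c i * mono_eval f (u i)) fg)"
      by (simp add: R_def fg'(1) M_def)
  qed (simp add: finite_J1 finite_J2)
  show ?thesis
  proof (rule J2_system_near[OF M, where h = "\<lambda>x i. \<gamma> x i f" and ?h0.0 = "\<lambda>i. c i * mono_eval f (u i)"])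
    fix g assume g: "g \<in> J2 m n p k"
    have "small \<Phi> e (\<lambda>x. R x (\<gamma> x) (f, g))" using sm f g by blast
    from near_add_small[OF ent[OF f g] small_minus[OF this]]
    show "near \<Phi> e (\<lambda>x. \<Sum>i=1..r. M x g i * \<gamma> x i f) (\<Sum>i=1..r. mono_eval g (u i) * (c i * mono_eval f (u i)))"
      by (simp add: R_def M_def mult.commute)
  qed (use i in auto)
qed

text \<open>Nondegeneracy gives, for each \<open>i\<close>, a row of the system in which the unknown \<open>u i j\<close> has a
  nonzero coefficient \<open>c i * mono_eval f (u i)\<close>.\<close>

lemma step3_v_near:
  assumes w: "\<And>i t. i \<in> {1..r} \<Longrightarrow> t \<in> {1..n-k} \<Longrightarrow> near \<Phi> e (\<lambda>x. w x i t) (u i (k + t))"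
    and \<gamma>: "\<And>i f. i \<in> {1..r} \<Longrightarrow> f \<in> J1 p k \<Longrightarrow> near \<Phi> e (\<lambda>x. \<gamma> x i f) (c i * mono_eval f (u i))"
    and step: "\<forall>\<^sub>F x in \<Phi>. step3_v m n r p k (Fh x) (w x) (\<gamma> x) (v x)"
    and nondeg: "step3_nondegenerate r p k u"
    and i: "i \<in> {1..r}" and j: "j \<in> {1..k}"
  shows "near \<Phi> e (\<lambda>x. v x i j) (u i j)"
proof -
  define S where "S = J1_without p k j \<times> J2 m n p k"
  have finS: "finite S"
    unfolding S_def J1_without_def by (intro finite_cartesian_product finite_J2 finite_subset[OF _ finite_J1]) auto
  define M where "M x fg i = \<gamma> x i (fst fg) * mono_eval (shift_mono k (snd fg)) (w x i)" for x fg i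
  define M0 where "M0 fg i = c i * mono_eval (fst fg) (u i) * mono_eval (snd fg) (u i)" for fg i
  define R where "R x c fg = (case fg of (f, g) \<Rightarrow> entry m (Fh x) ({#j#} + f + g)
     - (\<Sum>i=1..r. c i * \<gamma> x i f * mono_eval (shift_mono k g) (w x i)))" for x and c :: "nat \<Rightarrow> complex" and fg
  have SD: "fst fg \<in> J1 p k" "j \<notin># fst fg" "snd fg \<in> J2 m n p k" if "fg \<in> S" for fg
    using that by (auto simp: S_def J1_without_def)
  have M: "near \<Phi> e (\<lambda>x. M x fg i) (M0 fg i)" if "fg \<in> S" "i \<in> {1..r}" for fg i
  proof -
    have "near \<Phi> e (\<lambda>x. mono_eval (shift_mono k (snd fg)) (w x i)) (mono_eval (snd fg) (u i))"
      by (rule shifted_near[where w = "\<lambda>x. w x i" and b = "u i", OF w[OF that(2)] SD(3)[OF that(1)]])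
    from near_mult[OF \<gamma>[OF that(2) SD(1)[OF that(1)]] this] show ?thesis by (simp add: M_def M0_def)
  qed
  have R_eq: "R x c fg = entry m (Fh x) ({#j#} + fst fg + snd fg) - (\<Sum>i=1..r. M x fg i * c i)" for x c fg
    by (simp add: R_def M_def split_beta ac_simps)
  have ent: "near \<Phi> e (\<lambda>x. entry m (Fh x) ({#j#} + fst fg + snd fg)) (\<Sum>i=1..r. M0 fg i * u i j)" if fg: "fg \<in> S" for fg
  proof -
    have "Omega_monomial m n ((fst fg + {#j#}) + snd fg)"
    proof (rule Omega_monomial_add)
      show "count (fst fg + {#j#}) i \<le> 1" for i
        using SD[OF fg] by (intro count_add_le_1) (auto simp: J1_iff)
    qed (use SD[OF fg] j p_m k_less_n in \<open>(fastforce simp: J1_iff J2_iff)+\<close>)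
    then have Om: "Omega_monomial m n ({#j#} + fst fg + snd fg)" by (simp add: ac_simps)
    show ?thesis using entry_near[OF Om] entry_eq[OF Om]
      by (simp only: M0_def mono_eval_add mono_eval_single ac_simps)
  qed
  have min: "\<forall>\<^sub>F x in \<Phi>. minimizer (\<lambda>c. (frob_norm S (R x c))\<^sup>2) (\<lambda>i. v x i j)"
    using step by eventually_elim (use j in \<open>simp add: step3_v_def R_def[abs_def] S_def\<close>)
  have sm: "small \<Phi> e (\<lambda>x. R x (\<lambda>i. v x i j) fg)" if "fg \<in> S" for fg
  proof (rule small_minimizer_residual[OF finS min _ that, where ?g0.0 = "\<lambda>i. u i j"])
    fix fg assume fg: "fg \<in> S"
    have "near \<Phi> e (\<lambda>x. \<Sum>i=1..r. M x fg i * u i j) (\<Sum>i=1..r. M0 fg i * u i j)"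
      by (intro near_sum near_mult near_const M fg)
    from small_diff[OF ent[OF fg, unfolded near_def] this[unfolded near_def]]
    show "small \<Phi> e (\<lambda>x. R x (\<lambda>i. u i j) fg)" by (simp add: R_eq)
  qed
  show ?thesis
  proof (rule near_solution[OF finS _ M, where h = "\<lambda>x i. v x i j" and ?h0.0 = "\<lambda>i. u i j" and T = "{1..r}"])
    fix fg assume fg: "fg \<in> S"
    from near_add_small[OF ent[OF fg] small_minus[OF sm[OF fg]]]
    show "near \<Phi> e (\<lambda>x. \<Sum>i=1..r. M x fg i * v x i j) (\<Sum>i=1..r. M0 fg i * u i j)"
      by (simp add: R_eq)
  next
    fix d :: "nat \<Rightarrow> complex" assume 0: "\<forall>fg\<in>S. (\<Sum>i=1..r. M0 fg i * d i) = 0"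
    show "\<forall>i\<in>{1..r}. d i = 0"
    proof
      fix i assume i: "i \<in> {1..r}"
      obtain f where f: "f \<in> J1_without p k j" "mono_eval f (u i) \<noteq> 0"
        using nondeg i j unfolding step3_nondegenerate_def by blast
      have "(\<Sum>i=1..r. (c i * mono_eval f (u i) * d i) * mono_eval g (u i)) = 0" if "g \<in> J2 m n p k" for g
      proof -
        have "(\<Sum>i=1..r. M0 (f, g) i * d i) = 0" using 0 f that by (simp add: S_def)
        then show ?thesis by (simp add: M0_def ac_simps)
      qed
      from indep_J2[OF this i] have "c i * mono_eval f (u i) * d i = 0" by simp
      then show "d i = 0" using f(2) c_nz[OF i] by simp
    qed
  qed (use i in auto)
qed

text \<open>The tuples labelled by products of a monomial from \<open>B0\<close> and one from \<open>J2\<close> already make the powers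
  of the \<open>u i\<close> independent.\<close>

lemma coefficients_near:
  assumes U: "\<And>i j. i \<in> {1..r} \<Longrightarrow> j \<in> {0..n} \<Longrightarrow> near \<Phi> e (\<lambda>x. U x i j) (u i j)"
    and rhs: "\<And>I. I \<in> Omega_set m n \<Longrightarrow> near \<Phi> e (\<lambda>x. \<Sum>i=1..r. a x i * tensor_power (U x i) I) (F I)"
    and i: "i \<in> {1..r}"
  shows "near \<Phi> e (\<lambda>x. a x i) (c i)"
proof (rule near_solution[where Ah = "\<lambda>x I i. tensor_power (U x i) I" and A = "\<lambda>I i. tensor_power (u i) I"
      and T = "{1..r}" and S = "Omega_set m n"])
  fix I i assume "I \<in> Omega_set m n" "i \<in> {1..r}"
  then show "near \<Phi> e (\<lambda>x. tensor_power (U x i) I) (tensor_power (u i) I)"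
    by (intro tensor_power_near U) (auto simp: Omega_set_def index_tuples_def)
next
  fix I assume "I \<in> Omega_set m n"
  then show "near \<Phi> e (\<lambda>x. \<Sum>i=1..r. tensor_power (U x i) I * a x i) (\<Sum>i=1..r. tensor_power (u i) I * c i)"
    using rhs F_eq by (simp add: mult.commute)
next
  fix d :: "nat \<Rightarrow> complex" assume 0: "\<forall>I\<in>Omega_set m n. (\<Sum>i=1..r. tensor_power (u i) I * d i) = 0"
  show "\<forall>i\<in>{1..r}. d i = 0"
  proof
    fix i assume i: "i \<in> {1..r}"
    obtain f where f: "f \<in> B0 r p k" "mono_eval f (u i) \<noteq> 0" using exists_nonzero_B0[OF i] by blast
    have "(\<Sum>i=1..r. (d i * mono_eval f (u i)) * mono_eval g (u i)) = 0" if g: "g \<in> J2 m n p k" for g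
    proof -
      define I where "I = replicate (m - size (f + g)) 0 @ sorted_list_of_multiset (f + g)"
      have "Omega_monomial m n (f + g)" using Omega_J1_J2 f(1) g B0_subset_J1 by blast
      then have "I \<in> Omega_set m n" unfolding I_def Omega_monomial_def by (intro padded_in_Omega_set) auto
      then have "(\<Sum>i=1..r. tensor_power (u i) I * d i) = 0" using 0 by blast
      moreover have "tensor_power (u i) I * d i = (d i * mono_eval f (u i)) * mono_eval g (u i)" if "i \<in> {1..r}" for i
        unfolding I_def tensor_power_padded using u0[OF that] by (simp add: mono_eval_add ac_simps)
      ultimately show ?thesis by simp
    qed
    from indep_J2[OF this i] have "d i * mono_eval f (u i) = 0" by simp
    then show "d i = 0" using f(2) by simp
  qed
qed (use i finite_Omega_set in auto)

lemma step3_lambda_near: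
  assumes U: "\<And>i j. i \<in> {1..r} \<Longrightarrow> j \<in> {0..n} \<Longrightarrow> near \<Phi> e (\<lambda>x. prepend_one (v x i) j) (u i j)"
    and step: "\<forall>\<^sub>F x in \<Phi>. step3_lambda m n r (Fh x) (v x) (a x)"
    and i: "i \<in> {1..r}"
  shows "near \<Phi> e (\<lambda>x. a x i) (c i)"
proof (rule coefficients_near[OF U _ i])
  fix I assume I: "I \<in> Omega_set m n"
  define R where "R x c I = Fh x I - (\<Sum>i=1..r. c i * tensor_power (prepend_one (v x i)) I)"
    for x and c :: "nat \<Rightarrow> complex" and I
  have min: "\<forall>\<^sub>F x in \<Phi>. minimizer (\<lambda>c. (frob_norm (Omega_set m n) (R x c))\<^sup>2) (a x)"
    using step by eventually_elim (simp add: step3_lambda_def R_def[abs_def])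
  have "small \<Phi> e (\<lambda>x. R x (a x) I)"
  proof (rule small_minimizer_residual[OF finite_Omega_set min _ I, where ?g0.0 = c])
    fix I assume I: "I \<in> Omega_set m n"
    then have "near \<Phi> e (\<lambda>x. \<Sum>i=1..r. c i * tensor_power (prepend_one (v x i)) I) (\<Sum>i=1..r. c i * tensor_power (u i) I)"
      by (intro near_sum near_mult near_const tensor_power_near U) (auto simp: Omega_set_def index_tuples_def)
    from small_diff[OF Fh_near[OF I, unfolded near_def] this[unfolded near_def]]
    show "small \<Phi> e (\<lambda>x. R x c I)" by (simp add: R_def F_eq[OF I])
  qed
  from near_add_small[OF Fh_near[OF I] small_minus[OF this]]
  show "near \<Phi> e (\<lambda>x. \<Sum>i=1..r. a x i * tensor_power (prepend_one (v x i)) I) (F I)" by (simp add: R_def)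
qed

end

section \<open>The output of the algorithm\<close>

lemma mono_eval_scale: "mono_eval f (\<lambda>j. a * v j) = a ^ size f * mono_eval f v"
  by (induction f) (simp_all add: mono_eval_def ac_simps)

lemma tensor_power_scale: "tensor_power (\<lambda>j. a * v j) I = a ^ length I * tensor_power v I"
  by (induction I) (simp_all add: tensor_power_def ac_simps)

lemma minimizer_of_zero_residual:
  assumes "\<And>s. s \<in> S \<Longrightarrow> R g s = 0"
  shows "minimizer (\<lambda>g. (frob_norm S (R g))\<^sup>2) g"
proof -
  have "frob_norm S (R g) = 0"
    unfolding frob_norm_def L2_set_def using assms by simp
  then show ?thesis unfolding minimizer_def is_arg_min_def by (simp add: not_less)
qed

definition nondegenerate_powers :: "nat \<Rightarrow> nat \<Rightarrow> nat \<Rightarrow> (nat \<Rightarrow> nat \<Rightarrow> complex) \<Rightarrow> bool" where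
  "nondegenerate_powers r p k q \<longleftrightarrow> (\<forall>i\<in>{1..r}. q i 0 \<noteq> 0) \<and>
     lin_indep r (B0 r p k) (\<lambda>i f. mono_eval f (q i)) \<and>
     (\<forall>h. (\<forall>i\<in>{1..r}. (\<Sum>\<beta>\<in>B0 r p k. mono_eval \<beta> (q i) * h \<beta>) = 0) \<longrightarrow> (\<forall>\<beta>\<in>B0 r p k. h \<beta> = 0))"

text \<open>For \<open>\<alpha>\<close> of degree \<open>p + 1\<close>, dividing both sides by \<open>(q i 0) ^ p\<close> turns this into interpolation at the
  normalized vector \<open>q i / q i 0\<close>.\<close>

definition interpolates ::
  "nat \<Rightarrow> nat \<Rightarrow> nat \<Rightarrow> (nat \<Rightarrow> nat \<Rightarrow> complex) \<Rightarrow> (monomial \<Rightarrow> monomial \<Rightarrow> complex) \<Rightarrow> bool" where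
  "interpolates r p k q G \<longleftrightarrow> (\<forall>\<alpha>. \<forall>i\<in>{1..r}.
     (\<Sum>\<beta>\<in>B0 r p k. mono_eval \<beta> (q i) * G \<beta> \<alpha>) = mono_eval \<alpha> (q i) / q i 0)"

context perturbed_decomposition begin

context
  fixes q :: "'x \<Rightarrow> nat \<Rightarrow> nat \<Rightarrow> complex"
  assumes Fq: "\<And>x I. Fh x I = (\<Sum>i=1..r. tensor_power (q x i) I)"
begin

lemma entry_powers: "entry m (Fh x) f = (\<Sum>i=1..r. q x i 0 ^ (m - size f) * mono_eval f (q x i))"
  unfolding entry_def Fq tensor_power_padded ..

lemma entry_J1_J2:
  assumes "f \<in> J1 p k" "g \<in> J2 m n p k"
  shows "entry m (Fh x) (f + g) = (\<Sum>i=1..r. q x i 0 * mono_eval f (q x i) * mono_eval g (q x i))"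
proof -
  have "m - size (f + g) = 1" using assms p_m by (simp add: J1_iff J2_iff)
  then show ?thesis by (simp add: entry_powers mono_eval_add mult.assoc)
qed

lemma A_mat_powers_action:
  assumes "\<gamma> \<in> J2 m n p k"
  shows "(\<Sum>\<beta>\<in>B0 r p k. A_mat m (Fh x) \<gamma> \<beta> * h \<beta>)
       = (\<Sum>i=1..r. q x i 0 * (\<Sum>\<beta>\<in>B0 r p k. mono_eval \<beta> (q x i) * h \<beta>) * mono_eval \<gamma> (q x i))"
  unfolding A_mat_def
  by (rule A_mat_action[unfolded A_mat_def], rule entry_J1_J2) (use B0_subset_J1 assms in blast)+

text \<open>The matrix of Step 1 factors through the \<open>r\<close> vectors of values of the monomials from \<open>B0\<close> at the
  \<open>q i\<close>, weighted by \<open>q i 0\<close>. It is near a matrix of rank \<open>r\<close>, so none of the \<open>r\<close> terms is redundant.\<close>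

lemma eventually_powers_nondegenerate:
  "\<forall>\<^sub>F x in \<Phi>. nondegenerate_powers r p k (q x)"
proof -
  obtain f where f: "f \<in> J1 p k" using J1_nonempty by blast
  define O' where "O' = O_set m n p k (f + {#k+1#})"
  have l: "k + 1 \<in> {k+1..n}" using k_less_n by simp
  have "\<forall>\<^sub>F x in \<Phi>. \<forall>h. (\<forall>\<gamma>\<in>O'. (\<Sum>\<beta>\<in>B0 r p k. A_mat m (Fh x) \<gamma> \<beta> * h \<beta>) = 0) \<longrightarrow> (\<forall>\<beta>\<in>B0 r p k. h \<beta> = 0)"
  proof (rule eventually_injective)
    show "near \<Phi> e (\<lambda>x. A_mat m (Fh x) \<gamma> \<beta>) (A_mat m F \<gamma> \<beta>)" if "\<gamma> \<in> O'" "\<beta> \<in> B0 r p k" for \<gamma> \<beta>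
      using A_mat_near[OF f] that unfolding O'_def by blast
    show "\<forall>\<beta>\<in>B0 r p k. h \<beta> = 0" if "\<forall>\<gamma>\<in>O'. (\<Sum>\<beta>\<in>B0 r p k. A_mat m F \<gamma> \<beta> * h \<beta>) = 0" for h
      using A_mat_injective[OF f l] that unfolding O'_def by blast
  qed (simp_all add: O'_def finite_O_set finite_B0)
  then show ?thesis
  proof eventually_elim
    case (elim x)
    define Q where "Q h i = (\<Sum>\<beta>\<in>B0 r p k. mono_eval \<beta> (q x i) * h \<beta>)" for h i
    have kernel: "\<forall>\<beta>\<in>B0 r p k. h \<beta> = 0" if Qh: "\<And>i. i \<in> {1..r} \<Longrightarrow> q x i 0 * Q h i = 0" for h
    proof -
      have "(\<Sum>\<beta>\<in>B0 r p k. A_mat m (Fh x) \<gamma> \<beta> * h \<beta>) = 0" if "\<gamma> \<in> O'" for \<gamma>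
      proof -
        have "\<gamma> \<in> J2 m n p k" using that O_set_iff[OF f] unfolding O'_def by blast
        then have "(\<Sum>\<beta>\<in>B0 r p k. A_mat m (Fh x) \<gamma> \<beta> * h \<beta>) = (\<Sum>i=1..r. q x i 0 * Q h i * mono_eval \<gamma> (q x i))"
          unfolding Q_def by (rule A_mat_powers_action)
        also have "\<dots> = 0" by (rule sum.neutral, rule ballI) (simp only: Qh mult_zero_left)
        finally show ?thesis .
      qed
      then show ?thesis using elim by blast
    qed
    \<comment> \<open>One of the \<open>r\<close> linear forms \<open>Q _ i\<close> on a space of dimension \<open>r\<close> cannot be omitted.\<close>
    have drop: "\<exists>h. (\<forall>j\<in>{1..r}. j \<noteq> i \<longrightarrow> Q h j = 0) \<and> q x i 0 * Q h i \<noteq> 0" if i: "i \<in> {1..r}" for i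
    proof -
      have "card ({1..r} - {i}) < card (B0 r p k)" using i card_B0 r_pos by simp
      then obtain h where h: "\<exists>\<beta>\<in>B0 r p k. h \<beta> \<noteq> 0" "\<forall>j\<in>{1..r} - {i}. Q h j = 0"
        using underdetermined_system[of "{1..r} - {i}" "B0 r p k" "\<lambda>i \<beta>. mono_eval \<beta> (q x i)"] finite_B0
        unfolding Q_def by auto
      have "q x i 0 * Q h i \<noteq> 0"
      proof
        assume "q x i 0 * Q h i = 0"
        then have "q x j 0 * Q h j = 0" if "j \<in> {1..r}" for j using h(2) that by (cases "j = i") auto
        from kernel[OF this] h(1) show False by blast
      qed
      with h(2) show ?thesis by blast
    qed
    have "\<forall>i\<in>{1..r}. q x i 0 \<noteq> 0" using drop by fastforce
    moreover have "lin_indep r (B0 r p k) (\<lambda>i f. mono_eval f (q x i))"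
      unfolding lin_indep_def
    proof (intro allI impI ballI)
      fix d i assume d: "\<forall>\<beta>\<in>B0 r p k. (\<Sum>i=1..r. d i * mono_eval \<beta> (q x i)) = 0" and i: "i \<in> {1..r}"
      obtain h where h: "\<forall>j\<in>{1..r}. j \<noteq> i \<longrightarrow> Q h j = 0" "Q h i \<noteq> 0" using drop[OF i] by auto
      have "(\<Sum>j=1..r. d j * Q h j) = (\<Sum>\<beta>\<in>B0 r p k. (\<Sum>j=1..r. d j * mono_eval \<beta> (q x j)) * h \<beta>)"
        unfolding Q_def sum_distrib_left sum_distrib_right by (subst sum.swap) (simp add: mult.assoc)
      also have "\<dots> = 0" using d by simp
      also have "(\<Sum>j=1..r. d j * Q h j) = (\<Sum>j=1..r. if j = i then d i * Q h i else 0)"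
        using h(1) by (intro sum.cong refl) auto
      finally show "d i = 0" using i h(2) by simp
    qed
    moreover have "\<forall>h. (\<forall>i\<in>{1..r}. (\<Sum>\<beta>\<in>B0 r p k. mono_eval \<beta> (q x i) * h \<beta>) = 0) \<longrightarrow> (\<forall>\<beta>\<in>B0 r p k. h \<beta> = 0)"
      using kernel unfolding Q_def by simp
    ultimately show ?case unfolding nondegenerate_powers_def by blast
  qed
qed

lemma interpolating_matrix_exists:
  assumes nd: "nondegenerate_powers r p k (q x)"
  shows "\<exists>G. interpolates r p k (q x) G"
proof -
  have "\<exists>L. \<forall>\<beta>\<in>B0 r p k. \<forall>\<beta>'\<in>B0 r p k. (\<Sum>i=1..r. L \<beta> i * mono_eval \<beta>' (q x i)) = (if \<beta> = \<beta>' then 1 else 0)"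
    by (rule left_inverse_of_injective) (use nd finite_B0 in \<open>auto simp: nondegenerate_powers_def\<close>)
  then obtain L where L: "\<And>\<beta> \<beta>'. \<beta> \<in> B0 r p k \<Longrightarrow> \<beta>' \<in> B0 r p k \<Longrightarrow>
      (\<Sum>i=1..r. L \<beta> i * mono_eval \<beta>' (q x i)) = (if \<beta> = \<beta>' then 1 else 0)" by blast
  have LR: "(\<Sum>\<beta>\<in>B0 r p k. mono_eval \<beta> (q x i) * L \<beta> i') = (if i = i' then 1 else 0)"
    if "i \<in> {1..r}" "i' \<in> {1..r}" for i i'
    by (rule right_inverse_of_square[OF finite_atLeastAtMost finite_B0 _ L that]) (simp_all add: card_B0)
  define G where "G \<beta> \<alpha> = (\<Sum>i=1..r. L \<beta> i * (mono_eval \<alpha> (q x i) / q x i 0))" for \<beta> \<alpha>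
  have "(\<Sum>\<beta>\<in>B0 r p k. mono_eval \<beta> (q x i) * G \<beta> \<alpha>) = mono_eval \<alpha> (q x i) / q x i 0" if i: "i \<in> {1..r}" for \<alpha> i
  proof -
    have "(\<Sum>\<beta>\<in>B0 r p k. mono_eval \<beta> (q x i) * G \<beta> \<alpha>)
       = (\<Sum>i'=1..r. (\<Sum>\<beta>\<in>B0 r p k. mono_eval \<beta> (q x i) * L \<beta> i') * (mono_eval \<alpha> (q x i') / q x i' 0))"
      unfolding G_def sum_distrib_left sum_distrib_right by (subst sum.swap) (simp add: mult.assoc)
    also have "\<dots> = (\<Sum>i'=1..r. if i = i' then mono_eval \<alpha> (q x i') / q x i' 0 else 0)"
      using LR[OF i] by (intro sum.cong refl) simp
    finally show ?thesis using i by simp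
  qed
  then show ?thesis unfolding interpolates_def by blast
qed

lemma step1_of_interpolation:
  assumes nd: "nondegenerate_powers r p k (q x)"
    and G: "interpolates r p k (q x) G"
  shows "step1 m n r p k (Fh x) G"
  unfolding step1_def
proof (intro ballI minimizer_of_zero_residual)
  fix \<alpha> \<gamma> assume \<alpha>: "\<alpha> \<in> B1 n p k" and \<gamma>: "\<gamma> \<in> O_set m n p k \<alpha>"
  obtain f l where fl: "f \<in> J1 p k" "l \<in> {k+1..n}" "\<alpha> = f + {#l#}" using \<alpha> B1_iff by blast
  have \<gamma>J: "\<gamma> \<in> J2 m n p k" using \<gamma> O_set_iff[OF fl(1)] fl(3) by blast
  have "m - size (\<alpha> + \<gamma>) = 0" using fl(1,3) \<gamma>J by (simp add: J1_iff J2_iff)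
  then have b: "b_vec m (Fh x) \<alpha> \<gamma> = (\<Sum>i=1..r. mono_eval \<alpha> (q x i) * mono_eval \<gamma> (q x i))"
    by (simp add: b_vec_def entry_powers mono_eval_add)
  have "(\<Sum>\<beta>\<in>B0 r p k. A_mat m (Fh x) \<gamma> \<beta> * G \<beta> \<alpha>)
      = (\<Sum>i=1..r. q x i 0 * (mono_eval \<alpha> (q x i) / q x i 0) * mono_eval \<gamma> (q x i))"
    unfolding A_mat_powers_action[OF \<gamma>J] using G[unfolded interpolates_def] by (intro sum.cong refl) simp
  also have "\<dots> = b_vec m (Fh x) \<alpha> \<gamma>"
    unfolding b using nd by (intro sum.cong refl) (simp add: nondegenerate_powers_def)
  finally show "residual m r p k (Fh x) \<alpha> (\<lambda>\<beta>. G \<beta> \<alpha>) \<gamma> = 0" by (simp add: residual_def)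
qed

text \<open>The normalized vectors of values at the \<open>q i\<close> are eigenvectors, so they are an admissible choice
  in Step 2.\<close>

lemma step2_of_interpolation:
  assumes nd: "nondegenerate_powers r p k (q x)"
    and G: "interpolates r p k (q x) G"
  shows "step2 n r p k \<xi> G (\<lambda>i t. q x i (k + t) / q x i 0)"
proof -
  have indep: "lin_indep r (B0 r p k) (\<lambda>i f. mono_eval f (q x i))"
    using nd unfolding nondegenerate_powers_def by blast
  define B where "B = B0 r p k"
  have finB: "finite B" by (simp add: B_def finite_B0)
  define N where "N i = frob_norm B (\<lambda>\<nu>. mono_eval \<nu> (q x i))" for i
  have nz: "\<exists>\<nu>\<in>B. mono_eval \<nu> (q x i) \<noteq> 0" if "i \<in> {1..r}" for i
    unfolding B_def by (rule lin_indep_imp_nonzero[OF indep that])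
  have N: "N i > 0" if i: "i \<in> {1..r}" for i
  proof -
    obtain \<nu> where "\<nu> \<in> B" "mono_eval \<nu> (q x i) \<noteq> 0" using nz[OF i] by blast
    then have "0 < norm (mono_eval \<nu> (q x i))" "norm (mono_eval \<nu> (q x i)) \<le> N i"
      unfolding N_def frob_norm_def by (auto intro: member_le_L2_set[OF finB, where f = "\<lambda>\<nu>. norm (mono_eval \<nu> (q x i))"])
    then show ?thesis by linarith
  qed
  define z where "z i \<nu> = mono_eval \<nu> (q x i) * complex_of_real (1 / N i)" for i \<nu>
  have Nl: "(\<Sum>\<beta>\<in>B. N_l G l \<nu> \<beta> * z i \<beta>) = q x i l / q x i 0 * z i \<nu>" if i: "i \<in> {1..r}" for i l \<nu>
  proof -
    have "(\<Sum>\<beta>\<in>B. N_l G l \<nu> \<beta> * z i \<beta>) = (\<Sum>\<beta>\<in>B. mono_eval \<beta> (q x i) * G \<beta> (\<nu> + {#l#})) * complex_of_real (1 / N i)"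
      unfolding N_l_def z_def sum_distrib_right by (intro sum.cong refl) (simp only: ac_simps)
    also have "\<dots> = mono_eval (\<nu> + {#l#}) (q x i) / q x i 0 * complex_of_real (1 / N i)"
      using G i unfolding B_def interpolates_def by (simp only:)
    finally show ?thesis by (simp add: z_def mono_eval_def)
  qed
  have norm1: "frob_norm B (z i) = 1" if i: "i \<in> {1..r}" for i
  proof -
    have "frob_norm B (z i) = L2_set (\<lambda>\<nu>. norm (mono_eval \<nu> (q x i)) * (1 / N i)) B"
      unfolding frob_norm_def z_def using N[OF i] by (intro L2_set_cong refl) (simp add: norm_mult norm_divide)
    also have "\<dots> = N i * (1 / N i)"
      unfolding N_def frob_norm_def by (rule L2_set_left_distrib[symmetric]) simp
    finally show ?thesis using N[OF i] by simp
  qed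
  have zz: "(\<Sum>\<nu>\<in>B. cnj (z i \<nu>) * z i \<nu>) = 1" if "i \<in> {1..r}" for i
    by (rule sum_cnj_mult_self[OF norm1[OF that]])
  have "eigenpair B (N_xi n k \<xi> G) (\<Sum>l=k+1..n. \<xi> l * (q x i l / q x i 0)) (z i)" if i: "i \<in> {1..r}" for i
    unfolding eigenpair_def
  proof (intro conjI ballI)
    show "\<exists>\<nu>\<in>B. z i \<nu> \<noteq> 0" using nz[OF i] N[OF i] by (auto simp: z_def)
    fix \<nu>
    have "(\<Sum>\<beta>\<in>B. N_xi n k \<xi> G \<nu> \<beta> * z i \<beta>) = (\<Sum>l=k+1..n. \<xi> l * (\<Sum>\<beta>\<in>B. N_l G l \<nu> \<beta> * z i \<beta>))"
      unfolding N_xi_def sum_distrib_right sum_distrib_left by (subst sum.swap) (simp add: mult.assoc)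
    then show "(\<Sum>\<beta>\<in>B. N_xi n k \<xi> G \<nu> \<beta> * z i \<beta>) = (\<Sum>l=k+1..n. \<xi> l * (q x i l / q x i 0)) * z i \<nu>"
      unfolding Nl[OF i] sum_distrib_right by (simp add: mult.assoc)
  qed
  moreover have "lin_indep r B z"
    unfolding lin_indep_def
  proof (intro allI impI ballI)
    fix d i assume d: "\<forall>\<nu>\<in>B. (\<Sum>i=1..r. d i * z i \<nu>) = 0" and i: "i \<in> {1..r}"
    have "(\<Sum>i=1..r. d i * complex_of_real (1 / N i) * mono_eval \<nu> (q x i)) = 0" if "\<nu> \<in> B" for \<nu>
      using d that by (simp add: z_def ac_simps)
    then have "d i * complex_of_real (1 / N i) = 0"
      using indep[unfolded lin_indep_def, rule_format, of "\<lambda>i. d i * complex_of_real (1 / N i)" i] i B_def by blast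
    then show "d i = 0" using N[OF i] by simp
  qed
  moreover have "q x i (k + t) / q x i 0 = herm_form B (N_l G (k + t)) (z i)" if i: "i \<in> {1..r}" for i t
  proof -
    have "herm_form B (N_l G (k + t)) (z i) = (\<Sum>\<nu>\<in>B. cnj (z i \<nu>) * (\<Sum>\<beta>\<in>B. N_l G (k + t) \<nu> \<beta> * z i \<beta>))"
      by (simp add: herm_form_def sum_distrib_left mult.assoc)
    also have "\<dots> = q x i (k + t) / q x i 0 * (\<Sum>\<nu>\<in>B. cnj (z i \<nu>) * z i \<nu>)"
      unfolding Nl[OF i] sum_distrib_left by (intro sum.cong refl) (simp only: ac_simps)
    finally show ?thesis unfolding zz[OF i] by simp
  qed
  ultimately show ?thesis unfolding step2_def B_def[symmetric] using norm1 by blast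
qed

text \<open>The number \<open>c i * mono_eval f (u i)\<close> is determined by \<open>F\<close> for \<open>f\<close> of degree \<open>p\<close> in the first \<open>k\<close>
  variables, and also for \<open>f\<close> of degree \<open>p - 1\<close>. The coordinate \<open>u i j\<close> with \<open>j \<le> k\<close> is the quotient
  for \<open>f + {#j#}\<close> and \<open>f\<close>, where \<open>f\<close> is chosen without \<open>x_j\<close> and with a nonzero value at \<open>u i\<close>.\<close>

lemma powers_near:
  assumes q0: "\<forall>\<^sub>F x in \<Phi>. \<forall>i\<in>{1..r}. q x i 0 \<noteq> 0"
    and w: "\<And>i t. i \<in> {1..r} \<Longrightarrow> t \<in> {1..n-k} \<Longrightarrow> near \<Phi> e (\<lambda>x. q x i (k + t) / q x i 0) (u i (k + t))"
    and i: "i \<in> {1..r}"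
  shows "near \<Phi> e (\<lambda>x. q x i 0 ^ m) (c i)" "\<And>j. j \<in> {0..n} \<Longrightarrow> near \<Phi> e (\<lambda>x. q x i j / q x i 0) (u i j)"
proof -
  define U where "U x i j = q x i j / q x i 0" for x i j
  define a where "a x i = q x i 0 ^ m" for x i
  have qU: "q x i = (\<lambda>j. q x i 0 * U x i j)" if "q x i 0 \<noteq> 0" for x i
    using that by (auto simp: U_def)
  have Ul: "near \<Phi> e (\<lambda>x. U x i l) (u i l)" if "i \<in> {1..r}" "l \<in> {k+1..n}" for i l
  proof -
    have "l - k \<in> {1..n-k}" "k + (l - k) = l" using that(2) by auto
    then show ?thesis using w[OF that(1), of "l - k"] unfolding U_def by simp
  qed
  have entry_U: "\<forall>\<^sub>F x in \<Phi>. entry m (Fh x) f = (\<Sum>i=1..r. a x i * mono_eval f (U x i))" if f: "size f \<le> m" for f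
    using q0
  proof eventually_elim
    case (elim x)
    have "q x i 0 ^ (m - size f) * mono_eval f (q x i) = a x i * mono_eval f (U x i)" if "i \<in> {1..r}" for i
    proof -
      have "mono_eval f (q x i) = q x i 0 ^ size f * mono_eval f (U x i)"
      proof -
        have "mono_eval f (q x i) = mono_eval f (\<lambda>j. q x i 0 * U x i j)"
          using qU elim that by (intro arg_cong[where f = "mono_eval f"]) blast
        then show ?thesis by (simp only: mono_eval_scale)
      qed
      then show ?thesis using f by (simp add: a_def flip: power_add mult.assoc)
    qed
    then show ?case unfolding entry_powers by (intro sum.cong) auto
  qed
  have gU: "near \<Phi> e (\<lambda>x. mono_eval g (U x i)) (mono_eval g (u i))" if "g \<in> J2 m n p k" "i \<in> {1..r}" for g i
    using that by (intro mono_eval_near Ul) (auto simp: J2_iff subset_iff)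
  have J1_near: "near \<Phi> e (\<lambda>x. a x i * mono_eval f (U x i)) (c i * mono_eval f (u i))"
    if f: "f \<in> J1 p k" and i: "i \<in> {1..r}" for f i
  proof (rule J2_system_near[where M = "\<lambda>x g i. mono_eval g (U x i)" and h = "\<lambda>x i. a x i * mono_eval f (U x i)"
        and ?h0.0 = "\<lambda>i. c i * mono_eval f (u i)"])
    fix g assume g: "g \<in> J2 m n p k"
    have Om: "Omega_monomial m n (f + g)" by (rule Omega_J1_J2[OF f g])
    show "near \<Phi> e (\<lambda>x. \<Sum>i=1..r. mono_eval g (U x i) * (a x i * mono_eval f (U x i)))
       (\<Sum>i=1..r. mono_eval g (u i) * (c i * mono_eval f (u i)))"
    proof (rule near_cong)
      show "near \<Phi> e (\<lambda>x. entry m (Fh x) (f + g)) (\<Sum>i=1..r. mono_eval g (u i) * (c i * mono_eval f (u i)))"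
        using entry_near[OF Om] unfolding entry_eq[OF Om] by (simp only: mono_eval_add ac_simps)
      show "\<forall>\<^sub>F x in \<Phi>. entry m (Fh x) (f + g) = (\<Sum>i=1..r. mono_eval g (U x i) * (a x i * mono_eval f (U x i)))"
        using entry_U[of "f + g"] Om unfolding Omega_monomial_def by (simp only: mono_eval_add ac_simps)
    qed
  qed (use gU i in auto)
  \<comment> \<open>A factor \<open>x_l\<close> with \<open>l > k\<close> makes the entries labelled by monomials of degree \<open>p - 1\<close> in the first
    \<open>k\<close> variables accessible.\<close>
  have low_near: "near \<Phi> e (\<lambda>x. a x i * mono_eval f (U x i)) (c i * mono_eval f (u i))"
    if f: "set_mset f \<subseteq> {1..k}" "size f = p - 1" "\<And>j. count f j \<le> 1" and i: "i \<in> {1..r}" for f i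
  proof -
    have "lin_indep r (J2 m n p k) (\<lambda>i f. mono_eval f (u i))"
      unfolding lin_indep_def using indep_J2 by blast
    from lin_indep_imp_nonzero[OF this i] obtain g where g: "g \<in> J2 m n p k" "mono_eval g (u i) \<noteq> 0"
      by blast
    have "size g \<noteq> 0" using g(1) p_m by (simp add: J2_iff)
    then obtain l where l: "l \<in># g" by fastforce
    have lk: "l \<in> {k+1..n}" using l g(1) unfolding J2_iff by blast
    have ul: "u i l \<noteq> 0"
    proof
      assume "u i l = 0"
      then have "mono_eval g (u i) = 0" using l by (force simp: mono_eval_def)
      then show False using g(2) by simp
    qed
    obtain f0 where f0: "f0 \<in> J1 p k" using J1_nonempty by blast
    define O' where "O' = O_set m n p k (f0 + {#l#})"
    have O': "g \<in> J2 m n p k" "l \<notin># g" if "g \<in> O'" for g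
      using that O_set_iff[OF f0] unfolding O'_def by blast+
    have Om: "Omega_monomial m n (f + (g + {#l#}))" if "g \<in> O'" for g
    proof (rule Omega_monomial_add)
      show "count (g + {#l#}) j \<le> 1" for j
        using O'[OF that] by (intro count_add_le_1) (auto simp: J2_iff)
    qed (use f O'[OF that] lk p_m p_pos k_less_n in \<open>(fastforce simp: J2_iff)+\<close>)
    have "near \<Phi> e (\<lambda>x. a x i * mono_eval f (U x i) * U x i l) (c i * mono_eval f (u i) * u i l)"
    proof (rule near_solution[where Ah = "\<lambda>x g i. mono_eval g (U x i)" and A = "\<lambda>g i. mono_eval g (u i)"
          and T = "{1..r}" and S = O' and h = "\<lambda>x i. a x i * mono_eval f (U x i) * U x i l"
          and ?h0.0 = "\<lambda>i. c i * mono_eval f (u i) * u i l"])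
      show "near \<Phi> e (\<lambda>x. mono_eval g (U x i)) (mono_eval g (u i))" if "g \<in> O'" "i \<in> {1..r}" for g i
        by (rule gU[OF O'(1)[OF that(1)] that(2)])
      show "\<forall>i\<in>{1..r}. d i = 0" if 0: "\<forall>g\<in>O'. (\<Sum>i=1..r. mono_eval g (u i) * d i) = 0" for d
      proof
        fix i assume i: "i \<in> {1..r}"
        have "(\<Sum>i=1..r. d i * mono_eval g (u i)) = 0" if "g \<in> O_set m n p k (f0 + {#l#})" for g
          using 0 that by (simp add: mult.commute O'_def)
        from indep_O_set[OF f0 lk this i] show "d i = 0" by simp
      qed
      fix g assume g: "g \<in> O'"
      show "near \<Phi> e (\<lambda>x. \<Sum>i=1..r. mono_eval g (U x i) * (a x i * mono_eval f (U x i) * U x i l))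
         (\<Sum>i=1..r. mono_eval g (u i) * (c i * mono_eval f (u i) * u i l))"
      proof (rule near_cong)
        show "near \<Phi> e (\<lambda>x. entry m (Fh x) (f + (g + {#l#}))) (\<Sum>i=1..r. mono_eval g (u i) * (c i * mono_eval f (u i) * u i l))"
          using entry_near[OF Om[OF g]] unfolding entry_eq[OF Om[OF g]]
          by (simp only: mono_eval_add mono_eval_single ac_simps)
        show "\<forall>\<^sub>F x in \<Phi>. entry m (Fh x) (f + (g + {#l#}))
            = (\<Sum>i=1..r. mono_eval g (U x i) * (a x i * mono_eval f (U x i) * U x i l))"
          using entry_U[of "f + (g + {#l#})"] Om[OF g] unfolding Omega_monomial_def
          by (simp only: mono_eval_add mono_eval_single ac_simps)
      qed
    qed (use i in \<open>simp_all add: O'_def finite_O_set\<close>)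
    from near_divide[OF this Ul[OF i lk] ul]
    have "near \<Phi> e (\<lambda>x. a x i * mono_eval f (U x i) * U x i l / U x i l) (c i * mono_eval f (u i))"
      using ul by simp
    moreover have "\<forall>\<^sub>F x in \<Phi>. a x i * mono_eval f (U x i) * U x i l / U x i l = a x i * mono_eval f (U x i)"
      using near_eventually_nonzero[OF Ul[OF i lk] ul] by eventually_elim simp
    ultimately show ?thesis by (rule near_cong[rotated])
  qed
  have U_low: "near \<Phi> e (\<lambda>x. U x i j) (u i j)" if i: "i \<in> {1..r}" and j: "j \<in> {1..k}" for i j
  proof -
    obtain f0 where f0: "f0 \<in> B0 r p k" "mono_eval f0 (u i) \<noteq> 0" using exists_nonzero_B0[OF i] by blast
    have f0J: "set_mset f0 \<subseteq> {1..k}" "size f0 = p" "\<And>j. count f0 j \<le> 1"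
      using f0(1) B0_subset_J1 J1_iff by blast+
    \<comment> \<open>Removing \<open>x_j\<close>, or any variable if \<open>x_j\<close> does not occur, leaves a monomial of degree \<open>p - 1\<close>
      without \<open>x_j\<close> and with a nonzero value.\<close>
    obtain s where s: "s \<in># f0" "j \<in># f0 \<Longrightarrow> s = j"
    proof (cases "j \<in># f0")
      case False
      have "f0 \<noteq> {#}" using f0J(2) p_pos by auto
      then obtain s where "s \<in># f0" by blast
      then show ?thesis using that False by blast
    qed (use that in blast)
    define f where "f = f0 - {#s#}"
    have f0f: "f0 = f + {#s#}" using s(1) by (simp add: f_def)
    have fs: "set_mset f \<subseteq> {1..k}" "size f = p - 1"
      using f0J(1,2) unfolding f0f by auto
    have fc: "count f j \<le> 1" for j
      using f0J(3)[of j] unfolding f0f count_union by linarith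
    note fs = fs fc
    have jf: "j \<notin># f"
    proof
      assume "j \<in># f"
      then have "j \<in># f0" unfolding f0f by simp
      then have "s = j" by (rule s(2))
      then have "count f0 j = Suc (count f j)" unfolding f0f by simp
      moreover have "count f j > 0" using \<open>j \<in># f\<close> by simp
      ultimately show False using f0J(3)[of j] by linarith
    qed
    have fu: "mono_eval f (u i) \<noteq> 0" using f0(2) unfolding f0f mono_eval_add by simp
    have "f + {#j#} \<in> J1 p k"
      unfolding J1_iff
    proof (intro conjI allI)
      show "count (f + {#j#}) j' \<le> 1" for j'
        using fs(3) jf by (intro count_add_le_1) auto
    qed (use fs j p_pos in auto)
    from near_divide[OF J1_near[OF this i] low_near[OF fs i]]
    have quotient: "near \<Phi> e (\<lambda>x. (a x i * mono_eval (f + {#j#}) (U x i)) / (a x i * mono_eval f (U x i)))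
       (c i * mono_eval (f + {#j#}) (u i) / (c i * mono_eval f (u i)))" using fu c_nz[OF i] by simp
    have val: "c i * mono_eval (f + {#j#}) (u i) / (c i * mono_eval f (u i)) = u i j"
      using fu c_nz[OF i] unfolding mono_eval_add mono_eval_single by simp
    have "\<forall>\<^sub>F x in \<Phi>. a x i * mono_eval f (U x i) \<noteq> 0"
      using near_eventually_nonzero[OF low_near[OF fs i]] fu c_nz[OF i] by simp
    then have "\<forall>\<^sub>F x in \<Phi>. (a x i * mono_eval (f + {#j#}) (U x i)) / (a x i * mono_eval f (U x i)) = U x i j"
      by eventually_elim (simp add: mono_eval_def)
    from near_cong[OF this] quotient show ?thesis unfolding val by blast
  qed
  have U0: "near \<Phi> e (\<lambda>x. U x i 0) (u i 0)" if i: "i \<in> {1..r}" for i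
  proof (rule near_cong)
    show "near \<Phi> e (\<lambda>_. 1) (u i 0)" by (simp only: u0[OF i] near_const)
    show "\<forall>\<^sub>F x in \<Phi>. 1 = U x i 0" using q0 by eventually_elim (use i in \<open>simp add: U_def\<close>)
  qed
  have U: "near \<Phi> e (\<lambda>x. U x i j) (u i j)" if i: "i \<in> {1..r}" and j: "j \<in> {0..n}" for i j
  proof -
    consider "j = 0" | "j \<in> {1..k}" | "j \<in> {k+1..n}" using j by fastforce
    then show ?thesis using U0[OF i] U_low[OF i] Ul[OF i] by cases auto
  qed
  show "near \<Phi> e (\<lambda>x. q x i j / q x i 0) (u i j)" if "j \<in> {0..n}" for j
    using U[OF i that] unfolding U_def .
  have "near \<Phi> e (\<lambda>x. a x i) (c i)"
  proof (rule coefficients_near[OF U _ i])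
    fix I assume I: "I \<in> Omega_set m n"
    show "near \<Phi> e (\<lambda>x. \<Sum>i=1..r. a x i * tensor_power (U x i) I) (F I)"
    proof (rule near_cong[OF _ Fh_near[OF I]])
      show "\<forall>\<^sub>F x in \<Phi>. Fh x I = (\<Sum>i=1..r. a x i * tensor_power (U x i) I)"
        using q0
      proof eventually_elim
        case (elim x)
        have len: "length I = m" using I by (simp add: Omega_set_def index_tuples_def)
        have "tensor_power (q x i) I = a x i * tensor_power (U x i) I" if "i \<in> {1..r}" for i
        proof -
          have "tensor_power (q x i) I = tensor_power (\<lambda>j. q x i 0 * U x i j) I"
            using qU elim that by (intro arg_cong[where f = "\<lambda>v. tensor_power v I"]) blast
          then show ?thesis by (simp only: tensor_power_scale a_def len)
        qed
        then show ?case unfolding Fq by (intro sum.cong) auto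
      qed
    qed
  qed
  then show "near \<Phi> e (\<lambda>x. q x i 0 ^ m) (c i)" unfolding a_def .
qed

end
end

section \<open>Error bounds\<close>

lemma frob_norm_nonneg: "0 \<le> frob_norm S f"
  unfolding frob_norm_def by (rule L2_set_nonneg)

lemma norm_le_frob_norm: "finite S \<Longrightarrow> s \<in> S \<Longrightarrow> norm (f s) \<le> frob_norm S f"
  unfolding frob_norm_def by (rule member_le_L2_set)

type_synonym input_and_result = "tensor \<times> (nat \<Rightarrow> nat \<Rightarrow> complex)"

lemma tensor_error_near:
  assumes I: "I \<in> Omega_set m n"
  shows "near \<Phi> (\<lambda>x. frob_norm (Omega_set m n) (\<lambda>I. Fh x I - F I)) (\<lambda>x. Fh x I) (F I)"
proof -
  have "norm (Fh x I - F I) \<le> 1 * frob_norm (Omega_set m n) (\<lambda>I. Fh x I - F I)" for x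
    using norm_le_frob_norm[OF finite_Omega_set I, of "\<lambda>I. Fh x I - F I"] by simp
  then show ?thesis unfolding near_def small_def by (intro exI[of _ 1] always_eventually allI)
qed

text \<open>The eigenvectors of Step 2 determine a labelling of the exact data. Where it is a fixed
  permutation \<open>s\<close>, the exact data relabelled by \<open>s\<close> are again a decomposition, whose eigenvalues
  are aligned with \<open>w\<close>. Only the later steps, which enter through \<open>aligned\<close>, depend on
  how the vectors \<open>q'\<close> were obtained.\<close>

lemma (in perturbed_decomposition) close_by_relabelling:
  assumes G0: "solves_linear_systems m n r p k F G0"
    and dist: "distinct_eigenvalues (B0 r p k) (N_xi n k \<xi> G0)"
    and step1: "\<forall>\<^sub>F x in \<Phi>. step1 m n r p k (Fh x) (G x)"
    and step2: "\<forall>\<^sub>F x in \<Phi>. step2 n r p k \<xi> (G x) (w x)"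
    and aligned: "\<And>s \<Psi>. s permutes {1..r} \<Longrightarrow> \<Psi> \<le> \<Phi> \<Longrightarrow>
       perturbed_decomposition m n r p k F (c \<circ> s) (u \<circ> s) \<Psi> e Fh \<Longrightarrow>
       (\<And>i t. i \<in> {1..r} \<Longrightarrow> t \<in> {1..n-k} \<Longrightarrow> near \<Psi> e (\<lambda>x. w x i t) ((u \<circ> s) i (k + t))) \<Longrightarrow>
       \<forall>i\<in>{1..r}. near \<Psi> e (\<lambda>x. q' x i 0 ^ m) ((c \<circ> s) i) \<and>
         (\<forall>j\<in>{0..n}. near \<Psi> e (\<lambda>x. U x i j) ((u \<circ> s) i j))"
    and q': "\<forall>\<^sub>F x in \<Phi>. \<forall>i\<in>{1..r}. \<forall>j\<in>{0..n}. q' x i j = q' x i 0 * U x i j"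
    and q_lead: "\<And>i. i \<in> {1..r} \<Longrightarrow> q i 0 ^ m = c i"
    and q: "\<And>i j. i \<in> {1..r} \<Longrightarrow> j \<in> {0..n} \<Longrightarrow> q i j = q i 0 * u i j"
  shows "\<exists>C. \<forall>\<^sub>F x in \<Phi>. close_up_to m n r (C * e x) (q' x) q"
proof -
  have m0: "m > 0" using p_m by simp
  have q0: "q i 0 \<noteq> 0" if "i \<in> {1..r}" for i
    using q_lead[OF that] c_nz[OF that] m0 by (metis power_0_left not_gr0)
  obtain \<sigma> where \<sigma>: "\<forall>\<^sub>F x in \<Phi>. \<sigma> x permutes {1..r}"
    and w_near: "\<And>s i t. i \<in> {1..r} \<Longrightarrow> t \<in> {1..n-k} \<Longrightarrow>
       near (inf \<Phi> (principal {x. \<sigma> x = s})) e (\<lambda>x. w x i t) (u (s i) (k + t))"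
    using step2_near[OF step1_near[OF step1 G0] G0 dist step2] by blast
  show ?thesis
  proof (rule bound_by_cases[where \<sigma> = \<sigma> and S = "{s. s permutes {1..r}}" and P = "\<lambda>d x. close_up_to m n r d (q' x) q"])
    show "finite {s. s permutes {1..r}}" by (simp add: finite_permutations)
    show "\<forall>\<^sub>F x in \<Phi>. \<sigma> x \<in> {s. s permutes {1..r}}" using \<sigma> by simp
    show "close_up_to m n r d' (q' x) q" if "d \<le> d'" "close_up_to m n r d (q' x) q" for d d' x
      using that by (rule close_up_to_mono)
    fix s assume "s \<in> {s. s permutes {1..r}}"
    then have s: "s permutes {1..r}" by simp
    have si: "s i \<in> {1..r}" if "i \<in> {1..r}" for i using permutes_in_image[OF s] that by blast
    define \<Psi> where "\<Psi> = inf \<Phi> (principal {x. \<sigma> x = s})"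
    have le: "\<Psi> \<le> \<Phi>" by (simp add: \<Psi>_def)
    interpret exact_s: exact_decomposition m n r p k F "c \<circ> s" "u \<circ> s" by (rule permuted[OF s])
    interpret sub: vanishing \<Psi> e unfolding \<Psi>_def by (rule restricted)
    have "perturbed_decomposition m n r p k F (c \<circ> s) (u \<circ> s) \<Psi> e Fh"
      by unfold_locales (rule near_filter_mono[OF le Fh_near])
    moreover have "near \<Psi> e (\<lambda>x. w x i t) ((u \<circ> s) i (k + t))" if "i \<in> {1..r}" "t \<in> {1..n-k}" for i t
      using w_near[OF that] by (simp add: \<Psi>_def)
    ultimately have al: "\<forall>i\<in>{1..r}. near \<Psi> e (\<lambda>x. q' x i 0 ^ m) ((c \<circ> s) i) \<and>
         (\<forall>j\<in>{0..n}. near \<Psi> e (\<lambda>x. U x i j) ((u \<circ> s) i j))"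
      by (rule aligned[OF s le])
    have "\<exists>C. \<forall>\<^sub>F x in \<Psi>. \<exists>\<eta>. \<forall>i\<in>{1..r}. \<eta> i ^ m = (1::complex) \<and>
           frob_norm {0..n} (\<lambda>j. \<eta> i * q' x i j - (q \<circ> s) i j) \<le> C * e x"
    proof (rule sub.aligned_vectors_close[OF m0, where q' = q' and q = "q \<circ> s" and u = "u \<circ> s" and u' = U])
      show "near \<Psi> e (\<lambda>x. q' x i 0 ^ m) ((q \<circ> s) i 0 ^ m)" if "i \<in> {1..r}" for i
        using al that q_lead[OF si[OF that]] by simp
      show "(q \<circ> s) i 0 \<noteq> 0" if "i \<in> {1..r}" for i using q0[OF si[OF that]] by simp
      show "\<forall>\<^sub>F x in \<Psi>. \<forall>i\<in>{1..r}. \<forall>j\<in>{0..n}. q' x i j = q' x i 0 * U x i j" by (rule filter_leD[OF le q'])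
      show "(q \<circ> s) i j = (q \<circ> s) i 0 * (u \<circ> s) i j" if "i \<in> {1..r}" "j \<in> {0..n}" for i j
        using q[OF si[OF that(1)] that(2)] unfolding o_def .
      show "near \<Psi> e (\<lambda>x. U x i j) ((u \<circ> s) i j)" if "i \<in> {1..r}" "j \<in> {0..n}" for i j
        using al that by blast
    qed
    then obtain C where "\<forall>\<^sub>F x in \<Psi>. \<exists>\<eta>. \<forall>i\<in>{1..r}. \<eta> i ^ m = (1::complex) \<and>
           frob_norm {0..n} (\<lambda>j. \<eta> i * q' x i j - q (s i) j) \<le> C * e x" unfolding o_def by blast
    then have "\<forall>\<^sub>F x in \<Psi>. close_up_to m n r (C * e x) (q' x) q"
      by eventually_elim (use s in \<open>unfold close_up_to_def, blast\<close>)
    then show "\<exists>C. \<forall>\<^sub>F x in inf \<Phi> (principal {x. \<sigma> x = s}). close_up_to m n r (C * e x) (q' x) q"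
      unfolding \<Psi>_def by blast
  qed
qed

context exact_decomposition begin

text \<open>The results of the intermediate steps are chosen as functions of the pair of an input tensor and the
  vectors obtained from it, which makes them functions on one filter.\<close>

lemma intermediate_vectors_close:
  assumes G0: "solves_linear_systems m n r p k F G0"
    and dist: "distinct_eigenvalues (B0 r p k) (N_xi n k \<xi> G0)"
    and nondeg: "step3_nondegenerate r p k u"
    and q_lead: "\<And>i. i \<in> {1..r} \<Longrightarrow> q i 0 ^ m = c i"
    and q: "\<And>i j. i \<in> {1..r} \<Longrightarrow> j \<in> {0..n} \<Longrightarrow> q i j = q i 0 * u i j"
  shows "\<exists>C \<delta> :: real. \<delta> > 0 \<and> (\<forall>Fh qh. intermediate_vectors m n r p k \<xi> Fh qh \<longrightarrow>
      frob_norm (Omega_set m n) (\<lambda>I. Fh I - F I) < \<delta> \<longrightarrow>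
      close_up_to m n r (C * frob_norm (Omega_set m n) (\<lambda>I. Fh I - F I)) qh q)"
proof -
  define Z :: "input_and_result set"
    where "Z = {x. intermediate_vectors m n r p k \<xi> (fst x) (snd x)}"
  define e where "e x = frob_norm (Omega_set m n) (\<lambda>I. fst x I - F I)"
    for x :: input_and_result
  have e0: "0 \<le> e x" for x by (simp add: e_def frob_norm_nonneg)
  define \<Phi> where "\<Phi> = inf (filtercomap e (nhds 0)) (principal Z)"
  interpret vanishing \<Phi> e unfolding \<Phi>_def by (rule vanishing_on_set[OF e0])
  interpret pert: perturbed_decomposition m n r p k F c u \<Phi> e fst
    by unfold_locales (simp add: e_def[abs_def] tensor_error_near)
  have Z: "\<forall>\<^sub>F x in \<Phi>. x \<in> Z"
    unfolding \<Phi>_def eventually_inf_principal by simp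
  have m0: "m > 0" using p_m by simp
  define run where "run x G w \<gamma> v y a \<longleftrightarrow>
     step1 m n r p k (fst x) G \<and> step2 n r p k \<xi> G w \<and>
     step3_gamma m n r p k (fst x) w \<gamma> \<and> step3_v m n r p k (fst x) w \<gamma> v \<and>
     (\<forall>i\<in>{1..r}. \<forall>j\<in>{1..n}. y i j = (if j \<le> k then v i j else w i (j - k))) \<and>
     step3_lambda m n r (fst x) y a \<and>
     (\<forall>i\<in>{1..r}. \<forall>j\<in>{0..n}. snd x i j = a i powr (1 / of_nat m) * prepend_one (y i) j)"
    for x :: input_and_result and G w \<gamma> v y a
  have "\<forall>x. \<exists>G w \<gamma> v y a. x \<in> Z \<longrightarrow> run x G w \<gamma> v y a"
    unfolding Z_def intermediate_vectors_def mem_Collect_eq run_def by blast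
  then obtain G w \<gamma> v y a where "\<And>x. x \<in> Z \<Longrightarrow> run x (G x) (w x) (\<gamma> x) (v x) (y x) (a x)"
    unfolding choice_iff by blast
  note run = this[unfolded run_def]
  have "\<exists>C. \<forall>\<^sub>F x in \<Phi>. close_up_to m n r (C * e x) (snd x) q"
  proof (rule pert.close_by_relabelling[OF G0 dist, where G = G and w = w and U = "\<lambda>x i. prepend_one (y x i)"])
    show "\<forall>\<^sub>F x in \<Phi>. step1 m n r p k (fst x) (G x)" "\<forall>\<^sub>F x in \<Phi>. step2 n r p k \<xi> (G x) (w x)"
      by (rule eventually_mono[OF Z], simp add: run)+
    show "\<forall>\<^sub>F x in \<Phi>. \<forall>i\<in>{1..r}. \<forall>j\<in>{0..n}. snd x i j = snd x i 0 * prepend_one (y x i) j"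
      using Z by eventually_elim (use run in \<open>simp add: prepend_one_def\<close>)
    fix s \<Psi>
    assume s: "s permutes {1..r}" and le: "\<Psi> \<le> \<Phi>"
      and "perturbed_decomposition m n r p k F (c \<circ> s) (u \<circ> s) \<Psi> e fst"
      and w': "\<And>i t. i \<in> {1..r} \<Longrightarrow> t \<in> {1..n-k} \<Longrightarrow> near \<Psi> e (\<lambda>x. w x i t) ((u \<circ> s) i (k + t))"
    then interpret sub: perturbed_decomposition m n r p k F "c \<circ> s" "u \<circ> s" \<Psi> e fst by blast
    have si: "s i \<in> {1..r}" if "i \<in> {1..r}" for i using permutes_in_image[OF s] that by blast
    have Z': "\<forall>\<^sub>F x in \<Psi>. x \<in> Z" by (rule filter_leD[OF le Z])
    have steps: "\<forall>\<^sub>F x in \<Psi>. step3_gamma m n r p k (fst x) (w x) (\<gamma> x)"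
      "\<forall>\<^sub>F x in \<Psi>. step3_v m n r p k (fst x) (w x) (\<gamma> x) (v x)"
      "\<forall>\<^sub>F x in \<Psi>. step3_lambda m n r (fst x) (y x) (a x)"
      by (rule eventually_mono[OF Z'], simp add: run)+
    have \<gamma>': "near \<Psi> e (\<lambda>x. \<gamma> x i f) ((c \<circ> s) i * mono_eval f ((u \<circ> s) i))" if "i \<in> {1..r}" "f \<in> J1 p k" for i f
      by (rule sub.step3_gamma_near[where w = w]) (fact w' steps that)+
    have nondeg': "step3_nondegenerate r p k (u \<circ> s)"
      using nondeg si unfolding step3_nondegenerate_def o_def by blast
    have v': "near \<Psi> e (\<lambda>x. v x i j) ((u \<circ> s) i j)" if "i \<in> {1..r}" "j \<in> {1..k}" for i j
      by (rule sub.step3_v_near[where w = w and \<gamma> = \<gamma>]) (fact w' \<gamma>' steps nondeg' that)+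
    have U: "near \<Psi> e (\<lambda>x. prepend_one (y x i) j) ((u \<circ> s) i j)" if i: "i \<in> {1..r}" and j: "j \<in> {0..n}" for i j
    proof -
      consider "j = 0" | "j \<in> {1..k}" | "j \<in> {k+1..n}" using j by fastforce
      then show ?thesis
      proof cases
        case 1
        then show ?thesis using u0[OF si[OF i]] by (simp add: prepend_one_def near_const)
      next
        case 2
        have "\<forall>\<^sub>F x in \<Psi>. v x i j = prepend_one (y x i) j"
          using Z' by eventually_elim (use run i j 2 in \<open>simp add: prepend_one_def\<close>)
        from near_cong[OF this v'[OF i 2]] show ?thesis .
      next
        case 3
        then have t: "j - k \<in> {1..n-k}" "k + (j - k) = j" by auto
        have "\<forall>\<^sub>F x in \<Psi>. w x i (j - k) = prepend_one (y x i) j"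
          using Z' by eventually_elim (use run i j 3 in \<open>simp add: prepend_one_def\<close>)
        from near_cong[OF this w'[OF i t(1)]] show ?thesis using t(2) by simp
      qed
    qed
    have a': "near \<Psi> e (\<lambda>x. a x i) ((c \<circ> s) i)" if "i \<in> {1..r}" for i
      by (rule sub.step3_lambda_near[where v = y]) (fact U steps that)+
    have "near \<Psi> e (\<lambda>x. snd x i 0 ^ m) ((c \<circ> s) i)" if i: "i \<in> {1..r}" for i
    proof (rule near_cong[OF _ a'[OF i]])
      have "\<forall>\<^sub>F x in \<Psi>. a x i \<noteq> 0" using sub.near_eventually_nonzero[OF a'[OF i] sub.c_nz[OF i]] .
      then show "\<forall>\<^sub>F x in \<Psi>. a x i = snd x i 0 ^ m"
        using Z'
      proof eventually_elim
        case (elim x)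
        have "snd x i 0 = a x i powr (1 / of_nat m)" using run[OF elim(2)] i by (simp add: prepend_one_def)
        then show ?case using elim(1) m0 by (simp add: powr_def exp_of_nat_mult[symmetric])
      qed
    qed
    with U show "\<forall>i\<in>{1..r}. near \<Psi> e (\<lambda>x. snd x i 0 ^ m) ((c \<circ> s) i) \<and>
         (\<forall>j\<in>{0..n}. near \<Psi> e (\<lambda>x. prepend_one (y x i) j) ((u \<circ> s) i j))" by blast
  qed (fact q_lead q)+
  from bound_near_zero[OF e0, where P = "\<lambda>d x. close_up_to m n r d (snd x) q", OF this[unfolded \<Phi>_def]]
  obtain C \<delta> where "\<delta> > 0" "\<forall>x\<in>Z. e x < \<delta> \<longrightarrow> close_up_to m n r (C * e x) (snd x) q" by blast
  then show ?thesis unfolding Z_def e_def by (intro exI[of _ C] exI[of _ \<delta>]) force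
qed

text \<open>The perturbed tensor is \<open>F'\<close>, the sum of the powers of the output vectors, rather than the input.\<close>

lemma output_vectors_close:
  assumes G0: "solves_linear_systems m n r p k F G0"
    and dist: "distinct_eigenvalues (B0 r p k) (N_xi n k \<xi> G0)"
    and q_lead: "\<And>i. i \<in> {1..r} \<Longrightarrow> q i 0 ^ m = c i"
    and q: "\<And>i j. i \<in> {1..r} \<Longrightarrow> j \<in> {0..n} \<Longrightarrow> q i j = q i 0 * u i j"
  shows "\<exists>C \<delta> :: real. \<delta> > 0 \<and> (\<forall>Fh qs. output_vectors m n r Fh qs \<longrightarrow>
      frob_norm (Omega_set m n) (\<lambda>I. Fh I - F I) < \<delta> \<longrightarrow>
      close_up_to m n r (C * frob_norm (Omega_set m n) (\<lambda>I. Fh I - F I)) qs q)"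
proof -
  define Z :: "input_and_result set"
    where "Z = {x. output_vectors m n r (fst x) (snd x)}"
  define e where "e x = frob_norm (Omega_set m n) (\<lambda>I. fst x I - F I)"
    for x :: input_and_result
  define F' where "F' x I = (\<Sum>i=1..r. tensor_power (snd x i) I)"
    for x :: input_and_result and I
  have e0: "0 \<le> e x" for x by (simp add: e_def frob_norm_nonneg)
  define \<Phi> where "\<Phi> = inf (filtercomap e (nhds 0)) (principal Z)"
  interpret vanishing \<Phi> e unfolding \<Phi>_def by (rule vanishing_on_set[OF e0])
  have Z: "\<forall>\<^sub>F x in \<Phi>. x \<in> Z"
    unfolding \<Phi>_def eventually_inf_principal by simp
  have q_power: "(\<Sum>i=1..r. tensor_power (q i) I) = F I" if I: "I \<in> Omega_set m n" for I
  proof -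
    have len: "length I = m" "set I \<subseteq> {0..n}" using I by (auto simp: Omega_set_def index_tuples_def)
    have "tensor_power (q i) I = c i * tensor_power (u i) I" if i: "i \<in> {1..r}" for i
    proof -
      have "tensor_power (q i) I = tensor_power (\<lambda>j. q i 0 * u i j) I"
        unfolding tensor_power_def
        by (intro arg_cong[where f = prod_list] map_cong refl q i) (use len(2) in blast)
      then show ?thesis by (simp only: tensor_power_scale len q_lead[OF i])
    qed
    then show ?thesis unfolding F_eq[OF I] by (intro sum.cong) auto
  qed
  \<comment> \<open>The minimizer is at least as good as the exact decomposition, whose residual is \<open>fst x - F\<close>.\<close>
  have F'_near: "near \<Phi> e (\<lambda>x. F' x I) (F I)" if I: "I \<in> Omega_set m n" for I
  proof -
    define R where "R x q I = fst x I - (\<Sum>i=1..r. tensor_power (q i) I)"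
      for x :: input_and_result and q :: "nat \<Rightarrow> nat \<Rightarrow> complex" and I
    have err: "near \<Phi> e (\<lambda>x. fst x I) (F I)" if "I \<in> Omega_set m n" for I
      unfolding e_def[abs_def] by (rule tensor_error_near[OF that])
    have min: "\<forall>\<^sub>F x in \<Phi>. minimizer (\<lambda>q. (frob_norm (Omega_set m n) (R x q))\<^sup>2) (snd x)"
      by (rule eventually_mono[OF Z]) (simp add: Z_def output_vectors_def R_def[abs_def])
    have "small \<Phi> e (\<lambda>x. R x (snd x) I)"
    proof (rule small_minimizer_residual[OF finite_Omega_set min _ I, where ?g0.0 = q])
      fix I assume I: "I \<in> Omega_set m n"
      show "small \<Phi> e (\<lambda>x. R x q I)"
        unfolding R_def q_power[OF I] using err[OF I] by (simp add: near_def)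
    qed
    from near_add_small[OF err[OF I] small_minus[OF this]] show ?thesis by (simp add: R_def F'_def)
  qed
  interpret pert: perturbed_decomposition m n r p k F c u \<Phi> e F'
    by unfold_locales (rule F'_near)
  have nd: "\<forall>\<^sub>F x in \<Phi>. nondegenerate_powers r p k (snd x)"
    by (rule pert.eventually_powers_nondegenerate[where q = snd, OF F'_def])
  have "\<forall>x :: input_and_result. \<exists>G. nondegenerate_powers r p k (snd x) \<longrightarrow> interpolates r p k (snd x) G"
    by (meson pert.interpolating_matrix_exists[where q = snd, OF F'_def])
  from choice[OF this] obtain G where
    G: "\<And>x :: input_and_result. nondegenerate_powers r p k (snd x) \<Longrightarrow> interpolates r p k (snd x) (G x)" by blast
  define w where "w x i t = snd x i (k + t) / snd x i 0" for x :: input_and_result and i t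
  have step1: "\<forall>\<^sub>F x in \<Phi>. step1 m n r p k (F' x) (G x)"
    by (rule eventually_mono[OF nd pert.step1_of_interpolation[where q = snd, OF F'_def _ G]])
  have step2: "\<forall>\<^sub>F x in \<Phi>. step2 n r p k \<xi> (G x) (w x)"
    unfolding w_def by (rule eventually_mono[OF nd pert.step2_of_interpolation[where q = snd, OF F'_def _ G]])
  have "\<exists>C. \<forall>\<^sub>F x in \<Phi>. close_up_to m n r (C * e x) (snd x) q"
  proof (rule pert.close_by_relabelling[OF G0 dist step1 step2, where U = "\<lambda>x i j. snd x i j / snd x i 0"])
    show "\<forall>\<^sub>F x in \<Phi>. \<forall>i\<in>{1..r}. \<forall>j\<in>{0..n}. snd x i j = snd x i 0 * (snd x i j / snd x i 0)"
      using nd by eventually_elim (simp add: nondegenerate_powers_def)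
    fix s \<Psi>
    assume le: "\<Psi> \<le> \<Phi>" and "perturbed_decomposition m n r p k F (c \<circ> s) (u \<circ> s) \<Psi> e F'"
      and w': "\<And>i t. i \<in> {1..r} \<Longrightarrow> t \<in> {1..n-k} \<Longrightarrow> near \<Psi> e (\<lambda>x. w x i t) ((u \<circ> s) i (k + t))"
    then interpret sub: perturbed_decomposition m n r p k F "c \<circ> s" "u \<circ> s" \<Psi> e F' by blast
    have lead0: "\<forall>\<^sub>F x in \<Psi>. \<forall>i\<in>{1..r}. snd x i 0 \<noteq> 0"
      by (rule eventually_mono[OF filter_leD[OF le nd]]) (simp add: nondegenerate_powers_def)
    show "\<forall>i\<in>{1..r}. near \<Psi> e (\<lambda>x. snd x i 0 ^ m) ((c \<circ> s) i) \<and>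
         (\<forall>j\<in>{0..n}. near \<Psi> e (\<lambda>x. snd x i j / snd x i 0) ((u \<circ> s) i j))"
      using sub.powers_near[where q = snd, OF F'_def lead0 w'[unfolded w_def]] by simp
  qed (fact q_lead q)+
  from bound_near_zero[OF e0, where P = "\<lambda>d x. close_up_to m n r d (snd x) q", OF this[unfolded \<Phi>_def]]
  obtain C \<delta> where "\<delta> > 0" "\<forall>x\<in>Z. e x < \<delta> \<longrightarrow> close_up_to m n r (C * e x) (snd x) q" by blast
  then show ?thesis unfolding Z_def e_def by (intro exI[of _ C] exI[of _ \<delta>]) force
qed

end

section \<open>Constants that serve all decompositions\<close>

definition valid_decomposition ::
  "nat \<Rightarrow> nat \<Rightarrow> nat \<Rightarrow> nat \<Rightarrow> nat \<Rightarrow> tensor \<Rightarrow> (nat \<Rightarrow> complex) \<Rightarrow> (nat \<Rightarrow> nat \<Rightarrow> complex) \<Rightarrow> bool" where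
  "valid_decomposition m n r p k F \<omega> \<mu> \<longleftrightarrow>
     (\<forall>I\<in>index_tuples m n. F I = (\<Sum>i=1..r. \<omega> i * tensor_power (\<mu> i) I)) \<and>
     (\<forall>i\<in>{1..r}. \<omega> i \<noteq> 0 \<and> \<mu> i 0 \<noteq> 0) \<and>
     lin_indep r (B0 r p k) (\<lambda>i f. mono_eval f (\<mu> i)) \<and>
     (\<forall>\<alpha>\<in>B1 n p k. lin_indep r (O_set m n p k \<alpha>) (\<lambda>i f. mono_eval f (\<mu> i)))"

lemma lin_indep_scale:
  assumes "lin_indep r S a" and "\<And>i. i \<in> {1..r} \<Longrightarrow> b i \<noteq> 0"
    and "\<And>i s. i \<in> {1..r} \<Longrightarrow> s \<in> S \<Longrightarrow> a i s = b i * a' i s"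
  shows "lin_indep r S a'"
  unfolding lin_indep_def
proof (intro allI impI ballI)
  fix d i assume d: "\<forall>s\<in>S. (\<Sum>i=1..r. d i * a' i s) = 0" and i: "i \<in> {1..r}"
  have "(\<Sum>i=1..r. d i / b i * a i s) = 0" if s: "s \<in> S" for s
  proof -
    have "(\<Sum>i=1..r. d i / b i * a i s) = (\<Sum>i=1..r. d i * a' i s)"
      using assms(2,3) s by (intro sum.cong refl) simp
    then show ?thesis using d s by simp
  qed
  then have "d i / b i = 0" using assms(1)[unfolded lin_indep_def, rule_format, of "\<lambda>i. d i / b i" i] i by blast
  then show "d i = 0" using assms(2)[OF i] by simp
qed

lemma normalized_decomposition:
  assumes "1 \<le> p" "p + 2 \<le> m" "p \<le> k" "k + m \<le> n + p" "1 \<le> r"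
    and v: "valid_decomposition m n r p k F \<omega> \<mu>"
  shows "exact_decomposition m n r p k F (\<lambda>i. \<omega> i * \<mu> i 0 ^ m) (\<lambda>i j. \<mu> i j / \<mu> i 0)"
proof -
  define u where "u i j = \<mu> i j / \<mu> i 0" for i j
  have nz: "\<omega> i \<noteq> 0" "\<mu> i 0 \<noteq> 0" if "i \<in> {1..r}" for i
    using v that unfolding valid_decomposition_def by blast+
  have \<mu>: "\<mu> i = (\<lambda>j. \<mu> i 0 * u i j)" if "i \<in> {1..r}" for i
    using nz(2)[OF that] by (simp add: u_def)
  have scale: "mono_eval f (\<mu> i) = \<mu> i 0 ^ size f * mono_eval f (u i)" if "i \<in> {1..r}" for i f
    using arg_cong[OF \<mu>[OF that], of "mono_eval f"] by (simp only: mono_eval_scale)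
  have indep: "lin_indep r S (\<lambda>i f. mono_eval f (u i))"
    if "lin_indep r S (\<lambda>i f. mono_eval f (\<mu> i))" "\<And>f. f \<in> S \<Longrightarrow> size f = d" for S d
    by (rule lin_indep_scale[OF that(1), where b = "\<lambda>i. \<mu> i 0 ^ d"]) (use nz scale that(2) in auto)
  have "exact_decomposition m n r p k F (\<lambda>i. \<omega> i * \<mu> i 0 ^ m) u"
  proof
    fix I assume I: "I \<in> Omega_set m n"
    then have len: "length I = m" "I \<in> index_tuples m n" by (auto simp: Omega_set_def index_tuples_def)
    have summand: "\<omega> i * tensor_power (\<mu> i) I = \<omega> i * \<mu> i 0 ^ m * tensor_power (u i) I" if "i \<in> {1..r}" for i
      using arg_cong[OF \<mu>[OF that], of "\<lambda>v. tensor_power v I"] by (simp only: tensor_power_scale len mult.assoc)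
    have "F I = (\<Sum>i=1..r. \<omega> i * tensor_power (\<mu> i) I)"
      using v len(2) unfolding valid_decomposition_def by blast
    also have "\<dots> = (\<Sum>i=1..r. \<omega> i * \<mu> i 0 ^ m * tensor_power (u i) I)"
      by (intro sum.cong refl summand)
    finally show "F I = (\<Sum>i=1..r. \<omega> i * \<mu> i 0 ^ m * tensor_power (u i) I)" .
  next
    show "lin_indep r (B0 r p k) (\<lambda>i f. mono_eval f (u i))"
    proof (rule indep[where d = p])
      show "lin_indep r (B0 r p k) (\<lambda>i f. mono_eval f (\<mu> i))"
        using v unfolding valid_decomposition_def by blast
      fix f assume "f \<in> B0 r p k"
      then have "f \<in> J1 p k" using B0_subset_J1 by blast
      then show "size f = p" by (simp add: J1_iff)
    qed
    show "lin_indep r (O_set m n p k \<alpha>) (\<lambda>i f. mono_eval f (u i))" if \<alpha>: "\<alpha> \<in> B1 n p k" for \<alpha>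
    proof (rule indep[where d = "m - p - 1"])
      show "lin_indep r (O_set m n p k \<alpha>) (\<lambda>i f. mono_eval f (\<mu> i))"
        using v \<alpha> unfolding valid_decomposition_def by blast
      fix f assume "f \<in> O_set m n p k \<alpha>"
      then show "size f = m - p - 1"
        unfolding O_set_def by (subst (asm) sqfree_monomials_iff) auto
    qed
    show "\<omega> i * \<mu> i 0 ^ m \<noteq> 0" "u i 0 = 1" if "i \<in> {1..r}" for i
      using nz[OF that] by (simp_all add: u_def)
  qed (fact assms)+
  then show ?thesis unfolding u_def .
qed

lemma nondegenerate_normalized:
  assumes nz: "\<And>i. i \<in> {1..r} \<Longrightarrow> \<mu> i 0 \<noteq> 0" and nd: "step3_nondegenerate r p k \<mu>"
  shows "step3_nondegenerate r p k (\<lambda>i j. \<mu> i j / \<mu> i 0)"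
  unfolding step3_nondegenerate_def
proof (intro ballI)
  fix i j assume ij: "i \<in> {1..r}" "j \<in> {1..k}"
  then obtain f where f: "f \<in> J1_without p k j" "mono_eval f (\<mu> i) \<noteq> 0"
    using nd unfolding step3_nondegenerate_def by blast
  have "mono_eval f (\<lambda>j. inverse (\<mu> i 0) * \<mu> i j) \<noteq> 0"
    unfolding mono_eval_scale using f(2) nz[OF ij(1)] by simp
  then have "mono_eval f (\<lambda>j. \<mu> i j / \<mu> i 0) \<noteq> 0" by (simp add: divide_inverse mult.commute)
  then show "\<exists>f\<in>J1_without p k j. mono_eval f (\<lambda>j. \<mu> i j / \<mu> i 0) \<noteq> 0" using f(1) by blast
qed

lemma root_lead: "m > 0 \<Longrightarrow> (\<omega> powr (1 / of_nat m) * z) ^ m = \<omega> * z ^ m" for \<omega> z :: complex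
  by (cases "\<omega> = 0") (simp_all add: power_mult_distrib powr_def exp_of_nat_mult[symmetric])

theorem theorem4p2:
  fixes m n r p k :: nat and F :: tensor and \<xi> :: "nat \<Rightarrow> complex"
  assumes "m \<ge> 3" and "n \<ge> 1" and "r \<ge> 1"
    and "1 \<le> p" and "p \<le> m - 2" and "p \<le> k" and "k + m \<le> n + p"
    and "min (k choose p) ((n - k - 1) choose (m - p - 1)) \<ge> r"
  shows "\<exists>C \<delta> :: real. \<delta> > 0 \<and>
    (\<forall>(\<omega> :: nat \<Rightarrow> complex) (\<mu> :: nat \<Rightarrow> nat \<Rightarrow> complex).
       (\<forall>I\<in>index_tuples m n. F I = (\<Sum>i=1..r. \<omega> i * tensor_power (\<mu> i) I)) \<and>
       (\<forall>i\<in>{1..r}. \<omega> i \<noteq> 0 \<and> \<mu> i 0 \<noteq> 0) \<and>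
       lin_indep r (B0 r p k) (\<lambda>i f. mono_eval f (\<mu> i)) \<and>
       (\<forall>\<alpha>\<in>B1 n p k. lin_indep r (O_set m n p k \<alpha>) (\<lambda>i f. mono_eval f (\<mu> i))) \<and>
       (\<exists>G. solves_linear_systems m n r p k F G \<and>
            distinct_eigenvalues (B0 r p k) (N_xi n k \<xi> G))
       \<longrightarrow>
       (\<forall>(Fh :: tensor) (\<epsilon> :: real).
          symmetric_tensor m n Fh \<and>
          \<epsilon> = frob_norm (Omega_set m n) (\<lambda>I. Fh I - F I) \<and> \<epsilon> < \<delta>
          \<longrightarrow>
          (\<forall>qh. intermediate_vectors m n r p k \<xi> Fh qh \<and> step3_nondegenerate r p k \<mu> \<longrightarrow>
             close_up_to m n r (C * \<epsilon>) qh (\<lambda>i j. \<omega> i powr (1 / of_nat m) * \<mu> i j)) \<and>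
          (\<forall>qs. output_vectors m n r Fh qs \<longrightarrow>
             close_up_to m n r (C * \<epsilon>) qs (\<lambda>i j. \<omega> i powr (1 / of_nat m) * \<mu> i j))))"
proof (cases "\<exists>G. solves_linear_systems m n r p k F G \<and> distinct_eigenvalues (B0 r p k) (N_xi n k \<xi> G)")
  case False
  then show ?thesis by (intro exI[of _ 0] exI[of _ 1]) auto
next
  case True
  then obtain G where G: "solves_linear_systems m n r p k F G"
    "distinct_eigenvalues (B0 r p k) (N_xi n k \<xi> G)" by blast
  have m0: "m > 0" using assms by simp
  define err where "err Fh = frob_norm (Omega_set m n) (\<lambda>I. Fh I - F I)" for Fh
  define Q where "Q \<omega> \<mu> = (\<lambda>i j. \<omega> i powr (1 / of_nat m) * \<mu> i j)"
    for \<omega> :: "nat \<Rightarrow> complex" and \<mu> :: "nat \<Rightarrow> nat \<Rightarrow> complex"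
  define valid where "valid = valid_decomposition m n r p k F"
  have err0: "0 \<le> err Fh" for Fh by (simp add: err_def frob_norm_nonneg)
  have ex: "exact_decomposition m n r p k F (\<lambda>i. \<omega> i * \<mu> i 0 ^ m) (\<lambda>i j. \<mu> i j / \<mu> i 0)"
    if "valid \<omega> \<mu>" for \<omega> \<mu>
    by (rule normalized_decomposition) (use assms that in \<open>simp_all add: valid_def\<close>)
  have lead: "Q \<omega> \<mu> i 0 ^ m = \<omega> i * \<mu> i 0 ^ m" for \<omega> \<mu> i
    unfolding Q_def by (rule root_lead[OF m0])
  have mult: "Q \<omega> \<mu> i j = Q \<omega> \<mu> i 0 * (\<mu> i j / \<mu> i 0)" if "valid \<omega> \<mu>" "i \<in> {1..r}" for \<omega> \<mu> i j
    using that unfolding valid_def valid_decomposition_def Q_def by simp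
  have out: "\<exists>C \<delta>. \<delta> > 0 \<and> (\<forall>Fh qs. output_vectors m n r Fh qs \<longrightarrow> err Fh < \<delta> \<longrightarrow>
      close_up_to m n r (C * err Fh) qs (Q \<omega> \<mu>))" if v: "valid \<omega> \<mu>" for \<omega> \<mu>
    unfolding err_def
    by (rule exact_decomposition.output_vectors_close[OF ex[OF v] G lead mult[OF v]])
  have int: "\<exists>C \<delta>. \<delta> > 0 \<and> (\<forall>Fh qh. intermediate_vectors m n r p k \<xi> Fh qh \<longrightarrow> err Fh < \<delta> \<longrightarrow>
      close_up_to m n r (C * err Fh) qh (Q \<omega> \<mu>))" if v: "valid \<omega> \<mu>" and nd: "step3_nondegenerate r p k \<mu>" for \<omega> \<mu>
    unfolding err_def
  proof (rule exact_decomposition.intermediate_vectors_close[OF ex[OF v] G _ lead mult[OF v]])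
    show "step3_nondegenerate r p k (\<lambda>i j. \<mu> i j / \<mu> i 0)"
      by (rule nondegenerate_normalized[OF _ nd]) (use v in \<open>simp add: valid_def valid_decomposition_def\<close>)
  qed
  \<comment> \<open>Two decompositions of the same tensor give the same vectors: one of them is an output of the
    algorithm applied to the unperturbed tensor.\<close>
  have unique: "close_up_to m n r 0 (Q \<omega> \<mu>) (Q \<omega>' \<mu>')" if v: "valid \<omega> \<mu>" and v': "valid \<omega>' \<mu>'" for \<omega> \<mu> \<omega>' \<mu>'
  proof -
    have "output_vectors m n r F (Q \<omega> \<mu>)"
      unfolding output_vectors_def
    proof (rule minimizer_of_zero_residual)
      fix I assume I: "I \<in> Omega_set m n"
      then have len: "length I = m" "I \<in> index_tuples m n" by (auto simp: Omega_set_def index_tuples_def)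
      have "tensor_power (Q \<omega> \<mu> i) I = \<omega> i * tensor_power (\<mu> i) I" for i
        unfolding Q_def tensor_power_scale len using root_lead[OF m0, of "\<omega> i" 1] by simp
      then show "F I - (\<Sum>i=1..r. tensor_power (Q \<omega> \<mu> i) I) = 0"
        using v len(2) unfolding valid_def valid_decomposition_def by simp
    qed
    moreover have "err F = 0" by (simp add: err_def frob_norm_def L2_set_def)
    ultimately show ?thesis using out[OF v'] by fastforce
  qed
  have uniform: "\<exists>C \<delta>. \<delta> > 0 \<and> (\<forall>\<omega> \<mu> Fh q. valid \<omega> \<mu> \<longrightarrow> K \<mu> \<longrightarrow> R Fh q \<longrightarrow> err Fh < \<delta> \<longrightarrow>
      close_up_to m n r (C * err Fh) q (Q \<omega> \<mu>))"
    if bound: "\<And>\<omega> \<mu>. valid \<omega> \<mu> \<Longrightarrow> K \<mu> \<Longrightarrow> \<exists>C \<delta>. \<delta> > 0 \<and> (\<forall>Fh q. R Fh q \<longrightarrow> err Fh < \<delta> \<longrightarrow>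
      close_up_to m n r (C * err Fh) q (Q \<omega> \<mu>))" for K R
  proof (cases "\<exists>\<omega> \<mu>. valid \<omega> \<mu> \<and> K \<mu>")
    case True
    then obtain \<omega>' \<mu>' where v': "valid \<omega>' \<mu>'" "K \<mu>'" by blast
    from bound[OF v'] obtain C \<delta> where C: "\<delta> > 0" "\<And>Fh q. R Fh q \<Longrightarrow> err Fh < \<delta> \<Longrightarrow>
      close_up_to m n r (C * err Fh) q (Q \<omega>' \<mu>')" by blast
    show ?thesis
      by (rule exI[of _ C], rule exI[of _ \<delta>])
        (use C close_up_to_change_target[OF m0] unique v' in blast)
  qed (use zero_less_one in blast)
  obtain C1 \<delta>1 where 1: "\<delta>1 > 0" "\<And>\<omega> \<mu> Fh qs. valid \<omega> \<mu> \<Longrightarrow> output_vectors m n r Fh qs \<Longrightarrow> err Fh < \<delta>1 \<Longrightarrow>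
      close_up_to m n r (C1 * err Fh) qs (Q \<omega> \<mu>)" using uniform[of "\<lambda>_. True" "output_vectors m n r"] out by blast
  obtain C2 \<delta>2 where 2: "\<delta>2 > 0" "\<And>\<omega> \<mu> Fh qh. valid \<omega> \<mu> \<Longrightarrow> step3_nondegenerate r p k \<mu> \<Longrightarrow>
      intermediate_vectors m n r p k \<xi> Fh qh \<Longrightarrow> err Fh < \<delta>2 \<Longrightarrow>
      close_up_to m n r (C2 * err Fh) qh (Q \<omega> \<mu>)" using uniform[of "step3_nondegenerate r p k" "intermediate_vectors m n r p k \<xi>"] int by blast
  define C where "C = max C1 C2"
  define \<delta> where "\<delta> = min \<delta>1 \<delta>2"
  have le: "C1 * err Fh \<le> C * err Fh" "C2 * err Fh \<le> C * err Fh" for Fh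
    unfolding C_def by (intro mult_right_mono err0; simp)+
  have "close_up_to m n r (C * err Fh) qs (Q \<omega> \<mu>)"
    if "valid \<omega> \<mu>" "output_vectors m n r Fh qs" "err Fh < \<delta>" for \<omega> \<mu> Fh qs
    by (rule close_up_to_mono[OF le(1) 1(2)]) (use that in \<open>simp_all add: \<delta>_def\<close>)
  moreover have "close_up_to m n r (C * err Fh) qh (Q \<omega> \<mu>)"
    if "valid \<omega> \<mu>" "step3_nondegenerate r p k \<mu>" "intermediate_vectors m n r p k \<xi> Fh qh" "err Fh < \<delta>" for \<omega> \<mu> Fh qh
    by (rule close_up_to_mono[OF le(2) 2(2)]) (use that in \<open>simp_all add: \<delta>_def\<close>)
  moreover have "\<delta> > 0" using 1 2 by (simp add: \<delta>_def)
  ultimately show ?thesis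
    unfolding valid_def valid_decomposition_def err_def Q_def
    by (intro exI[of _ C] exI[of _ \<delta>]) blast
qed

end
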